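(* Let $G$ be a connected $n$-node graph with diameter $D$ in the $\mathsf{CONGEST}$ model, each node $v$ holding $\mathrm{val}(v)\in\{1,\dots,N\}\cup\{\mathrm{NULL}\}$ with $N=\mathrm{poly}(n)$. There exists an $O(D+\epsilon^{-2}\log n)$-round algorithm in the $\mathsf{CONGEST}$ model that computes a $1\pm\epsilon$ approximation of $F_0$ and of $F_2$ with high probability. Furthermore, for $p>2$, there exists an $O(D+\epsilon^{-2}\min(n,N)^{1-1/p}\log n)$-round algorithm that computes a $1\pm\epsilon$ approximation of $F_p$ with high probability.
   Context: $f_i=|\{v:\mathrm{val}(v)=i\}|$, $F_p=\sum_{i=1}^N f_i^p$ for $p>0$, $F_0=|\{i:f_i>0\}|$. $\mathsf{CONGEST}$: in each synchronous round each node may send an $O(\log n)$-bit message to each neighbor and then compute locally. A $1\pm\epsilon$ approximation of $F$ is a value in $[(1-\epsilon)F,(1+\epsilon)F]$. With high probability means with probability $1-1/\mathrm{poly}(n)$. *)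

theory Defs
  imports "HOL-Probability.Probability" "Graph_Theory.Digraph_Component"
begin

section \<open>Graphs\<close>

definition graph_dist :: "'v pair_pre_digraph \<Rightarrow> 'v \<Rightarrow> 'v \<Rightarrow> nat" where
  "graph_dist G u v = (LEAST k. (u, v) \<in> parcs G ^^ k)"

definition graph_diameter :: "'v pair_pre_digraph \<Rightarrow> nat" where
  "graph_diameter G = Max {graph_dist G u v | u v. u \<in> pverts G \<and> v \<in> pverts G}"

text \<open>
  A connected simple graph on \<open>n\<close> nodes. Nodes are named by their unique identifiers, which are
  natural numbers of size polynomial in \<open>n\<close>, i.e. of \<open>O(log n)\<close> bits. The bound \<open>c * n ^ c\<close> is
  monotone in \<open>c\<close> and dominates every polynomial in \<open>n \<ge> 1\<close> for a suitable constant \<open>c\<close>.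
\<close>

definition congest_network :: "nat \<Rightarrow> nat \<Rightarrow> nat pair_pre_digraph \<Rightarrow> bool" where
  "congest_network c n G \<longleftrightarrow>
     pair_graph G \<and> Digraph_Component.connected (with_proj G) \<and>
     card (pverts G) = n \<and> pverts G \<subseteq> {..< c * n ^ c}"

section \<open>Randomized algorithms in the CONGEST model\<close>

text \<open>
  \<open>'i\<close> is the type of local inputs, \<open>'s\<close> of local states and \<open>'o\<close> of outputs.
  A node starts from its own identifier, the identifiers of its neighbours and its input.
  In a state \<open>s\<close>, \<open>alg_send A s u\<close> is the bit string (if any) for the neighbour \<open>u\<close>;
  \<open>alg_step A s r\<close> is the local computation after receiving \<open>r u\<close> from each neighbour \<open>u\<close>.
  Private randomness enters through \<open>alg_init\<close> and \<open>alg_step\<close>.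
  A node in a state with \<open>alg_output A s \<noteq> None\<close> has halted.
\<close>

record ('i, 's, 'o) congest_alg =
  alg_init :: "nat \<Rightarrow> nat set \<Rightarrow> 'i \<Rightarrow> 's pmf"
  alg_send :: "'s \<Rightarrow> nat \<Rightarrow> bool list option"
  alg_step :: "'s \<Rightarrow> (nat \<Rightarrow> bool list option) \<Rightarrow> 's pmf"
  alg_output :: "'s \<Rightarrow> 'o option"

definition bandwidth_at_most :: "('i, 's, 'o) congest_alg \<Rightarrow> real \<Rightarrow> bool" where
  "bandwidth_at_most A b \<longleftrightarrow>
     (\<forall>s u m. alg_send A s u = Some m \<longrightarrow> real (length m) \<le> b)"

definition received ::
  "('i, 's, 'o) congest_alg \<Rightarrow> nat pair_pre_digraph \<Rightarrow> (nat \<Rightarrow> 's) \<Rightarrow> nat \<Rightarrow> nat \<Rightarrow> bool list option" where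
  "received A G \<sigma> v u =
     (if (u, v) \<in> parcs G \<and> alg_output A (\<sigma> u) = None then alg_send A (\<sigma> u) v else None)"

text \<open>
  Given the global configuration, the nodes act independently. Halted nodes are silent and keep
  their state, so an output is irrevocable.
\<close>

definition congest_round ::
  "('i, 's, 'o) congest_alg \<Rightarrow> nat pair_pre_digraph \<Rightarrow> (nat \<Rightarrow> 's) \<Rightarrow> (nat \<Rightarrow> 's) pmf" where
  "congest_round A G \<sigma> =
     Pi_pmf (pverts G) undefined
       (\<lambda>v. if alg_output A (\<sigma> v) = None then alg_step A (\<sigma> v) (received A G \<sigma> v)
            else return_pmf (\<sigma> v))"

primrec congest_run ::
  "('i, 's, 'o) congest_alg \<Rightarrow> nat pair_pre_digraph \<Rightarrow> (nat \<Rightarrow> 'i) \<Rightarrow> nat \<Rightarrow> (nat \<Rightarrow> 's) pmf" where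
  "congest_run A G x 0 =
     Pi_pmf (pverts G) undefined (\<lambda>v. alg_init A v {u. (v, u) \<in> parcs G} (x v))"
| "congest_run A G x (Suc t) = bind_pmf (congest_run A G x t) (congest_round A G)"

text \<open>
  Every node surely halts within \<open>R\<close> rounds, and with probability at least \<open>1 - \<delta>\<close> the output
  of every node is acceptable.
\<close>

definition solves_within ::
  "('i, 's, 'o) congest_alg \<Rightarrow> nat pair_pre_digraph \<Rightarrow> (nat \<Rightarrow> 'i) \<Rightarrow> real \<Rightarrow> real \<Rightarrow> ('o \<Rightarrow> bool) \<Rightarrow> bool" where
  "solves_within A G x R \<delta> P \<longleftrightarrow>
     (\<exists>t. real t \<le> R \<and>
        (\<forall>\<sigma> \<in> set_pmf (congest_run A G x t). \<forall>v \<in> pverts G. alg_output A (\<sigma> v) \<noteq> None) \<and>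
        measure_pmf.prob (congest_run A G x t)
          {\<sigma>. \<forall>v \<in> pverts G. \<exists>y. alg_output A (\<sigma> v) = Some y \<and> P y} \<ge> 1 - \<delta>)"

section \<open>Frequency moments\<close>

text \<open>The input \<open>None\<close> stands for NULL.\<close>

definition valid_vals :: "nat \<Rightarrow> 'v set \<Rightarrow> ('v \<Rightarrow> nat option) \<Rightarrow> bool" where
  "valid_vals N V val \<longleftrightarrow> (\<forall>v \<in> V. val v = None \<or> (\<exists>i \<in> {1..N}. val v = Some i))"

definition freq :: "'v set \<Rightarrow> ('v \<Rightarrow> nat option) \<Rightarrow> nat \<Rightarrow> nat" where
  "freq V val i = card {v \<in> V. val v = Some i}"

definition distinct_count :: "nat \<Rightarrow> 'v set \<Rightarrow> ('v \<Rightarrow> nat option) \<Rightarrow> nat" where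
  "distinct_count N V val = card {i \<in> {1..N}. freq V val i > 0}"

definition freq_moment :: "real \<Rightarrow> nat \<Rightarrow> 'v set \<Rightarrow> ('v \<Rightarrow> nat option) \<Rightarrow> real" where
  "freq_moment p N V val = (\<Sum>i = 1..N. real (freq V val i) powr p)"

definition approximates :: "real \<Rightarrow> real \<Rightarrow> real \<Rightarrow> bool" where
  "approximates \<epsilon> F y \<longleftrightarrow> y \<in> {(1 - \<epsilon>) * F .. (1 + \<epsilon>) * F}"

end

theory Submission
  imports Defs
begin

text \<open>
  Suppose first that the nodes share a random string. Then two passes over a blackboard suffice: in
  each pass every node contributes numbers to \<open>K\<close> slots, and each slot is aggregated over all nodes,
  by maximum in the first pass and by sum in the second one.

  \<^item> \<open>F\<^sub>0\<close>: slot \<open>j\<close> holds the maximum of \<open>u\<^sub>j(i)\<close> over the present values \<open>i\<close>, where \<open>u\<^sub>j(i)\<close> is uniform on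
    \<open>{1..2n}\<close>. It is at most \<open>\<theta>\<close> with probability \<open>(\<theta>/2n)^F\<^sub>0\<close>, and Hoeffding's inequality lets one
    read off \<open>F\<^sub>0\<close> from the empirical frequencies.
  \<^item> \<open>F\<^sub>2\<close>: medians of means of squares of random signed sums (Alon, Matias and Szegedy).
  \<^item> \<open>F\<^sub>p\<close>, \<open>p > 2\<close>: the maximum of a random permutation of the identifiers selects a uniform node
    among those with a value; if its value is \<open>i\<close>, then \<open>F\<^sub>1 f\<^sub>i^(p-1)\<close>, with \<open>f\<^sub>i\<close> counted in the second
    pass, is an unbiased estimate of \<open>F\<^sub>p\<close> with second moment
    \<open>F\<^sub>1 F\<^sub>2\<^sub>p\<^sub>-\<^sub>1 \<le> min(n,N)^(1-1/p) F\<^sub>p\<^sup>2\<close>. Medians of means finish the proof.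

  As in Newman's theorem, the shared string can be taken from a fixed list of polynomially many
  strings which is good for all inputs simultaneously, so that an index into the list, drawn by the
  leader, has \<open>O(log n)\<close> bits and travels with the leader's identifier.

  The minimum identifier is flooded together with its seed. The diameter is unknown; the nodes
  test at times \<open>T = 0, 1, 4, 13, \<dots>\<close> whether all neighbours agree on the minimum seen so far, and flood
  any disagreement for \<open>2T\<close> rounds, after which all nodes know whether there was one. At the first
  test without disagreement \<open>T = O(D)\<close>, every node is within distance \<open>T\<close> of the leader, and the
  arrival times of the minimum define a breadth-first tree. Each pass is a pipelined convergecast
  and broadcast on this tree, taking \<open>2(T + K)\<close> rounds.
\<close>

section \<open>Leader election by flooding\<close>

text \<open>This is the smallest identifier within distance \<open>t\<close> of \<open>v\<close>, as
  \<open>ball_min_le\<close> and \<open>ball_min_attained\<close> show. The recursion is what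
  flooding carries out: a round uses only the previous values at the node and its
  neighbours.\<close>

primrec ball_min :: "nat rel \<Rightarrow> nat \<Rightarrow> nat \<Rightarrow> nat" where
  "ball_min E 0 v = v"
| "ball_min E (Suc t) v = Min (insert (ball_min E t v) (ball_min E t ` {u. (u, v) \<in> E}))"

locale network =
  fixes V :: "nat set" and E :: "nat rel"
  assumes finite_V: "finite V" and V_nonempty: "V \<noteq> {}"
    and E_sub: "E \<subseteq> V \<times> V" and sym_E: "sym E"
    and connected_E: "\<And>u v. u \<in> V \<Longrightarrow> v \<in> V \<Longrightarrow> (u, v) \<in> E\<^sup>*"
begin

abbreviation "L \<equiv> ball_min E"

lemma finite_nbrs [simp]: "finite {u. (u, v) \<in> E}"
  by (rule finite_subset[OF _ finite_V]) (use E_sub in auto)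

lemma ball_min_le: "(u, v) \<in> E ^^ k \<Longrightarrow> k \<le> t \<Longrightarrow> L t v \<le> u"
proof (induction t arbitrary: k v)
  case 0
  then show ?case by simp
next
  case (Suc t)
  show ?case
  proof (cases k)
    case 0
    then have "L t v \<le> u" using Suc.IH[of v 0] Suc.prems by simp
    then show ?thesis by (auto simp: Min_le_iff)
  next
    case (Suc k')
    then obtain w where w: "(u, w) \<in> E ^^ k'" "(w, v) \<in> E" using Suc.prems by auto
    then have "L t w \<le> u" using Suc.IH[of w k'] Suc Suc.prems by simp
    then show ?thesis using w by (auto simp: Min_le_iff)
  qed
qed

lemma ball_min_attained: "\<exists>k\<le>t. (L t v, v) \<in> E ^^ k"
proof (induction t arbitrary: v)
  case 0
  then show ?case by simp
next
  case (Suc t)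
  have "L (Suc t) v \<in> insert (L t v) (L t ` {u. (u, v) \<in> E})"
    unfolding ball_min.simps by (rule Min_in) auto
  then consider "L (Suc t) v = L t v" | u where "L (Suc t) v = L t u" "(u, v) \<in> E" by auto
  then show ?case
  proof cases
    case 1
    then show ?thesis using Suc.IH[of v] le_SucI by metis
  next
    case 2
    obtain k where "k \<le> t" "(L t u, u) \<in> E ^^ k" using Suc.IH by blast
    then have "(L t u, v) \<in> E ^^ Suc k" "Suc k \<le> Suc t" using 2 by auto
    then show ?thesis using 2 by metis
  qed
qed

lemma relpow_closed: "(u, v) \<in> E ^^ k \<Longrightarrow> v \<in> V \<Longrightarrow> u \<in> V"
  by (cases k) (use E_sub relpow_Suc_D2 in fastforce)+

lemma relpow_symE: "(u, v) \<in> E ^^ k \<Longrightarrow> (v, u) \<in> E ^^ k"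
proof (induction k arbitrary: u v)
  case (Suc k)
  then obtain w where "(u, w) \<in> E ^^ k" "(w, v) \<in> E" by auto
  then have "(w, u) \<in> E ^^ k" "(v, w) \<in> E" using Suc.IH sym_E by (auto dest: symD)
  then show ?case by (metis relpow_Suc_I2)
qed auto

lemma ball_min_in_V: "v \<in> V \<Longrightarrow> L t v \<in> V"
  using ball_min_attained relpow_closed by blast

definition leader :: nat where "leader = Min V"

lemma leader_in_V: "leader \<in> V" and leader_le: "v \<in> V \<Longrightarrow> leader \<le> v"
  unfolding leader_def using finite_V V_nonempty by auto

lemma ball_min_leader: "L t leader = leader"
proof (rule antisym)
  show "L t leader \<le> leader" by (rule ball_min_le[of _ _ 0]) auto
  show "leader \<le> L t leader" by (intro leader_le ball_min_in_V leader_in_V)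
qed

lemma ball_min_mono: "t \<le> t' \<Longrightarrow> L t' v \<le> L t v"
  using ball_min_attained[of t v] ball_min_le by (meson le_trans)

lemma ball_min_eq_leader_mono: "t \<le> t' \<Longrightarrow> v \<in> V \<Longrightarrow> L t v = leader \<Longrightarrow> L t' v = leader"
  using ball_min_mono[of t t' v] leader_le[OF ball_min_in_V[of v t']] by simp

text \<open>Agreement refers to the global minimum, which no node can verify by itself. The local
  condition \<open>disagree_at\<close>, flooded far enough, serves as a substitute.\<close>

definition agree :: "nat \<Rightarrow> bool" where
  "agree T \<longleftrightarrow> (\<forall>v\<in>V. L T v = leader)"

definition disagree_at :: "nat \<Rightarrow> nat \<Rightarrow> bool" where
  "disagree_at T u \<longleftrightarrow> (\<exists>w. (w, u) \<in> E \<and> L T w \<noteq> L T u)"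

lemma agree_if_diameter_le:
  assumes "\<And>u v. u \<in> V \<Longrightarrow> v \<in> V \<Longrightarrow> \<exists>k\<le>D. (u, v) \<in> E ^^ k" "D \<le> T"
  shows "agree T"
  unfolding agree_def
proof
  fix v assume v: "v \<in> V"
  obtain k where "k \<le> D" "(leader, v) \<in> E ^^ k" using assms(1)[OF leader_in_V v] by blast
  then have "L T v \<le> leader" using assms(2) by (intro ball_min_le[of leader v k T]) auto
  then show "L T v = leader" using leader_le[OF ball_min_in_V[OF v]] by (simp add: antisym)
qed

lemma agree_imp_no_disagreement:
  assumes "agree T" "v \<in> V" shows "\<not> (\<exists>u k. (u, v) \<in> E ^^ k \<and> disagree_at T u)"
proof clarify
  fix u k assume u: "(u, v) \<in> E ^^ k" "disagree_at T u"
  then obtain w where w: "(w, u) \<in> E" "L T w \<noteq> L T u" by (auto simp: disagree_at_def)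
  have "u \<in> V" "w \<in> V" using w E_sub by auto
  with assms w show False by (auto simp: agree_def)
qed

text \<open>If no node within distance \<open>T\<close> of the local leader \<open>m\<close> of \<open>v\<close> sees a disagreement, then
  all nodes within distance \<open>T + 1\<close> of \<open>m\<close> follow \<open>m\<close> and are therefore within distance \<open>T\<close>;
  so this ball is closed under adjacency and is everything.\<close>

lemma disagreement_nearby:
  assumes "\<not> agree T" and v: "v \<in> V"
  shows "\<exists>u k. k \<le> 2 * T \<and> (u, v) \<in> E ^^ k \<and> disagree_at T u"
proof (rule ccontr)
  assume none: "\<not> ?thesis"
  define m where "m = L T v"
  obtain k0 where k0: "k0 \<le> T" "(m, v) \<in> E ^^ k0" using ball_min_attained m_def by blast
  have mV: "m \<in> V" unfolding m_def by (rule ball_min_in_V[OF v])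
  have nodis: "\<not> disagree_at T u" if "(u, m) \<in> E ^^ k" "k \<le> T" for u k
  proof
    assume "disagree_at T u"
    moreover have "(u, v) \<in> E ^^ (k + k0)" using that k0 relpow_add by blast
    moreover have "k + k0 \<le> 2 * T" using that k0 by simp
    ultimately show False using none by blast
  qed
  have same: "L T u = L T m" if "(u, m) \<in> E ^^ k" "k \<le> Suc T" for u k
    using that
  proof (induction k arbitrary: u)
    case (Suc k)
    then obtain w where w: "(u, w) \<in> E" "(w, m) \<in> E ^^ k" by (meson relpow_Suc_D2)
    have "L T w = L T m" using Suc w by auto
    moreover have "\<not> disagree_at T w" using nodis[OF w(2)] Suc by simp
    ultimately show ?case using w by (auto simp: disagree_at_def)
  qed simp
  have Lm: "L T m = m" using same[OF relpow_symE[OF k0(2)]] k0 by (simp add: m_def)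
  have step: "\<exists>k\<le>T. (w, m) \<in> E ^^ k" if "(u, m) \<in> E ^^ k" "k \<le> T" "(w, u) \<in> E" for u w k
  proof -
    have "(w, m) \<in> E ^^ Suc k" using that by (meson relpow_Suc_I2)
    then have "L T w = m" using same Lm that by fastforce
    then show ?thesis using ball_min_attained[of T w] relpow_symE by metis
  qed
  have "\<exists>k\<le>T. (u, m) \<in> E ^^ k" if "u \<in> V" for u
  proof -
    have "(u, m) \<in> E\<^sup>*" using connected_E that mV by blast
    then show ?thesis
    proof (induction rule: converse_rtrancl_induct)
      case base
      show ?case by (rule exI[of _ 0]) simp
    next
      case (step y z)
      then show ?case using \<open>\<And>u w k. \<lbrakk>(u, m) \<in> E ^^ k; k \<le> T; (w, u) \<in> E\<rbrakk> \<Longrightarrow> _\<close> by blast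
    qed
  qed
  then have all: "L T u = m" if "u \<in> V" for u using that same Lm le_SucI by metis
  have "m = leader" using all[OF leader_in_V] ball_min_leader by simp
  with all assms(1) show False by (simp add: agree_def)
qed

end

section \<open>The node program\<close>

text \<open>Stage \<open>0\<close> takes maxima and all later stages take sums. Inserting
  \<open>0\<close> gives the empty maximum a value that is neutral for \<open>comb\<close>.\<close>

definition agg :: "nat \<Rightarrow> ('a \<Rightarrow> nat) \<Rightarrow> 'a set \<Rightarrow> nat" where
  "agg st f A = (if st = 0 then Max (insert 0 (f ` A)) else sum f A)"

definition comb :: "nat \<Rightarrow> nat \<Rightarrow> nat \<Rightarrow> nat" where
  "comb st a b = (if st = 0 then max a b else a + b)"

lemma agg_empty [simp]: "agg st f {} = 0" and comb_0 [simp]: "comb st a 0 = a"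
  by (auto simp: agg_def comb_def)

lemma agg_cong: "A = B \<Longrightarrow> (\<And>a. a \<in> B \<Longrightarrow> f a = h a) \<Longrightarrow> agg st f A = agg st h B"
  by (auto simp: agg_def intro!: sum.cong arg_cong[of _ _ Max] image_cong arg_cong[of _ _ "insert 0"])

text \<open>This is the recursion behind a convergecast: \<open>v\<close> is the root of a subtree
  and the sets \<open>D c\<close> are the subtrees of its children. Disjointness keeps sums from
  counting a node twice.\<close>

lemma agg_insert_UN:
  assumes "finite C" "\<And>c. c \<in> C \<Longrightarrow> finite (D c)"
    and disj: "\<And>c c'. c \<in> C \<Longrightarrow> c' \<in> C \<Longrightarrow> c \<noteq> c' \<Longrightarrow> D c \<inter> D c' = {}"
    and v: "v \<notin> (\<Union>c\<in>C. D c)"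
  shows "agg st f (insert v (\<Union>c\<in>C. D c)) = comb st (f v) (agg st (\<lambda>c. agg st f (D c)) C)"
proof (cases "st = 0")
  case True
  have "Max (insert 0 (f ` (insert v (\<Union>c\<in>C. D c)))) =
        max (f v) (Max (insert 0 ((\<lambda>c. Max (insert 0 (f ` D c))) ` C)))" (is "?l = ?r")
  proof (rule antisym)
    show "?l \<le> ?r"
    proof (rule Max.boundedI)
      show "finite (insert 0 (f ` insert v (\<Union>c\<in>C. D c)))" using assms(1,2) by auto
      fix a assume "a \<in> insert 0 (f ` insert v (\<Union>c\<in>C. D c))"
      then consider "a = 0" | "a = f v" | c w where "c \<in> C" "w \<in> D c" "a = f w" by auto
      then show "a \<le> ?r"
      proof cases
        case 3
        then have "a \<le> Max (insert 0 (f ` D c))" using assms(2) by (intro Max_ge) auto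
        also have "\<dots> \<le> Max (insert 0 ((\<lambda>c. Max (insert 0 (f ` D c))) ` C))"
          using assms(1) 3 by (intro Max_ge) auto
        finally show ?thesis by simp
      qed auto
    qed simp
    show "?r \<le> ?l"
    proof (rule max.boundedI)
      show "f v \<le> ?l" using assms(1,2) by (intro Max_ge) auto
      have "Max (insert 0 (f ` D c)) \<le> ?l" if "c \<in> C" for c
        using assms(1,2) that by (intro Max_mono) auto
      then show "Max (insert 0 ((\<lambda>c. Max (insert 0 (f ` D c))) ` C)) \<le> ?l"
        using assms(1) by (intro Max.boundedI) auto
    qed
  qed
  then show ?thesis using True by (simp add: agg_def comb_def)
next
  case False
  then show ?thesis
    using assms by (simp add: agg_def comb_def sum.UNION_disjoint)
qed

text \<open>
  \<open>Elect v x t T l s d p b\<close>: node \<open>v\<close> with input \<open>x\<close>, in round \<open>t\<close> of the epoch started at time \<open>T\<close>, has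
  seen the minimum \<open>l\<close> with seed \<open>s\<close>, first at time \<open>d\<close> from the neighbour \<open>p\<close>; \<open>b\<close> records a known
  disagreement.

  \<open>Aggr v x st \<tau> T \<delta> p s acc res\<close>: round \<open>\<tau>\<close> of stage \<open>st\<close>; \<open>\<delta>\<close> and \<open>p\<close> are the depth and the parent in the
  tree, \<open>s\<close> is the leader's seed, \<open>acc\<close> the current contents of the slots and \<open>res\<close> the results of the
  previous stages.
\<close>

datatype node_state =
    Elect nat "nat option" nat nat nat nat nat nat bool
  | Aggr nat "nat option" nat nat nat nat nat nat "nat list" "nat list list"

instance node_state :: countable
  by countable_datatype

type_synonym msg = "nat \<times> nat \<times> nat"

locale protocol =
  fixes K :: nat
    and g :: "nat \<Rightarrow> nat \<Rightarrow> nat list list \<Rightarrow> nat \<Rightarrow> nat \<Rightarrow> nat option \<Rightarrow> nat"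
    and out :: "nat \<Rightarrow> nat list list \<Rightarrow> 'o"
begin

text \<open>In rounds \<open>\<tau> < T + K\<close> a node of depth \<open>\<delta>\<close> passes slot \<open>j\<close> to its parent when \<open>\<tau> = T - \<delta> + j\<close>; in round
  \<open>T + K + \<delta> + j\<close> it passes the final value of slot \<open>j\<close> on to its children.\<close>

fun nsend :: "node_state \<Rightarrow> nat \<Rightarrow> msg option" where
  "nsend (Elect v x t T l s d p b) u = Some (l, s, of_bool b)"
| "nsend (Aggr v x st \<tau> T \<delta> p s acc res) u =
    (if \<tau> < T + K
     then if u = p \<and> 0 < \<delta> \<and> T \<le> \<tau> + \<delta> \<and> \<tau> + \<delta> < T + K then Some (acc ! (\<tau> + \<delta> - T), 0, 0) else None
     else if \<delta> \<le> \<tau> - (T + K) \<and> \<tau> - (T + K) < \<delta> + K then Some (acc ! (\<tau> - (T + K) - \<delta>), 0, 0)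
     else None)"

definition contrib :: "nat \<Rightarrow> nat \<Rightarrow> nat list list \<Rightarrow> nat \<Rightarrow> nat option \<Rightarrow> nat list" where
  "contrib st s res v x = map (\<lambda>j. g st s res j v x) [0..<K]"

text \<open>The indices are those of \<open>nsend\<close> seen from the receiver. A child has depth
  \<open>\<delta> + 1\<close>, so it sends slot \<open>\<tau> + \<delta> + 1 - T\<close>; the parent
  has depth \<open>\<delta> - 1\<close>, so it sends slot
  \<open>\<tau> - (T + K) + 1 - \<delta>\<close>.\<close>

fun aggr_acc :: "nat \<Rightarrow> nat \<Rightarrow> nat \<Rightarrow> nat \<Rightarrow> nat \<Rightarrow> nat list \<Rightarrow> (nat \<Rightarrow> msg option) \<Rightarrow> nat list" where
  "aggr_acc st \<tau> T \<delta> p acc r =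
    (if \<tau> < T + K
     then if T \<le> \<tau> + \<delta> + 1 \<and> \<tau> + \<delta> + 1 < T + K
       then acc[\<tau> + \<delta> + 1 - T :=
         comb st (acc ! (\<tau> + \<delta> + 1 - T)) (agg st (\<lambda>u. fst (the (r u))) {u. r u \<noteq> None})]
       else acc
     else if 0 < \<delta> \<and> \<delta> \<le> \<tau> - (T + K) + 1 \<and> \<tau> - (T + K) + 1 < \<delta> + K \<and> r p \<noteq> None
       then acc[\<tau> - (T + K) + 1 - \<delta> := fst (the (r p))]
     else acc)"

text \<open>In round \<open>T\<close> the flag is reset to a comparison with the neighbours; up to
  round \<open>3 * T\<close> it spreads by one hop per round. Then it decides between a new epoch,
  with \<open>T\<close> replaced by \<open>3 * T + 1\<close>, and the aggregation.\<close>

fun nstep :: "node_state \<Rightarrow> (nat \<Rightarrow> msg option) \<Rightarrow> node_state" where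
  "nstep (Elect v x t T l s d p b) r =
    (let R = {u. r u \<noteq> None};
         l' = Min (insert l ((\<lambda>u. fst (the (r u))) ` R));
         p' = (if l' < l then LEAST u. u \<in> R \<and> fst (the (r u)) = l' else p);
         s' = (if l' < l then fst (snd (the (r p'))) else s);
         d' = (if l' < l then Suc t else d);
         b' = (if t = T then \<exists>u\<in>R. fst (the (r u)) \<noteq> l else b \<or> (\<exists>u\<in>R. snd (snd (the (r u))) \<noteq> 0))
     in if t = 3 * T
        then if b' then Elect v x (Suc t) (Suc t) l' s' d' p' b'
          else Aggr v x 0 0 T d' p' s' (contrib 0 s' [] v x) []
        else Elect v x (Suc t) T l' s' d' p' b')"
| "nstep (Aggr v x st \<tau> T \<delta> p s acc res) r =
    (let acc' = aggr_acc st \<tau> T \<delta> p acc r; res' = res @ [acc']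
     in if Suc \<tau> = 2 * (T + K)
        then Aggr v x (Suc st) 0 T \<delta> p s (contrib (Suc st) s res' v x) res'
        else Aggr v x st (Suc \<tau>) T \<delta> p s acc' res)"

fun nout :: "node_state \<Rightarrow> 'o option" where
  "nout (Elect v x t T l s d p b) = None"
| "nout (Aggr v x st \<tau> T \<delta> p s acc res) = (if st = 2 then Some (out s res) else None)"

text \<open>\<open>bandwidth_at_most\<close> speaks of all states, reachable or not. Dropping every
  triple with a component of size at least \<open>M\<close> makes the bandwidth bound unconditional;
  the bounds in \<open>execution\<close> ensure that nothing the protocol relies on is lost.\<close>

definition filt :: "nat \<Rightarrow> msg option \<Rightarrow> msg option" where
  "filt M m = (case m of None \<Rightarrow> None
     | Some (a, b, c) \<Rightarrow> if a < M \<and> b < M \<and> c < M then Some (a, b, c) else None)"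

lemma filt_simps [simp]:
  "filt M None = None"
  "a < M \<Longrightarrow> b < M \<Longrightarrow> c < M \<Longrightarrow> filt M (Some (a, b, c)) = Some (a, b, c)"
  by (auto simp: filt_def)

definition nrecv :: "nat \<Rightarrow> nat rel \<Rightarrow> (nat \<Rightarrow> node_state) \<Rightarrow> nat \<Rightarrow> nat \<Rightarrow> msg option" where
  "nrecv M E \<sigma> v u = (if (u, v) \<in> E \<and> nout (\<sigma> u) = None then filt M (nsend (\<sigma> u) v) else None)"

text \<open>Once the seeds \<open>sd\<close> are fixed the protocol is deterministic, so its
  analysis needs no probability.\<close>

primrec drun :: "nat \<Rightarrow> nat rel \<Rightarrow> (nat \<Rightarrow> nat option) \<Rightarrow> (nat \<Rightarrow> nat) \<Rightarrow> nat \<Rightarrow> nat \<Rightarrow> node_state" where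
  "drun M E x sd 0 = (\<lambda>v. Elect v (x v) 0 0 v (sd v) 0 v False)"
| "drun M E x sd (Suc t) = (\<lambda>v. if nout (drun M E x sd t v) = None
     then nstep (drun M E x sd t v) (nrecv M E (drun M E x sd t) v) else drun M E x sd t v)"

end

section \<open>Invariants of a flooding round\<close>

locale execution = network V E + protocol K g out
  for V :: "nat set" and E :: "nat rel" and K :: nat
    and g :: "nat \<Rightarrow> nat \<Rightarrow> nat list list \<Rightarrow> nat \<Rightarrow> nat \<Rightarrow> nat option \<Rightarrow> nat"
    and out :: "nat \<Rightarrow> nat list list \<Rightarrow> 'o" +
  fixes M :: nat and x :: "nat \<Rightarrow> nat option" and sd :: "nat \<Rightarrow> nat"
  assumes V_less: "V \<subseteq> {..<M}" and two_le_M: "2 \<le> M"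
    and sd_less: "\<And>v. v \<in> V \<Longrightarrow> sd v < M"
    and agg_less: "\<And>st res j S. S \<subseteq> V \<Longrightarrow> agg st (\<lambda>v. g st (sd leader) res j v (x v)) S < M"
begin

abbreviation "\<sigma> \<equiv> drun M E x sd"

text \<open>\<open>d\<close> is the time at which the minimum known at time \<open>t\<close> first
  reached \<open>v\<close>, and \<open>p\<close> is a neighbour that had it one round before. For
  \<open>d = 0\<close> the node is its own minimum and \<open>p\<close> is arbitrary.\<close>

definition bfs_entry :: "nat \<Rightarrow> nat \<Rightarrow> nat \<Rightarrow> nat \<Rightarrow> bool" where
  "bfs_entry t v d p \<longleftrightarrow> (d = 0 \<and> L t v = v) \<or>
     (\<exists>s. d = Suc s \<and> d \<le> t \<and> (p, v) \<in> E \<and> L s p = L t v \<and> L s v \<noteq> L t v \<and> L d v = L t v)"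

definition elect_spec :: "nat \<Rightarrow> nat \<Rightarrow> nat \<Rightarrow> bool \<Rightarrow> bool" where
  "elect_spec t T v b \<longleftrightarrow> (\<exists>d p. \<sigma> t v = Elect v (x v) t T (L t v) (sd (L t v)) d p b \<and> bfs_entry t v d p)"

lemma ball_min_Suc_less: 
  assumes "L (Suc t) v < L t v"
  shows "\<exists>u. (u, v) \<in> E \<and> L t u = L (Suc t) v"
proof -
  have "L (Suc t) v \<in> insert (L t v) (L t ` {u. (u, v) \<in> E})"
    unfolding ball_min.simps by (rule Min_in) auto
  with assms show ?thesis by auto
qed

text \<open>All components of the messages are below \<open>M\<close> and pass the filter. So a node
  sees the exact minima and flags of its neighbours, and the recursion of \<open>ball_min\<close>
  yields the new minimum; its seed arrives with it from the new parent.\<close>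

lemma elect_step:
  assumes all: "\<And>v. v \<in> V \<Longrightarrow> elect_spec t T v (B v)" and v: "v \<in> V"
  defines "b \<equiv> (if t = T then disagree_at t v else B v \<or> (\<exists>u. (u, v) \<in> E \<and> B u))"
  shows "if t = 3 * T
    then if b then elect_spec (Suc t) (Suc t) v b
      else \<exists>d p. bfs_entry (Suc t) v d p \<and> \<sigma> (Suc t) v =
        Aggr v (x v) 0 0 T d p (sd (L (Suc t) v)) (contrib 0 (sd (L (Suc t) v)) [] v (x v)) []
    else elect_spec (Suc t) T v b"
proof -
  obtain d p where s: "\<sigma> t v = Elect v (x v) t T (L t v) (sd (L t v)) d p (B v)"
    and bfs: "bfs_entry t v d p"
    using all[OF v] by (auto simp: elect_spec_def)
  define r where "r = nrecv M E (\<sigma> t) v"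
  have r: "r u = (if (u, v) \<in> E then Some (L t u, sd (L t u), of_bool (B u)) else None)" for u
  proof (cases "(u, v) \<in> E")
    case True
    then have u: "u \<in> V" using E_sub by auto
    then obtain d p where "\<sigma> t u = Elect u (x u) t T (L t u) (sd (L t u)) d p (B u)"
      using all[of u] by (auto simp: elect_spec_def)
    moreover have "L t u < M" "sd (L t u) < M" "of_bool (B u) < M"
      using ball_min_in_V[OF u] V_less sd_less two_le_M by (auto simp: of_bool_def)
    ultimately show ?thesis using True by (simp add: r_def nrecv_def)
  qed (simp add: r_def nrecv_def)
  have R: "{u. r u \<noteq> None} = {u. (u, v) \<in> E}" by (auto simp: r)
  have img: "(\<lambda>u. fst (the (r u))) ` {u. r u \<noteq> None} = L t ` {u. (u, v) \<in> E}"
    unfolding R by (rule image_cong) (auto simp: r)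
  have l': "Min (insert (L t v) ((\<lambda>u. fst (the (r u))) ` {u. r u \<noteq> None})) = L (Suc t) v"
    unfolding img by simp
  define p' where "p' = (if L (Suc t) v < L t v 
    then LEAST u. u \<in> {u. r u \<noteq> None} \<and> fst (the (r u)) = L (Suc t) v else p)"
  define d' where "d' = (if L (Suc t) v < L t v then Suc t else d)"
  have p': "(p', v) \<in> E \<and> L t p' = L (Suc t) v" if less: "L (Suc t) v < L t v"
  proof -
    have "\<exists>u. u \<in> {u. r u \<noteq> None} \<and> fst (the (r u)) = L (Suc t) v"
      using ball_min_Suc_less[OF less] by (auto simp: r)
    from LeastI_ex[OF this] show ?thesis unfolding p'_def using less 
      by (auto simp: r split: if_splits)
  qed
  have eq: "L (Suc t) v = L t v" if "\<not> L (Suc t) v < L t v"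
    using ball_min_mono[of t "Suc t" v] that by (simp del: ball_min.simps)
  have s': "(if L (Suc t) v < L t v then fst (snd (the (r p'))) else sd (L t v)) = sd (L (Suc t) v)"
    using p' eq by (auto simp: r simp del: ball_min.simps)
  have bfs': "bfs_entry (Suc t) v d' p'"
  proof (cases "L (Suc t) v < L t v")
    case True
    then show ?thesis using p' by (auto simp: bfs_entry_def d'_def simp del: ball_min.simps)
  next
    case False
    then show ?thesis using bfs eq unfolding bfs_entry_def d'_def p'_def
      by (auto simp del: ball_min.simps)
  qed
  have b: "(if t = T then \<exists>u\<in>{u. r u \<noteq> None}. fst (the (r u)) \<noteq> L t v
      else B v \<or> (\<exists>u\<in>{u. r u \<noteq> None}. snd (snd (the (r u))) \<noteq> 0)) = b"
    unfolding R b_def disagree_at_def by (auto simp: r)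
  have "\<sigma> (Suc t) v = nstep (Elect v (x v) t T (L t v) (sd (L t v)) d p (B v)) r"
    by (simp add: s r_def)
  also have "\<dots> = (if t = 3 * T
        then if b then Elect v (x v) (Suc t) (Suc t) (L (Suc t) v) (sd (L (Suc t) v)) d' p' b
          else Aggr v (x v) 0 0 T d' p' (sd (L (Suc t) v)) (contrib 0 (sd (L (Suc t) v)) [] v (x v)) []
        else Elect v (x v) (Suc t) T (L (Suc t) v) (sd (L (Suc t) v)) d' p' b)"
    unfolding nstep.simps Let_def l' b p'_def[symmetric] d'_def[symmetric] s' ..
  finally show ?thesis using bfs' unfolding elect_spec_def by (auto simp del: ball_min.simps drun.simps)
qed

end

section \<open>Epochs, termination of the election and the breadth-first tree\<close>

context execution
begin

definition disagreement_within :: "nat \<Rightarrow> nat \<Rightarrow> nat \<Rightarrow> bool" where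
  "disagreement_within T s v \<longleftrightarrow> (\<exists>u k. k \<le> s \<and> (u, v) \<in> E ^^ k \<and> disagree_at T u)"

lemma disagreement_within_0: "disagreement_within T 0 v \<longleftrightarrow> disagree_at T v"
  by (simp add: disagreement_within_def)

lemma disagreement_within_Suc:
  "disagreement_within T (Suc s) v \<longleftrightarrow>
     disagreement_within T s v \<or> (\<exists>u. (u, v) \<in> E \<and> disagreement_within T s u)"
proof
  assume "disagreement_within T (Suc s) v"
  then obtain u k where k: "k \<le> Suc s" "(u, v) \<in> E ^^ k" "disagree_at T u"
    by (auto simp: disagreement_within_def)
  show "disagreement_within T s v \<or> (\<exists>u. (u, v) \<in> E \<and> disagreement_within T s u)"
  proof (cases "k \<le> s")
    case True
    then show ?thesis using k by (auto simp: disagreement_within_def)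
  next
    case False
    then have "k = Suc s" using k by simp
    then obtain w where "(u, w) \<in> E ^^ s" "(w, v) \<in> E" using k by auto
    then show ?thesis using k by (auto simp: disagreement_within_def)
  qed
next
  assume "disagreement_within T s v \<or> (\<exists>u. (u, v) \<in> E \<and> disagreement_within T s u)"
  then show "disagreement_within T (Suc s) v"
  proof
    assume "disagreement_within T s v"
    then show ?thesis unfolding disagreement_within_def using le_SucI by blast
  next
    assume "\<exists>u. (u, v) \<in> E \<and> disagreement_within T s u"
    then obtain u w k where "(u, v) \<in> E" "k \<le> s" "(w, u) \<in> E ^^ k" "disagree_at T w"
      by (auto simp: disagreement_within_def)
    then have "(w, v) \<in> E ^^ Suc k" "Suc k \<le> Suc s" by auto
    then show ?thesis unfolding disagreement_within_def using \<open>disagree_at T w\<close> by blast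
  qed
qed

text \<open>The radius \<open>2 * T\<close> turns the flag into a global predicate that does not
  depend on \<open>v\<close>; hence all nodes leave the epoch in the same way.\<close>

lemma disagreement_within_iff: "v \<in> V \<Longrightarrow> disagreement_within T (2 * T) v \<longleftrightarrow> \<not> agree T"
  using disagreement_nearby[of T v] agree_imp_no_disagreement[of T v]
  unfolding disagreement_within_def by blast

text \<open>The test takes place in round \<open>T\<close>, so the state at time
  \<open>T + 1\<close> carries the flag for \<open>s = 0\<close>. The bound on \<open>s\<close>
  keeps time \<open>T + s + 1\<close> within the epoch.\<close>

lemma elect_within_epoch:
  assumes start: "\<And>v. v \<in> V \<Longrightarrow> elect_spec T T v (B v)"
  shows "s < 2 * T \<Longrightarrow> v \<in> V \<Longrightarrow> elect_spec (Suc (T + s)) T v (disagreement_within T s v)"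
proof (induction s arbitrary: v)
  case 0
  then show ?case using elect_step[OF start, of v] by (auto simp: disagreement_within_0)
next
  case (Suc s)
  then have IH: "\<And>v. v \<in> V \<Longrightarrow> elect_spec (Suc (T + s)) T v (disagreement_within T s v)" by simp
  have "Suc (T + s) \<noteq> 3 * T" using Suc.prems by simp
  then show ?case using elect_step[OF IH Suc.prems(2)]
    by (simp add: disagreement_within_Suc)
qed

lemma epoch_end:
  assumes start: "\<And>v. v \<in> V \<Longrightarrow> elect_spec T T v (B v)" and v: "v \<in> V"
  shows "if agree T
    then \<exists>d p. bfs_entry (Suc (3 * T)) v d p \<and> \<sigma> (Suc (3 * T)) v =
      Aggr v (x v) 0 0 T d p (sd (L (Suc (3 * T)) v)) (contrib 0 (sd (L (Suc (3 * T)) v)) [] v (x v)) []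
    else elect_spec (Suc (3 * T)) (Suc (3 * T)) v True"
\<comment> \<open>For \<open>T = 0\<close> the test round is also the last round of the
  epoch.\<close>
proof (cases "T = 0")
  case True
  have "disagree_at 0 v \<longleftrightarrow> \<not> agree 0"
    using disagreement_within_iff[OF v, of 0] by (simp add: disagreement_within_0)
  then show ?thesis using elect_step[OF start v] unfolding True
    by (auto simp del: ball_min.simps drun.simps)
next
  case False
  \<comment> \<open>After \<open>2 * T - 1\<close> hops the time is \<open>3 * T\<close>; the
    exchange in that round supplies the last hop.\<close>
  define s where "s = 2 * T - 1"
  have s: "Suc (T + s) = 3 * T" "Suc s = 2 * T" using False by (auto simp: s_def)
  have ep: "elect_spec (3 * T) T v (disagreement_within T s v)" if "v \<in> V" for v
    using elect_within_epoch[OF start, of s v] that s by simp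
  have eq: "(disagreement_within T s v \<or> (\<exists>u. (u, v) \<in> E \<and> disagreement_within T s u)) = (\<not> agree T)"
    using disagreement_within_Suc[of T s v] disagreement_within_iff[OF v] s by simp
  show ?thesis using elect_step[OF ep v, unfolded eq] False
    by (cases "agree T") (simp_all del: ball_min.simps drun.simps)
qed

text \<open>A failed test at \<open>T\<close> implies \<open>T < D\<close>, so the next value
  \<open>3 * T + 1\<close> is still at most \<open>3 * D\<close>. This gives an induction on
  \<open>3 * D - T\<close>.\<close>

lemma election:
  assumes diam: "\<And>u v. u \<in> V \<Longrightarrow> v \<in> V \<Longrightarrow> \<exists>k\<le>D. (u, v) \<in> E ^^ k"
  shows "\<exists>T\<le>3 * D. agree T \<and> (\<forall>v\<in>V. \<exists>d p. bfs_entry (Suc (3 * T)) v d p \<and> \<sigma> (Suc (3 * T)) v =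
      Aggr v (x v) 0 0 T d p (sd leader) (contrib 0 (sd leader) [] v (x v)) [])"
proof -
  have "\<exists>T\<le>3 * D. agree T \<and> (\<forall>v\<in>V. \<exists>d p. bfs_entry (Suc (3 * T)) v d p \<and> \<sigma> (Suc (3 * T)) v =
      Aggr v (x v) 0 0 T d p (sd leader) (contrib 0 (sd leader) [] v (x v)) [])"
    if "\<And>v. v \<in> V \<Longrightarrow> elect_spec T T v (B v)" "T \<le> 3 * D" for T B
    using that
  proof (induction "3 * D - T" arbitrary: T B rule: less_induct)
    case less
    show ?case
    proof (cases "agree T")
      case True
      have "L (Suc (3 * T)) v = leader" if "v \<in> V" for v
        using True that ball_min_eq_leader_mono[of T "Suc (3 * T)" v] unfolding agree_def by simp
      then have "\<forall>v\<in>V. \<exists>d p. bfs_entry (Suc (3 * T)) v d p \<and> \<sigma> (Suc (3 * T)) v =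
          Aggr v (x v) 0 0 T d p (sd leader) (contrib 0 (sd leader) [] v (x v)) []"
        using epoch_end[OF less.prems(1)] True by (auto simp del: ball_min.simps drun.simps)
      then show ?thesis using True less.prems(2) by blast
    next
      case False
      then have "T < D" using agree_if_diameter_le[OF diam, of T] by fastforce
      then have "3 * D - Suc (3 * T) < 3 * D - T" "Suc (3 * T) \<le> 3 * D" by auto
      moreover have "elect_spec (Suc (3 * T)) (Suc (3 * T)) v True" if "v \<in> V" for v
        using epoch_end[OF less.prems(1) that] False by simp
      ultimately show ?thesis using less.hyps[of "Suc (3 * T)" "\<lambda>_. True"] by blast
    qed
  qed
  from this[of 0 "\<lambda>_. False"] show ?thesis
    by (auto simp: elect_spec_def bfs_entry_def)
qed

lemma bfs_entry_first:
  assumes "bfs_entry t v d p" "L t v = leader" "v \<in> V"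
  shows "L s v = leader \<longleftrightarrow> d \<le> s"
proof (cases d)
  case 0
  then have "v = leader" using assms by (auto simp: bfs_entry_def)
  then show ?thesis using 0 ball_min_leader by simp
next
  case (Suc s')
  then have "L s' v \<noteq> leader" "L d v = leader" using assms unfolding bfs_entry_def by auto
  then show ?thesis using ball_min_eq_leader_mono[of s s' v] ball_min_eq_leader_mono[of d s v] assms(3) Suc
    by (cases "s \<le> s'") auto
qed

text \<open>\<open>dep v\<close> is the first time at which \<open>v\<close> knows the leader. The
  parent knew it one round earlier, and not before that, since otherwise \<open>v\<close> would have
  learned it sooner.\<close>

lemma bfs_tree:
  assumes "agree T" "T \<le> t" and b: "\<And>v. v \<in> V \<Longrightarrow> bfs_entry t v (dep v) (par v)"
  shows "dep leader = 0"
    and "v \<in> V \<Longrightarrow> dep v \<le> T"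
    and "v \<in> V \<Longrightarrow> v \<noteq> leader \<Longrightarrow> (par v, v) \<in> E \<and> dep v = Suc (dep (par v))"
proof -
  have Lt: "L t v = leader" if "v \<in> V" for v
    using assms that ball_min_eq_leader_mono[of T t v] by (simp add: agree_def)
  have first: "L s v = leader \<longleftrightarrow> dep v \<le> s" if "v \<in> V" for v s
    using bfs_entry_first[OF b[OF that] Lt[OF that] that] .
  show "dep leader = 0" using first[OF leader_in_V, of 0] ball_min_leader by simp
  show "dep v \<le> T" if "v \<in> V" using first[OF that, of T] assms(1) that by (simp add: agree_def)
  assume v: "v \<in> V" "v \<noteq> leader"
  then obtain s where s: "dep v = Suc s" "(par v, v) \<in> E" "L s (par v) = leader"
    using b[OF v(1)] Lt[OF v(1)] by (auto simp: bfs_entry_def)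
  have p: "par v \<in> V" using s E_sub by auto
  have "L (Suc (dep (par v))) v \<le> L (dep (par v)) (par v)"
    using s(2) by auto
  also have "\<dots> = leader" using first[OF p] by simp
  finally have "dep v \<le> Suc (dep (par v))"
    using first[OF v(1)] leader_le[OF ball_min_in_V[OF v(1)], of "Suc (dep (par v))"]
    by (metis antisym)
  moreover have "dep (par v) \<le> s" using first[OF p] s by simp
  ultimately show "(par v, v) \<in> E \<and> dep v = Suc (dep (par v))" using s by simp
qed

end

section \<open>Subtrees of the breadth-first tree\<close>

locale tree_execution = execution V E K g out M x sd
  for V :: "nat set" and E :: "nat rel" and K :: nat
    and g :: "nat \<Rightarrow> nat \<Rightarrow> nat list list \<Rightarrow> nat \<Rightarrow> nat \<Rightarrow> nat option \<Rightarrow> nat"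
    and out :: "nat \<Rightarrow> nat list list \<Rightarrow> 'o"
    and M :: nat and x :: "nat \<Rightarrow> nat option" and sd :: "nat \<Rightarrow> nat" +
  fixes T :: nat and dep par :: "nat \<Rightarrow> nat"
  assumes dep_leader: "dep leader = 0"
    and dep_le: "\<And>v. v \<in> V \<Longrightarrow> dep v \<le> T"
    and par: "\<And>v. v \<in> V \<Longrightarrow> v \<noteq> leader \<Longrightarrow> (par v, v) \<in> E \<and> dep v = Suc (dep (par v))"
begin

lemma par_in_V: "v \<in> V \<Longrightarrow> v \<noteq> leader \<Longrightarrow> par v \<in> V"
  using par E_sub by auto

lemma dep_eq_0_iff: "v \<in> V \<Longrightarrow> dep v = 0 \<longleftrightarrow> v = leader"
  using par dep_leader by force

definition children :: "nat \<Rightarrow> nat set" where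
  "children v = {u \<in> V. u \<noteq> leader \<and> par u = v}"

text \<open>The parent map is iterated exactly as often as the depths differ. Siblings have equal
  depth, so the disjointness of their subtrees is immediate.\<close>

definition desc :: "nat \<Rightarrow> nat set" where
  "desc v = {w \<in> V. dep v \<le> dep w \<and> (par ^^ (dep w - dep v)) w = v}"

lemma par_pow: "w \<in> V \<Longrightarrow> k \<le> dep w \<Longrightarrow> (par ^^ k) w \<in> V \<and> dep ((par ^^ k) w) = dep w - k"
proof (induction k)
  case (Suc k)
  then have IH: "(par ^^ k) w \<in> V" "dep ((par ^^ k) w) = dep w - k" by auto
  then have "(par ^^ k) w \<noteq> leader" using Suc.prems dep_leader by auto
  then show ?case using par[OF IH(1)] par_in_V[OF IH(1)] IH by (simp, linarith)
qed simp

lemma desc_leader: "desc leader = V"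
  unfolding desc_def using par_pow dep_eq_0_iff dep_leader by force

lemma desc_subset: "desc v \<subseteq> V"
  by (auto simp: desc_def)

lemma dep_children: "c \<in> children v \<Longrightarrow> dep c = Suc (dep v)"
  using par by (auto simp: children_def)

lemma desc_unfold:
  assumes v: "v \<in> V"
  shows "desc v = insert v (\<Union>c\<in>children v. desc c)"
proof (intro equalityI subsetI)
  fix w assume w: "w \<in> desc v"
  then have wV: "w \<in> V" and le: "dep v \<le> dep w" and pw: "(par ^^ (dep w - dep v)) w = v"
    by (auto simp: desc_def)
  show "w \<in> insert v (\<Union>c\<in>children v. desc c)"
  proof (cases "dep w - dep v")
    case 0
    then show ?thesis using pw by simp
  next
    case (Suc k)
    define c where "c = (par ^^ k) w"
    have c: "c \<in> V" "dep c = dep w - k" using par_pow[OF wV, of k] Suc by (auto simp: c_def)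
    have "par c = v" using pw Suc by (simp add: c_def)
    moreover have "c \<noteq> leader" using c Suc dep_leader by auto
    moreover have "dep w - dep c = k" "dep c \<le> dep w" using c Suc by auto
    ultimately have "c \<in> children v" "w \<in> desc c"
      using c wV by (auto simp: children_def desc_def c_def)
    then show ?thesis by blast
  qed
next
  fix w assume "w \<in> insert v (\<Union>c\<in>children v. desc c)"
  then consider "w = v" | c where "c \<in> children v" "w \<in> desc c" by blast
  then show "w \<in> desc v"
  proof cases
    case 1
    then show ?thesis using v by (simp add: desc_def)
  next
    case 2
    then have w: "w \<in> V" "dep c \<le> dep w" "(par ^^ (dep w - dep c)) w = c" by (auto simp: desc_def)
    have "dep w - dep v = Suc (dep w - dep c)" using dep_children[OF 2(1)] w by simp
    then show ?thesis using w 2 dep_children[OF 2(1)] by (auto simp: desc_def children_def)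
  qed
qed

lemma desc_disjoint: "c \<in> children v \<Longrightarrow> c' \<in> children v \<Longrightarrow> c \<noteq> c' \<Longrightarrow> desc c \<inter> desc c' = {}"
  using dep_children[of c v] dep_children[of c' v] by (auto simp: desc_def)

lemma not_in_desc_children: "v \<notin> (\<Union>c\<in>children v. desc c)"
proof
  assume "v \<in> (\<Union>c\<in>children v. desc c)"
  then obtain c where "c \<in> children v" "v \<in> desc c" by blast
  then show False using dep_children[of c v] by (simp add: desc_def)
qed

lemma agg_desc:
  assumes "v \<in> V"
  shows "agg st f (desc v) = comb st (f v) (agg st (\<lambda>c. agg st f (desc c)) (children v))"
  unfolding desc_unfold[OF assms]
  by (rule agg_insert_UN)
    (use finite_V desc_subset desc_disjoint not_in_desc_children in
      \<open>auto simp: children_def intro: finite_subset\<close>)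

lemma children_deepest: "v \<in> V \<Longrightarrow> dep v = T \<Longrightarrow> children v = {}"
  using dep_children dep_le by (fastforce simp: children_def)

end

section \<open>Pipelined convergecast and broadcast\<close>

context tree_execution
begin

definition node_at :: "nat \<Rightarrow> nat list list \<Rightarrow> nat \<Rightarrow> nat list \<Rightarrow> nat \<Rightarrow> node_state" where
  "node_at st res \<tau> acc v = Aggr v (x v) st \<tau> T (dep v) (par v) (sd leader) acc res"

abbreviation contribution :: "nat \<Rightarrow> nat list list \<Rightarrow> nat \<Rightarrow> nat \<Rightarrow> nat" where
  "contribution st res j v \<equiv> g st (sd leader) res j v (x v)"

definition total :: "nat \<Rightarrow> nat list list \<Rightarrow> nat \<Rightarrow> nat" where
  "total st res j = agg st (contribution st res j) V"

text \<open>The first clause describes the convergecast: slot \<open>j\<close> is complete for the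
  subtree of \<open>v\<close> from time \<open>T + j - dep v\<close> on. The second describes the
  broadcast, with the root finished from the outset. At the handover, time \<open>T + K\<close>,
  both apply.\<close>

definition acc_inv :: "nat \<Rightarrow> nat list list \<Rightarrow> nat \<Rightarrow> nat \<Rightarrow> nat list \<Rightarrow> bool" where
  "acc_inv st res \<tau> v acc \<longleftrightarrow> length acc = K \<and>
     (\<tau> \<le> T + K \<longrightarrow> (\<forall>j<K. acc ! j = (if T + j \<le> \<tau> + dep v
        then agg st (contribution st res j) (desc v) else contribution st res j v))) \<and>
     (T + K \<le> \<tau> \<longrightarrow> (\<forall>j<K. dep v = 0 \<or> dep v + j \<le> \<tau> - (T + K) \<longrightarrow> acc ! j = total st res j))"

lemma acc_inv_start: "v \<in> V \<Longrightarrow> 0 < K \<Longrightarrow> acc_inv st res 0 v (contrib st (sd leader) res v (x v))"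
proof -
  assume v: "v \<in> V" and K: "0 < K"
  \<comment> \<open>At time \<open>0\<close> the invariant claims complete slots only at depth
    \<open>T\<close>, where the subtree is the node itself.\<close>
  have "agg st (contribution st res j) (desc v) = contribution st res j v" if "T + j \<le> dep v" for j
  proof -
    have "dep v = T" using that dep_le[OF v] by simp
    then show ?thesis using agg_desc[OF v] children_deepest[OF v] by simp
  qed
  then show ?thesis using K by (auto simp: acc_inv_def contrib_def)
qed

lemma acc_inv_convergecast:
  assumes inv: "\<And>v. v \<in> V \<Longrightarrow> acc_inv st res \<tau> v (acc v)" and st: "st < 2" and \<tau>: "\<tau> < T + K"
    and v: "v \<in> V"
    and \<sigma>': "\<And>v. v \<in> V \<Longrightarrow> \<sigma>' v = node_at st res \<tau> (acc v) v"
  shows "acc_inv st res (Suc \<tau>) v (aggr_acc st \<tau> T (dep v) (par v) (acc v) (nrecv M E \<sigma>' v))"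
    (is "acc_inv st res (Suc \<tau>) v ?acc'")
proof -
  have len: "length (acc v) = K" using inv[OF v] by (simp add: acc_inv_def)
  have conv: "acc v ! j = (if T + j \<le> \<tau> + dep v
        then agg st (contribution st res j) (desc v) else contribution st res j v)" if "j < K" "v \<in> V" for j v
    using inv[OF that(2)] that \<tau> by (simp add: acc_inv_def)
  have conv': "?acc' ! j = (if T + j \<le> Suc \<tau> + dep v
        then agg st (contribution st res j) (desc v) else contribution st res j v)" if j: "j < K" for j
  proof (cases "T + j = Suc \<tau> + dep v")
    case False
    then have "?acc' ! j = acc v ! j" using \<tau> j
      by (auto simp: nth_list_update)
    then show ?thesis using conv[OF j v] False by auto
  next
    case True
    \<comment> \<open>In this round slot \<open>j\<close> of \<open>v\<close> is completed: the
      children, one level deeper, completed it a round earlier and send it now, while no other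
      neighbour sends to \<open>v\<close>.\<close>
    have r: "nrecv M E \<sigma>' v u = (if u \<in> children v
      then Some (agg st (contribution st res j) (desc u), 0, 0) else None)" for u
    proof (cases "(u, v) \<in> E")
      case False
      then show ?thesis using par by (auto simp: nrecv_def children_def sym_E[THEN symD])
    next
      case uv: True
      then have u: "u \<in> V" using E_sub by auto
      have s: "\<sigma>' u = node_at st res \<tau> (acc u) u" using \<sigma>'[OF u] .
      show ?thesis
      proof (cases "u \<in> children v")
        case True
        then have du: "dep u = Suc (dep v)" and pu: "par u = v"
          using dep_children by (auto simp: children_def)
        have idx: "\<tau> + dep u - T = j" "T \<le> \<tau> + dep u" "\<tau> + dep u < T + K" "T + j \<le> \<tau> + dep u"
          using \<open>T + j = Suc \<tau> + dep v\<close> du j by auto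
        have "acc u ! j = agg st (contribution st res j) (desc u)"
          using conv[OF j u] idx by simp
        \<comment> \<open>Aggregates of subtrees travel too, which is why \<open>agg_less\<close>
          speaks of arbitrary subsets.\<close>
        moreover have "\<dots> < M" by (rule agg_less[OF desc_subset])
        ultimately show ?thesis using True uv st \<tau> idx du pu two_le_M
          by (simp add: nrecv_def s node_at_def)
      next
        case False
        then have "u = leader \<or> par u \<noteq> v" using u by (simp add: children_def)
        then show ?thesis using False uv st \<tau> dep_leader
          by (auto simp: nrecv_def s node_at_def)
      qed
    qed
    have dom: "{u. nrecv M E \<sigma>' v u \<noteq> None} = children v" by (auto simp: r)
    have "agg st (\<lambda>u. fst (the (nrecv M E \<sigma>' v u))) {u. nrecv M E \<sigma>' v u \<noteq> None}
      = agg st (\<lambda>c. agg st (contribution st res j) (desc c)) (children v)"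
      unfolding dom by (rule agg_cong) (auto simp: r)
    moreover have "acc v ! j = contribution st res j v" using conv[OF j v] True by simp
    moreover have "\<tau> + dep v + 1 - T = j" "T \<le> \<tau> + dep v + 1" "\<tau> + dep v + 1 < T + K"
      using True j by auto
    ultimately have "?acc' ! j = comb st (contribution st res j v)
        (agg st (\<lambda>c. agg st (contribution st res j) (desc c)) (children v))"
      using \<tau> len j by simp
    then show ?thesis using agg_desc[OF v] True by simp
  qed
  \<comment> \<open>When the convergecast ends, the root has aggregated all of \<open>V\<close>;
    this starts the broadcast clause.\<close>
  have "?acc' ! j = total st res j" if "T + K \<le> Suc \<tau>" "j < K" "dep v = 0" for j
  proof -
    have "v = leader" using dep_eq_0_iff[OF v] that by simp
    then show ?thesis using conv'[OF that(2)] that desc_leader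
      by (simp add: total_def del: aggr_acc.simps)
  qed
  moreover have "dep v = 0" if "T + K \<le> Suc \<tau>" "dep v + j \<le> Suc \<tau> - (T + K)" for j
    using that \<tau> by simp
  moreover have "length ?acc' = K" using len by simp
  ultimately show ?thesis unfolding acc_inv_def using conv' by blast
qed

lemma acc_inv_broadcast:
  assumes inv: "\<And>v. v \<in> V \<Longrightarrow> acc_inv st res \<tau> v (acc v)" and st: "st < 2"
    and \<tau>: "T + K \<le> \<tau>" and v: "v \<in> V"
    and \<sigma>': "\<And>v. v \<in> V \<Longrightarrow> \<sigma>' v = node_at st res \<tau> (acc v) v"
  shows "acc_inv st res (Suc \<tau>) v (aggr_acc st \<tau> T (dep v) (par v) (acc v) (nrecv M E \<sigma>' v))"
    (is "acc_inv st res (Suc \<tau>) v ?acc'")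
proof -
  have len: "length (acc v) = K" using inv[OF v] by (simp add: acc_inv_def)
  define \<tau>' where "\<tau>' = \<tau> - (T + K)"
  have bc: "acc v ! j = total st res j" if "j < K" "v \<in> V" "dep v = 0 \<or> dep v + j \<le> \<tau>'" for j v
    using inv[OF that(2)] that \<tau> unfolding acc_inv_def \<tau>'_def by blast
  have new: "?acc' ! j = total st res j" if j: "j < K" and c: "dep v = 0 \<or> dep v + j \<le> Suc \<tau>'" for j
  proof (cases "0 < dep v \<and> dep v + j = Suc \<tau>'")
    case False
    then have "?acc' ! j = acc v ! j" using \<tau> j by (auto simp: nth_list_update \<tau>'_def)
    then show ?thesis using bc[OF j v] False c by auto
  next
    case True
    then have nl: "v \<noteq> leader" using dep_leader by auto
    define u where "u = par v"
    have u: "u \<in> V" "(u, v) \<in> E" "dep v = Suc (dep u)"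
      using par[OF v nl] par_in_V[OF v nl] by (auto simp: u_def)
    have s: "\<sigma>' u = node_at st res \<tau> (acc u) u" using \<sigma>'[OF u(1)] .
    have idx: "\<tau>' - dep u = j" "dep u \<le> \<tau>'" "\<tau>' < dep u + K" "dep u + j \<le> \<tau>'" using True u j by auto
    have "acc u ! j = total st res j" using bc[OF j u(1)] idx by simp
    moreover have "total st res j < M" unfolding total_def by (rule agg_less) simp
    ultimately have "nrecv M E \<sigma>' v u = Some (total st res j, 0, 0)"
      using u st \<tau> idx two_le_M by (simp add: nrecv_def s node_at_def \<tau>'_def[symmetric])
    moreover have "\<tau>' + 1 - dep v = j" "dep v \<le> \<tau>' + 1" "\<tau>' + 1 < dep v + K" using True j by auto
    ultimately show ?thesis using True \<tau> len j
      by (simp add: \<tau>'_def[symmetric] u_def[symmetric])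
  qed
  have "length ?acc' = K" using len by simp
  moreover have "Suc \<tau> - (T + K) = Suc \<tau>'" using \<tau> by (simp add: \<tau>'_def)
  moreover have "\<not> Suc \<tau> \<le> T + K" using \<tau> by simp
  ultimately show ?thesis unfolding acc_inv_def using new by metis
qed

lemma stage_running:
  assumes st: "st < 2" and K: "0 < K"
    and start: "\<And>v. v \<in> V \<Longrightarrow> \<sigma> t0 v = node_at st res 0 (contrib st (sd leader) res v (x v)) v"
  shows "\<tau> < 2 * (T + K) \<Longrightarrow>
    \<exists>acc. \<forall>v\<in>V. \<sigma> (t0 + \<tau>) v = node_at st res \<tau> (acc v) v \<and> acc_inv st res \<tau> v (acc v)"
proof (induction \<tau>)
  case 0
  show ?case
    by (rule exI[of _ "\<lambda>v. contrib st (sd leader) res v (x v)"])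
      (use start acc_inv_start K in auto)
next
  case (Suc \<tau>)
  then obtain acc where acc: "\<And>v. v \<in> V \<Longrightarrow> \<sigma> (t0 + \<tau>) v = node_at st res \<tau> (acc v) v"
    "\<And>v. v \<in> V \<Longrightarrow> acc_inv st res \<tau> v (acc v)" by auto
  define acc' where "acc' v = aggr_acc st \<tau> T (dep v) (par v) (acc v) (nrecv M E (\<sigma> (t0 + \<tau>)) v)" for v
  have "\<sigma> (t0 + Suc \<tau>) v = node_at st res (Suc \<tau>) (acc' v) v" if "v \<in> V" for v
    using acc(1)[OF that] st Suc.prems
    by (simp add: node_at_def acc'_def Let_def del: aggr_acc.simps)
  moreover have "acc_inv st res (Suc \<tau>) v (acc' v)" if "v \<in> V" for v
    unfolding acc'_def
    by (cases "\<tau> < T + K") (use acc_inv_convergecast[OF acc(2) st _ that acc(1)]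
      acc_inv_broadcast[OF acc(2) st _ that acc(1)] in \<open>auto simp del: aggr_acc.simps\<close>)
  ultimately show ?case by blast
qed

lemma stage:
  assumes st: "st < 2" and K: "0 < K"
    and start: "\<And>v. v \<in> V \<Longrightarrow> \<sigma> t0 v = node_at st res 0 (contrib st (sd leader) res v (x v)) v"
    and v: "v \<in> V"
  defines "res' \<equiv> res @ [map (total st res) [0..<K]]"
  shows "\<sigma> (t0 + 2 * (T + K)) v = node_at (Suc st) res' 0 (contrib (Suc st) (sd leader) res' v (x v)) v"
proof -
  \<comment> \<open>The last round is treated apart, because \<open>nstep\<close> then enters the
    next stage. By time \<open>2 * (T + K)\<close> even slot \<open>K - 1\<close> has reached depth
    \<open>T\<close>.\<close>
  define \<tau> where "\<tau> = 2 * (T + K) - 1"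
  have \<tau>: "Suc \<tau> = 2 * (T + K)" using K by (simp add: \<tau>_def)
  obtain acc where acc: "\<And>v. v \<in> V \<Longrightarrow> \<sigma> (t0 + \<tau>) v = node_at st res \<tau> (acc v) v"
    "\<And>v. v \<in> V \<Longrightarrow> acc_inv st res \<tau> v (acc v)" 
    using stage_running[OF st K start, of \<tau>] \<tau> by auto
  define acc' where "acc' = aggr_acc st \<tau> T (dep v) (par v) (acc v) (nrecv M E (\<sigma> (t0 + \<tau>)) v)"
  have "acc_inv st res (Suc \<tau>) v acc'"
    unfolding acc'_def
    by (rule acc_inv_broadcast[OF acc(2) st _ v acc(1)]) (use K \<tau> in auto)
  then have "length acc' = K" "\<forall>j<K. acc' ! j = total st res j"
    using dep_le[OF v] by (auto simp: acc_inv_def \<tau>)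
  then have "acc' = map (total st res) [0..<K]" by (intro nth_equalityI) auto
  then have res': "res' = res @ [acc']" by (simp add: res'_def)
  have "\<sigma> (Suc (t0 + \<tau>)) v = node_at (Suc st) res' 0 (contrib (Suc st) (sd leader) res' v (x v)) v"
    using acc(1)[OF v] st \<tau> unfolding res' acc'_def
    by (simp add: node_at_def Let_def del: aggr_acc.simps)
  moreover have "Suc (t0 + \<tau>) = t0 + 2 * (T + K)" using \<tau> by simp
  ultimately show ?thesis by (simp only:)
qed

end

text \<open>This is the ideal computation that the network simulates: the result of the first pass
  is public when the contributions to the second are formed.\<close>

definition blackboard :: "nat \<Rightarrow> (nat \<Rightarrow> nat list list \<Rightarrow> nat \<Rightarrow> nat \<Rightarrow> nat option \<Rightarrow> nat) \<Rightarrow>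
    nat set \<Rightarrow> (nat \<Rightarrow> nat option) \<Rightarrow> nat list list" where
  "blackboard K \<gamma> V x =
    (let b1 = map (\<lambda>j. agg 0 (\<lambda>v. \<gamma> 0 [] j v (x v)) V) [0..<K];
         b2 = map (\<lambda>j. agg 1 (\<lambda>v. \<gamma> 1 [b1] j v (x v)) V) [0..<K]
     in [b1, b2])"

context protocol
begin

lemma drun_halted: "nout (drun M E x sd t v) = Some y \<Longrightarrow> t \<le> t' \<Longrightarrow> nout (drun M E x sd t' v) = Some y"
  by (induction t') (auto simp: le_Suc_eq)

end

context execution
begin

text \<open>The election ends at time \<open>3 * T + 1\<close> and each of the two stages takes
  \<open>2 * (T + K)\<close> rounds. With \<open>T \<le> 3 * D\<close> this is at most
  \<open>21 * D + 4 * K + 1\<close>, and halted nodes keep their outputs.\<close>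

lemma execution_correct:
  assumes diam: "\<And>u v. u \<in> V \<Longrightarrow> v \<in> V \<Longrightarrow> \<exists>k\<le>D. (u, v) \<in> E ^^ k" and K: "0 < K"
  shows "v \<in> V \<Longrightarrow> nout (\<sigma> (21 * D + 4 * K + 1) v) =
    Some (out (sd leader) (blackboard K (\<lambda>st. g st (sd leader)) V x))"
proof -
  assume v: "v \<in> V"
  define b1 where "b1 = map (\<lambda>j. agg 0 (\<lambda>v. g 0 (sd leader) [] j v (x v)) V) [0..<K]"
  define b2 where "b2 = map (\<lambda>j. agg 1 (\<lambda>v. g 1 (sd leader) [b1] j v (x v)) V) [0..<K]"
  obtain T where T: "T \<le> 3 * D" "agree T" 
    and "\<forall>v\<in>V. \<exists>d p. bfs_entry (Suc (3 * T)) v d p \<and> \<sigma> (Suc (3 * T)) v =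
      Aggr v (x v) 0 0 T d p (sd leader) (contrib 0 (sd leader) [] v (x v)) []"
    using election[OF diam] by blast
  then obtain dep par where b: "\<And>v. v \<in> V \<Longrightarrow> bfs_entry (Suc (3 * T)) v (dep v) (par v)"
    and s: "\<And>v. v \<in> V \<Longrightarrow> \<sigma> (Suc (3 * T)) v =
      Aggr v (x v) 0 0 T (dep v) (par v) (sd leader) (contrib 0 (sd leader) [] v (x v)) []"
    by metis
  interpret tree_execution V E K g out M x sd T dep par
    using bfs_tree[OF T(2) _ b] by unfold_locales auto
  define t1 where "t1 = Suc (3 * T) + 2 * (T + K)"
  have 1: "\<sigma> t1 v = node_at 1 [b1] 0 (contrib 1 (sd leader) [b1] v (x v)) v" if "v \<in> V" for v
    using stage[of 0 "Suc (3 * T)" "[]" v] s that K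
    by (simp add: node_at_def t1_def b1_def total_def[abs_def] del: drun.simps)
  have 2: "\<sigma> (t1 + 2 * (T + K)) v = node_at 2 [b1, b2] 0
      (contrib 2 (sd leader) [b1, b2] v (x v)) v" if "v \<in> V" for v
    using stage[of 1 t1 "[b1]" v] 1 that K
    by (simp add: b2_def total_def[abs_def] numeral_2_eq_2 del: drun.simps)
  have "nout (\<sigma> (t1 + 2 * (T + K)) v) = Some (out (sd leader) [b1, b2])"
    using 2[OF v] by (simp add: node_at_def)
  moreover have "t1 + 2 * (T + K) \<le> 21 * D + 4 * K + 1" using T(1) by (simp add: t1_def)
  ultimately have "nout (\<sigma> (21 * D + 4 * K + 1) v) = Some (out (sd leader) [b1, b2])"
    by (rule drun_halted)
  also have "[b1, b2] = blackboard K (\<lambda>st. g st (sd leader)) V x"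
    unfolding blackboard_def Let_def b1_def b2_def ..
  finally show ?thesis .
qed

end

text \<open>There are \<open>M ^ 3\<close> admissible triples and \<open>2 ^ b\<close> strings of
  length \<open>b\<close>, so an injective code exists by counting.\<close>

lemma message_encoding:
  assumes "M ^ 3 \<le> 2 ^ b"
  shows "\<exists>(e :: msg \<Rightarrow> bool list) d. \<forall>p q r. p < M \<and> q < M \<and> r < M \<longrightarrow>
    length (e (p, q, r)) = b \<and> d (e (p, q, r)) = (p, q, r)"
proof -
  define A where "A = {..<M} \<times> {..<M} \<times> {..<M}"
  define B where "B = {xs :: bool list. length xs = b}"
  have B: "finite B" "card B = 2 ^ b"
    using finite_lists_length_eq[of "UNIV :: bool set" b] card_lists_length_eq[of "UNIV :: bool set" b]
    by (auto simp: B_def)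
  have "card A \<le> card B" using assms B by (simp add: A_def power3_eq_cube card_cartesian_product)
  then obtain e where e: "e ` A \<subseteq> B" "inj_on e A"
    using card_le_inj[of A B] B by (auto simp: A_def)
  have "length (e (p, q, r)) = b \<and> the_inv_into A e (e (p, q, r)) = (p, q, r)"
    if "p < M" "q < M" "r < M" for p q r
  proof -
    have "(p, q, r) \<in> A" using that by (simp add: A_def)
    then show ?thesis using e the_inv_into_f_f by (auto simp: B_def)
  qed
  then show ?thesis by (intro exI[of _ e] exI[of _ "the_inv_into A e"]) blast
qed

section \<open>From the node program to an algorithm of the model\<close>

context protocol
begin

text \<open>States are encoded as natural numbers. All randomness is spent at the start: every node
  draws a seed, since none knows yet who the leader is.\<close>

definition compiled :: "(msg \<Rightarrow> bool list) \<Rightarrow> (bool list \<Rightarrow> msg) \<Rightarrow> nat \<Rightarrow> nat \<Rightarrow>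
    (nat option, nat, 'o) congest_alg" where
  "compiled e d M S = \<lparr>
     alg_init = \<lambda>v nb x. map_pmf (\<lambda>s. to_nat (Elect v x 0 0 v s 0 v False)) (pmf_of_set {..<S}),
     alg_send = \<lambda>s u. map_option e (filt M (nsend (from_nat s) u)),
     alg_step = \<lambda>s r. return_pmf (to_nat (nstep (from_nat s) (\<lambda>u. map_option d (r u)))),
     alg_output = \<lambda>s. nout (from_nat s)\<rparr>"

definition valid_code :: "(msg \<Rightarrow> bool list) \<Rightarrow> (bool list \<Rightarrow> msg) \<Rightarrow> nat \<Rightarrow> nat \<Rightarrow> bool" where
  "valid_code e d M b \<longleftrightarrow> (\<forall>p q r. p < M \<and> q < M \<and> r < M \<longrightarrow>
    length (e (p, q, r)) = b \<and> d (e (p, q, r)) = (p, q, r))"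

lemma filt_range: "filt M m = Some z \<Longrightarrow> \<exists>p q r. z = (p, q, r) \<and> p < M \<and> q < M \<and> r < M"
  by (auto simp: filt_def split: option.splits prod.splits if_splits)

lemma bandwidth_compiled:
  assumes "valid_code e d M b"
  shows "bandwidth_at_most (compiled e d M S) (real b)"
  unfolding bandwidth_at_most_def
proof (intro allI impI)
  fix s u m assume "alg_send (compiled e d M S) s u = Some m"
  then obtain z where z: "filt M (nsend (from_nat s) u) = Some z" "m = e z"
    by (auto simp: compiled_def)
  then show "real (length m) \<le> real b"
    using filt_range[OF z(1)] assms by (auto simp: valid_code_def)
qed

text \<open>After the initial draw every round is a deterministic map, so the run is the image of
  independent uniform seeds under \<open>drun\<close>.\<close>

lemma run_compiled:
  assumes code: "valid_code e d M b" and fin: "finite (pverts G)"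
    and E: "parcs G \<subseteq> pverts G \<times> pverts G"
  shows "congest_run (compiled e d M S) G x t =
    map_pmf (\<lambda>sd v. if v \<in> pverts G then to_nat (drun M (parcs G) x sd t v) else undefined)
      (Pi_pmf (pverts G) 0 (\<lambda>_. pmf_of_set {..<S}))"
proof (induction t)
  case 0
  show ?case
    unfolding congest_run.simps drun.simps map_pmf_def
    by (simp add: compiled_def map_pmf_def Pi_pmf_bind[OF fin, where d' = 0] Pi_pmf_return_pmf[OF fin])
next
  case (Suc t)
  have round: "congest_round (compiled e d M S) G
      (\<lambda>v. if v \<in> pverts G then to_nat (drun M (parcs G) x sd t v) else undefined) =
    return_pmf (\<lambda>v. if v \<in> pverts G then to_nat (drun M (parcs G) x sd (Suc t) v) else undefined)"
    (is "congest_round ?A G ?\<sigma> = _") for sd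
  proof -
    have "map_option d (received ?A G ?\<sigma> v u) = nrecv M (parcs G) (drun M (parcs G) x sd t) v u" for v u
    proof (cases "(u, v) \<in> parcs G")
      case True
      then have "u \<in> pverts G" using E by auto
      moreover have "map_option d (map_option e (filt M m)) = filt M m" for m
        using filt_range[of M m] code by (cases "filt M m") (auto simp: valid_code_def)
      ultimately show ?thesis using True by (simp add: received_def nrecv_def compiled_def del: map_option_eq_Some)
    qed (simp add: received_def nrecv_def)
    then have r: "(\<lambda>u. map_option d (received ?A G ?\<sigma> v u)) =
        nrecv M (parcs G) (drun M (parcs G) x sd t) v" for v by blast
    have "congest_round ?A G ?\<sigma> =
      Pi_pmf (pverts G) undefined (\<lambda>v. return_pmf (to_nat (drun M (parcs G) x sd (Suc t) v)))"
      unfolding congest_round_def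
    proof (rule Pi_pmf_cong)
      fix v assume v: "v \<in> pverts G"
      have "alg_step ?A (?\<sigma> v) (received ?A G ?\<sigma> v) = return_pmf (to_nat
          (nstep (drun M (parcs G) x sd t v) (nrecv M (parcs G) (drun M (parcs G) x sd t) v)))"
        using v r[of v] by (simp add: compiled_def)
      then show "(if alg_output ?A (?\<sigma> v) = None then alg_step ?A (?\<sigma> v) (received ?A G ?\<sigma> v)
            else return_pmf (?\<sigma> v)) = return_pmf (to_nat (drun M (parcs G) x sd (Suc t) v))"
        using v by (simp add: compiled_def)
    qed auto
    then show ?thesis by (simp add: Pi_pmf_return_pmf[OF fin] del: drun.simps)
  qed
  show ?case
    unfolding congest_run.simps Suc.IH
    by (simp only: bind_map_pmf round) (simp add: map_pmf_def)
qed

text \<open>The output depends on the seed of the leader alone, which is uniform on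
  \<open>{..<S}\<close>. The failure probability is thus the proportion of bad seeds.\<close>

lemma compiled_solves:
  assumes code: "valid_code e d M b" and net: "network (pverts G) (parcs G)"
    and diam: "\<And>u v. u \<in> pverts G \<Longrightarrow> v \<in> pverts G \<Longrightarrow> \<exists>k\<le>D. (u, v) \<in> parcs G ^^ k"
    and K: "0 < K" and VM: "pverts G \<subseteq> {..<M}" and M: "2 \<le> M" and S: "0 < S" "S \<le> M"
    and bound: "\<And>st s res j W. s < S \<Longrightarrow> W \<subseteq> pverts G \<Longrightarrow> agg st (\<lambda>v. g st s res j v (x v)) W < M"
    and R: "21 * real D + 4 * real K + 1 \<le> R"
    and bad: "real (card {s. s < S \<and> \<not> P (out s (blackboard K (\<lambda>st. g st s) (pverts G) x))})
      \<le> \<delta> * real S"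
  shows "solves_within (compiled e d M S) G x R \<delta> P"
proof -
  interpret network "pverts G" "parcs G" by (rule net)
  let ?V = "pverts G" and ?A = "compiled e d M S"
  define t where "t = 21 * D + 4 * K + 1"
  define y where "y s = out s (blackboard K (\<lambda>st. g st s) ?V x)" for s
  let ?p = "Pi_pmf ?V 0 (\<lambda>_. pmf_of_set {..<S})"
  let ?h = "\<lambda>sd v. if v \<in> ?V then to_nat (drun M (parcs G) x sd t v) else undefined"
  have ne: "{..<S} \<noteq> {}" using S by auto
  have run: "congest_run ?A G x t = map_pmf ?h ?p"
    by (rule run_compiled[OF code finite_V E_sub])
  have out: "alg_output ?A (?h sd v) = Some (y (sd leader))" if sd: "sd \<in> set_pmf ?p" and v: "v \<in> ?V" for sd v
  proof -
    have sdS: "sd v < S" if "v \<in> ?V" for v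
      using sd that ne by (auto simp: set_Pi_pmf[OF finite_V] PiE_dflt_def set_pmf_of_set)
    interpret execution ?V "parcs G" K g out M x sd
    proof
      fix v assume "v \<in> ?V"
      then show "sd v < M" using sdS S(2) by (meson less_le_trans)
    qed (use VM M bound[OF sdS[OF leader_in_V]] in auto)
    show ?thesis using execution_correct[OF diam K v] v by (simp add: compiled_def y_def t_def)
  qed
  have "1 - \<delta> \<le> measure (pmf_of_set {..<S}) {s. P (y s)}"
  proof -
    have "card ({..<S} \<inter> {s. P (y s)}) + card {s. s < S \<and> \<not> P (y s)} = S"
      by (subst card_Un_disjoint[symmetric]) (auto intro!: arg_cong[of _ _ card, where y = "{..<S}", simplified])
    then have "real (card ({..<S} \<inter> {s. P (y s)})) \<ge> real S - \<delta> * real S"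
      using bad unfolding y_def by linarith
    then show ?thesis using S ne by (simp add: measure_pmf_of_set field_simps)
  qed
  also have "measure (pmf_of_set {..<S}) {s. P (y s)} = measure ?p {sd. P (y (sd leader))}"
  proof -
    have eq: "pmf_of_set {..<S} = map_pmf (\<lambda>sd. sd leader) ?p"
      by (subst Pi_pmf_component[OF finite_V]) (simp add: leader_in_V)
    show ?thesis by (subst eq) (simp only: measure_map_pmf vimage_Collect_eq)
  qed
  also have "\<dots> \<le> measure (congest_run ?A G x t) {\<sigma>. \<forall>v\<in>?V. \<exists>z. alg_output ?A (\<sigma> v) = Some z \<and> P z}"
    unfolding run measure_map_pmf
  proof (rule measure_pmf.finite_measure_mono_AE)
    show "AE sd in ?p. sd \<in> {sd. P (y (sd leader))} \<longrightarrow>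
        sd \<in> ?h -` {\<sigma>. \<forall>v\<in>?V. \<exists>z. alg_output ?A (\<sigma> v) = Some z \<and> P z}"
      unfolding AE_measure_pmf_iff using out by blast
  qed simp
  finally have prob: "1 - \<delta> \<le> \<dots>" .
  have "real t \<le> R" using R by (simp add: t_def)
  moreover have "\<forall>\<sigma>\<in>set_pmf (congest_run ?A G x t). \<forall>v\<in>?V. alg_output ?A (\<sigma> v) \<noteq> None"
    unfolding run using out by auto
  ultimately show ?thesis unfolding solves_within_def using prob by blast
qed

end

section \<open>Concentration and estimators\<close>

lemma map_pmf_mem_eq_bernoulli: "map_pmf (\<lambda>a. a \<in> B) p = bernoulli_pmf (measure_pmf.prob p B)"
proof (rule pmf_eqI)
  fix b :: bool
  have q: "measure_pmf.prob p B \<in> {0..1}" by simp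
  show "pmf (map_pmf (\<lambda>a. a \<in> B) p) b = pmf (bernoulli_pmf (measure_pmf.prob p B)) b"
  proof (cases b)
    case True
    then show ?thesis by (simp add: pmf_map vimage_def)
  next
    case False
    have "(\<lambda>a. a \<in> B) -` {False} = UNIV - B" by auto
    then show ?thesis using False measure_pmf.prob_compl[of B p] by (simp add: pmf_map)
  qed
qed

text \<open>The number of independent samples that fall into \<open>B\<close> is binomial, so
  Hoeffding's inequality for binomial distributions applies to it.\<close>

lemma map_pmf_card_eq_binomial:
  "map_pmf (\<lambda>\<omega>. card {i. i < L \<and> \<omega> i \<in> B}) (Pi_pmf {..<L} d (\<lambda>_. p)) =
     binomial_pmf L (measure_pmf.prob p B)"
proof -
  have "binomial_pmf L (measure_pmf.prob p B) =
      map_pmf (\<lambda>f. card {x \<in> {..<L}. f x}) (Pi_pmf {..<L} (d \<in> B) (\<lambda>_. map_pmf (\<lambda>a. a \<in> B) p))"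
    unfolding map_pmf_mem_eq_bernoulli by (rule binomial_pmf_altdef') auto
  also have "Pi_pmf {..<L} (d \<in> B) (\<lambda>_. map_pmf (\<lambda>a. a \<in> B) p) =
      map_pmf (\<lambda>h. (\<lambda>a. a \<in> B) \<circ> h) (Pi_pmf {..<L} d (\<lambda>_. p))"
    by (rule Pi_pmf_map) auto
  finally show ?thesis by (simp add: pmf.map_comp o_def)
qed

lemma hoeffding_Pi_pmf:
  fixes p :: "'a pmf" and d :: 'a and L :: nat and \<eta> :: real
  assumes "0 < L" "0 \<le> \<eta>"
  defines "P \<equiv> Pi_pmf {..<L} d (\<lambda>_. p)"
  shows "measure_pmf.prob P {\<omega>. real (card {i. i < L \<and> \<omega> i \<in> B}) / real L \<ge> measure_pmf.prob p B + \<eta>}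
      \<le> exp (- 2 * real L * \<eta>\<^sup>2)"
    and "measure_pmf.prob P {\<omega>. \<bar>real (card {i. i < L \<and> \<omega> i \<in> B}) / real L - measure_pmf.prob p B\<bar> \<ge> \<eta>}
      \<le> 2 * exp (- 2 * real L * \<eta>\<^sup>2)"
proof -
  interpret binomial_distribution L "measure_pmf.prob p B" by unfold_locales simp
  have conv: "measure_pmf.prob P {\<omega>. Q (card {i. i < L \<and> \<omega> i \<in> B})} =
      measure_pmf.prob (binomial_pmf L (measure_pmf.prob p B)) {x. Q x}" for Q
    unfolding map_pmf_card_eq_binomial[of L B d p, symmetric] P_def by (simp add: vimage_def)
  show "measure_pmf.prob P {\<omega>. real (card {i. i < L \<and> \<omega> i \<in> B}) / real L \<ge> measure_pmf.prob p B + \<eta>}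
      \<le> exp (- 2 * real L * \<eta>\<^sup>2)"
    using prob_ge'[OF assms(1,2)]
      conv[of "\<lambda>k. real k / real L \<ge> measure_pmf.prob p B + \<eta>"] by simp
  show "measure_pmf.prob P {\<omega>. \<bar>real (card {i. i < L \<and> \<omega> i \<in> B}) / real L - measure_pmf.prob p B\<bar> \<ge> \<eta>}
      \<le> 2 * exp (- 2 * real L * \<eta>\<^sup>2)"
    using prob_abs_ge'[OF assms(1,2)]
      conv[of "\<lambda>k. \<bar>real k / real L - measure_pmf.prob p B\<bar> \<ge> \<eta>"] by simp
qed

text \<open>For \<open>S\<close> independent strings, the proportion that is bad for a given
  \<open>z\<close> exceeds its mean by \<open>\<delta> / 2\<close> with probability at most
  \<open>exp (- (S * \<delta>\<^sup>2 / 2))\<close>. The union bound over \<open>X\<close> stays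
  below \<open>1\<close>, so some list is good for all \<open>z\<close> at once.\<close>

lemma random_string_list:
  fixes p :: "'a pmf"
  assumes X: "finite X" and bad: "\<And>z. z \<in> X \<Longrightarrow> measure_pmf.prob p (Bad z) \<le> \<delta> / 2"
    and "0 < \<delta>" "0 < S" and small: "real (card X) * exp (- (real S * \<delta>\<^sup>2 / 2)) < 1"
  shows "\<exists>\<omega>. (\<forall>s<S. \<omega> s \<in> set_pmf p) \<and> (\<forall>z\<in>X. real (card {s. s < S \<and> \<omega> s \<in> Bad z}) \<le> \<delta> * real S)"
proof -
  define d where "d = (SOME a. a \<in> set_pmf p)"
  define P where "P = Pi_pmf {..<S} d (\<lambda>_. p)"
  define C where "C z = {\<omega>. real (card {s. s < S \<and> \<omega> s \<in> Bad z}) > \<delta> * real S}" for z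
  have C: "measure_pmf.prob P (C z) \<le> exp (- (real S * \<delta>\<^sup>2 / 2))" if z: "z \<in> X" for z
  proof -
    have "measure_pmf.prob P (C z) \<le> measure_pmf.prob P
        {\<omega>. real (card {i. i < S \<and> \<omega> i \<in> Bad z}) / real S \<ge> measure_pmf.prob p (Bad z) + \<delta> / 2}"
    proof (rule measure_pmf.finite_measure_mono)
      show "C z \<subseteq> {\<omega>. real (card {i. i < S \<and> \<omega> i \<in> Bad z}) / real S \<ge> measure_pmf.prob p (Bad z) + \<delta> / 2}"
      proof
        fix \<omega> assume "\<omega> \<in> C z"
        then have "real (card {i. i < S \<and> \<omega> i \<in> Bad z}) / real S > \<delta>"
          using assms(4) by (simp add: C_def pos_less_divide_eq)
        then show "\<omega> \<in> {\<omega>. real (card {i. i < S \<and> \<omega> i \<in> Bad z}) / real S \<ge> measure_pmf.prob p (Bad z) + \<delta> / 2}"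
          using bad[OF z] by simp
      qed
    qed simp
    also have "\<dots> \<le> exp (- 2 * real S * (\<delta> / 2)\<^sup>2)"
      unfolding P_def by (rule hoeffding_Pi_pmf) (use assms in auto)
    finally show ?thesis by (simp add: power2_eq_square mult_ac)
  qed
  have "measure_pmf.prob P (\<Union>z\<in>X. C z) \<le> (\<Sum>z\<in>X. measure_pmf.prob P (C z))"
    by (rule measure_pmf.finite_measure_subadditive_finite) (use X in auto)
  also have "\<dots> \<le> (\<Sum>z\<in>X. exp (- (real S * \<delta>\<^sup>2 / 2)))" by (rule sum_mono) (rule C)
  also have "\<dots> < 1" using small by simp
  finally have "measure_pmf.prob P (\<Union>z\<in>X. C z) < 1" .
  then have "\<not> set_pmf P \<subseteq> (\<Union>z\<in>X. C z)"
    using measure_pmf.prob_eq_1[of "\<Union>z\<in>X. C z" P] by (auto simp: AE_measure_pmf_iff)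
  then obtain \<omega> where \<omega>: "\<omega> \<in> set_pmf P" "\<omega> \<notin> (\<Union>z\<in>X. C z)" by blast
  have "\<omega> s \<in> set_pmf p" if "s < S" for s
    using \<omega>(1) that by (auto simp: P_def set_Pi_pmf PiE_dflt_def)
  then show ?thesis using \<omega>(2) by (intro exI[of _ \<omega>]) (auto simp: C_def not_less)
qed

section \<open>Chebyshev's inequality and medians of means\<close>

lemma expectation_Pi_pmf_insert:
  fixes h :: "('a \<Rightarrow> 'b) \<Rightarrow> real"
  assumes "finite I" "i \<notin> I" "finite (set_pmf (p i))" "\<And>j. j \<in> I \<Longrightarrow> finite (set_pmf (p j))"
  shows "measure_pmf.expectation (Pi_pmf (insert i I) d p) h =
    measure_pmf.expectation (p i) (\<lambda>y. measure_pmf.expectation (Pi_pmf I d p) (\<lambda>f. h (f(i := y))))"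
proof -
  have fin: "finite (set_pmf (Pi_pmf I d p))"
    using assms by (auto simp: set_Pi_pmf intro!: finite_PiE_dflt)
  have "Pi_pmf (insert i I) d p = p i \<bind> (\<lambda>y. map_pmf (\<lambda>f. f(i := y)) (Pi_pmf I d p))"
    using assms(1,2) by (simp add: Pi_pmf_insert' map_pmf_def)
  then have "measure_pmf.expectation (Pi_pmf (insert i I) d p) h =
     (\<Sum>y\<in>set_pmf (p i). pmf (p i) y *\<^sub>R
        measure_pmf.expectation (map_pmf (\<lambda>f. f(i := y)) (Pi_pmf I d p)) h)"
    by (simp only:) (rule pmf_expectation_bind, use assms fin in auto)
  also have "\<dots> = measure_pmf.expectation (p i) (\<lambda>y. measure_pmf.expectation (Pi_pmf I d p) (\<lambda>f. h (f(i := y))))"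
    using assms(3) by (subst integral_measure_pmf[of "set_pmf (p i)"]) auto
  finally show ?thesis .
qed

lemma finite_set_Pi_pmf:
  "finite I \<Longrightarrow> (\<And>j. j \<in> I \<Longrightarrow> finite (set_pmf (p j))) \<Longrightarrow> finite (set_pmf (Pi_pmf I d p))"
  by (auto simp: set_Pi_pmf intro!: finite_PiE_dflt)

text \<open>The variances of independent variables add up. The mean of the partial sum is carried
  along in the induction, because it removes the cross term.\<close>

lemma second_moment_centered_sum:
  fixes Y :: "'b \<Rightarrow> real"
  assumes I: "finite I" and fin: "finite (set_pmf p)" and mean: "measure_pmf.expectation p Y = 0"
  shows "measure_pmf.expectation (Pi_pmf I d (\<lambda>_. p)) (\<lambda>\<omega>. \<Sum>j\<in>I. Y (\<omega> j)) = 0 \<and>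
    measure_pmf.expectation (Pi_pmf I d (\<lambda>_. p)) (\<lambda>\<omega>. (\<Sum>j\<in>I. Y (\<omega> j))\<^sup>2) =
      card I * measure_pmf.expectation p (\<lambda>y. (Y y)\<^sup>2)"
  using I
proof (induction I rule: finite_induct)
  case empty
  then show ?case by simp
next
  case (insert i I)
  let ?P = "Pi_pmf I d (\<lambda>_. p)"
  have [simp]: "integrable (measure_pmf ?P) h" for h :: "_ \<Rightarrow> real"
    by (intro integrable_measure_pmf_finite finite_set_Pi_pmf insert.hyps fin)
  have [simp]: "integrable (measure_pmf p) h" for h :: "_ \<Rightarrow> real"
    by (intro integrable_measure_pmf_finite fin)
  have upd: "(\<Sum>j\<in>insert i I. Y ((f(i := y)) j)) = Y y + (\<Sum>j\<in>I. Y (f j))" for f y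
  proof -
    have "(\<Sum>j\<in>I. Y ((f(i := y)) j)) = (\<Sum>j\<in>I. Y (f j))"
      using insert.hyps by (intro sum.cong) auto
    then show ?thesis using insert.hyps by simp
  qed
  show ?case
    unfolding expectation_Pi_pmf_insert[OF insert.hyps fin fin] upd
    using insert mean by (simp add: power2_sum algebra_simps)
qed

text \<open>This is Chebyshev's inequality for the sum of the centered variables, whose variance is
  at most \<open>b * A * F\<^sup>2\<close>.\<close>

lemma mean_concentration:
  fixes X :: "'a \<Rightarrow> real"
  assumes fin: "finite (set_pmf p)" and EX: "measure_pmf.expectation p X = F"
    and EX2: "measure_pmf.expectation p (\<lambda>a. (X a)\<^sup>2) \<le> A * F\<^sup>2"
    and F: "0 \<le> F" and \<xi>: "0 < \<xi>" and b: "0 < b" and A: "0 \<le> A"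
  shows "measure_pmf.prob (Pi_pmf {..<b} d (\<lambda>_. p)) {\<omega>. \<bar>(\<Sum>j<b. X (\<omega> j)) / real b - F\<bar> > \<xi> * F}
    \<le> A / (real b * \<xi>\<^sup>2)"
proof (cases "F = 0")
  case True
  have int: "integrable (measure_pmf p) h" for h :: "_ \<Rightarrow> real"
    by (intro integrable_measure_pmf_finite fin)
  \<comment> \<open>For \<open>F = 0\<close> the threshold vanishes and Chebyshev's inequality says
    nothing; but the second moment is then \<open>0\<close> too, so \<open>X\<close> is zero on the
    support.\<close>
  have "measure_pmf.expectation p (\<lambda>a. (X a)\<^sup>2) = 0"
    using EX2 True by (intro antisym Bochner_Integration.integral_nonneg) auto
  then have "AE a in p. (X a)\<^sup>2 = 0"
    using integral_nonneg_eq_0_iff_AE[OF int, of "\<lambda>a. (X a)\<^sup>2"] by simp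
  then have X0: "X a = 0" if "a \<in> set_pmf p" for a using that by (simp add: AE_measure_pmf_iff)
  have "measure_pmf.prob (Pi_pmf {..<b} d (\<lambda>_. p)) {\<omega>. \<bar>(\<Sum>j<b. X (\<omega> j)) / real b - F\<bar> > \<xi> * F} = 0"
    using X0 True by (auto simp: measure_pmf_zero_iff set_Pi_pmf PiE_dflt_def intro!: sum.neutral)
  then show ?thesis using A by simp
next
  case False
  let ?P = "Pi_pmf {..<b} d (\<lambda>_. p)"
  define Y where "Y a = X a - F" for a
  have int [simp]: "integrable (measure_pmf p) h" for h :: "_ \<Rightarrow> real"
    by (intro integrable_measure_pmf_finite fin)
  have EY: "measure_pmf.expectation p Y = 0" unfolding Y_def using EX by simp
  have "measure_pmf.expectation p (\<lambda>a. (Y a)\<^sup>2) = measure_pmf.expectation p (\<lambda>a. (X a)\<^sup>2) - F\<^sup>2"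
    unfolding Y_def power2_diff using EX by (simp add: power2_eq_square algebra_simps)
  then have EY2: "measure_pmf.expectation p (\<lambda>a. (Y a)\<^sup>2) \<le> A * F\<^sup>2" using EX2 by (smt (verit) zero_le_power2)
  define a where "a = real b * \<xi> * F"
  have a: "0 < a" using b \<xi> F False by (simp add: a_def)
  have "measure_pmf.prob ?P {\<omega>. \<bar>(\<Sum>j<b. X (\<omega> j)) / real b - F\<bar> > \<xi> * F} \<le>
     measure_pmf.prob ?P {\<omega>\<in>space ?P. \<bar>\<Sum>j<b. Y (\<omega> j)\<bar> \<ge> a}"
  proof (rule measure_pmf.finite_measure_mono)
    show "{\<omega>. \<bar>(\<Sum>j<b. X (\<omega> j)) / real b - F\<bar> > \<xi> * F} \<subseteq> {\<omega>\<in>space ?P. \<bar>\<Sum>j<b. Y (\<omega> j)\<bar> \<ge> a}"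
    proof
      fix \<omega> assume "\<omega> \<in> {\<omega>. \<bar>(\<Sum>j<b. X (\<omega> j)) / real b - F\<bar> > \<xi> * F}"
      moreover have "(\<Sum>j<b. Y (\<omega> j)) = real b * ((\<Sum>j<b. X (\<omega> j)) / real b - F)"
        using b by (simp add: Y_def sum_subtractf field_simps)
      ultimately show "\<omega> \<in> {\<omega>\<in>space ?P. \<bar>\<Sum>j<b. Y (\<omega> j)\<bar> \<ge> a}"
        using b by (simp add: abs_mult a_def mult.assoc)
    qed
  qed simp
  also have "\<dots> \<le> measure_pmf.expectation ?P (\<lambda>\<omega>. (\<Sum>j<b. Y (\<omega> j))\<^sup>2) / a\<^sup>2"
    by (rule measure_pmf.second_moment_method)
      (use a in \<open>auto intro!: integrable_measure_pmf_finite finite_set_Pi_pmf fin\<close>)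
  also have "\<dots> = real b * measure_pmf.expectation p (\<lambda>y. (Y y)\<^sup>2) / a\<^sup>2"
    using second_moment_centered_sum[OF finite_lessThan fin EY, of b d] by simp
  also have "\<dots> \<le> real b * (A * F\<^sup>2) / a\<^sup>2"
    using EY2 by (intro divide_right_mono mult_left_mono) auto
  also have "\<dots> = A / (real b * \<xi>\<^sup>2)"
    using b \<xi> False by (simp add: a_def power2_eq_square field_simps)
  finally show ?thesis .
qed

text \<open>By the choice of \<open>b\<close>, a group mean fails with probability at most
  \<open>1 / 4\<close>. That half of the groups fail is then a deviation by
  \<open>\<eta> \<ge> 1 / 4\<close>, and Hoeffding's exponent \<open>2 * L / 16\<close> is
  \<open>L / 8\<close>.\<close>

lemma median_of_means:
  fixes X :: "'a \<Rightarrow> real"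
  assumes fin: "finite (set_pmf p)" and EX: "measure_pmf.expectation p X = F"
    and EX2: "measure_pmf.expectation p (\<lambda>a. (X a)\<^sup>2) \<le> A * F\<^sup>2"
    and F: "0 \<le> F" and \<xi>: "0 < \<xi>" and b: "0 < b" "4 * A / \<xi>\<^sup>2 \<le> real b" and A: "0 \<le> A" and L: "0 < L"
  shows "measure_pmf.prob (Pi_pmf {..<L} d' (\<lambda>_. Pi_pmf {..<b} d (\<lambda>_. p)))
    {\<omega>. \<not> L < 2 * card {i. i < L \<and> \<bar>(\<Sum>j<b. X (\<omega> i j)) / real b - F\<bar> \<le> \<xi> * F}} \<le> exp (- real L / 8)"
proof -
  let ?Q = "Pi_pmf {..<b} d (\<lambda>_. p)"
  let ?P = "Pi_pmf {..<L} d' (\<lambda>_. ?Q)"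
  define B where "B = {\<omega>. \<bar>(\<Sum>j<b. X (\<omega> j)) / real b - F\<bar> > \<xi> * F}"
  define \<eta> where "\<eta> = 1 / 2 - measure_pmf.prob ?Q B"
  have "measure_pmf.prob ?Q B \<le> A / (real b * \<xi>\<^sup>2)"
    unfolding B_def by (rule mean_concentration) fact+
  also have "\<dots> \<le> 1 / 4" using b \<xi> A by (simp add: field_simps)
  finally have \<eta>: "1 / 4 \<le> \<eta>" by (simp add: \<eta>_def)
  have "measure_pmf.prob ?P
    {\<omega>. \<not> L < 2 * card {i. i < L \<and> \<bar>(\<Sum>j<b. X (\<omega> i j)) / real b - F\<bar> \<le> \<xi> * F}} \<le>
    measure_pmf.prob ?P {\<omega>. real (card {i. i < L \<and> \<omega> i \<in> B}) / real L \<ge> measure_pmf.prob ?Q B + \<eta>}"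
  proof (rule measure_pmf.finite_measure_mono, rule subsetI)
    fix \<omega> assume "\<omega> \<in> {\<omega>. \<not> L < 2 * card {i. i < L \<and> \<bar>(\<Sum>j<b. X (\<omega> i j)) / real b - F\<bar> \<le> \<xi> * F}}"
    then have le: "2 * card {i. i < L \<and> \<omega> i \<notin> B} \<le> L" by (simp add: B_def not_less)
    have "card {i. i < L \<and> \<omega> i \<notin> B} + card {i. i < L \<and> \<omega> i \<in> B} = card {..<L}"
      by (subst card_Un_disjoint[symmetric]) (auto intro!: arg_cong[where f = card] simp del: card_lessThan)
    then have "L \<le> 2 * card {i. i < L \<and> \<omega> i \<in> B}" using le by simp
    then have "real L \<le> 2 * real (card {i. i < L \<and> \<omega> i \<in> B})" by linarith
    then show "\<omega> \<in> {\<omega>. real (card {i. i < L \<and> \<omega> i \<in> B}) / real L \<ge> measure_pmf.prob ?Q B + \<eta>}"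
      using L by (simp add: \<eta>_def field_simps)
  qed simp
  also have "\<dots> \<le> exp (- 2 * real L * \<eta>\<^sup>2)"
    by (rule hoeffding_Pi_pmf) (use L \<eta> in auto)
  also have "\<dots> \<le> exp (- real L / 8)"
  proof -
    have "(1 / 4)\<^sup>2 \<le> \<eta>\<^sup>2" using \<eta> by (intro power_mono) auto
    then have "real L * (1 / 4)\<^sup>2 \<le> real L * \<eta>\<^sup>2" by (intro mult_left_mono) auto
    then show ?thesis by (simp add: power2_eq_square)
  qed
  finally show ?thesis .
qed

text \<open>Any two values fitting more than half of the group means fit a common one; this replaces the median.\<close>

definition majority_value :: "nat \<Rightarrow> real \<Rightarrow> (nat \<Rightarrow> real) \<Rightarrow> real" where
  "majority_value L \<xi> m = (SOME y. 0 \<le> y \<and> L < 2 * card {i. i < L \<and> \<bar>m i - y\<bar> \<le> \<xi> * y})"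

lemma majority_value_approximates:
  assumes F: "0 \<le> F" "L < 2 * card {i. i < L \<and> \<bar>m i - F\<bar> \<le> \<epsilon> / 3 * F}" and \<epsilon>: "0 < \<epsilon>" "\<epsilon> < 1"
  shows "approximates \<epsilon> F (majority_value L (\<epsilon> / 3) m)"
proof -
  define y where "y = majority_value L (\<epsilon> / 3) m"
  define \<xi> where "\<xi> = \<epsilon> / 3"
  have y: "0 \<le> y" "L < 2 * card {i. i < L \<and> \<bar>m i - y\<bar> \<le> \<xi> * y}"
    using someI[of "\<lambda>y. 0 \<le> y \<and> L < 2 * card {i. i < L \<and> \<bar>m i - y\<bar> \<le> \<xi> * y}" F] F
    by (auto simp: y_def majority_value_def \<xi>_def)
  let ?A = "{i. i < L \<and> \<bar>m i - F\<bar> \<le> \<xi> * F}" and ?B = "{i. i < L \<and> \<bar>m i - y\<bar> \<le> \<xi> * y}"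
  have "?A \<inter> ?B \<noteq> {}"
  proof
    assume "?A \<inter> ?B = {}"
    then have "card ?A + card ?B = card (?A \<union> ?B)" by (intro card_Un_disjoint[symmetric]) auto
    also have "\<dots> \<le> card {..<L}" by (intro card_mono) auto
    finally show False using y F by (simp add: \<xi>_def)
  qed
  then obtain i where i: "\<bar>m i - F\<bar> \<le> \<xi> * F" "\<bar>m i - y\<bar> \<le> \<xi> * y" by auto
  have 1: "(1 - \<xi>) * y \<le> (1 + \<xi>) * F" and 2: "(1 - \<xi>) * F \<le> (1 + \<xi>) * y"
    using i by (simp_all add: abs_le_iff algebra_simps)
  \<comment> \<open>For \<open>3 * \<xi> < 1\<close> the quotient of \<open>1 + \<xi>\<close> by
    \<open>1 - \<xi>\<close> and its inverse lie between \<open>1 - 3 * \<xi>\<close> and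
    \<open>1 + 3 * \<xi>\<close>. Hence the accuracy \<open>\<epsilon> / 3\<close> of the
    means.\<close>
  have \<xi>: "0 < \<xi>" "3 * \<xi> < 1" using \<epsilon> by (auto simp: \<xi>_def)
  have "(1 + \<xi>) * F \<le> ((1 - \<xi>) * (1 + 3 * \<xi>)) * F"
    using \<xi> F by (intro mult_right_mono) (simp_all add: algebra_simps)
  then have "(1 - \<xi>) * y \<le> (1 - \<xi>) * ((1 + 3 * \<xi>) * F)" using 1 by (simp add: mult.assoc)
  then have up: "y \<le> (1 + 3 * \<xi>) * F" using \<xi> by simp
  have "((1 + \<xi>) * (1 - 3 * \<xi>)) * F \<le> (1 - \<xi>) * F"
    using \<xi> F by (intro mult_right_mono) (simp_all add: algebra_simps)
  then have "(1 + \<xi>) * ((1 - 3 * \<xi>) * F) \<le> (1 + \<xi>) * y" using 2 by (simp add: mult.assoc)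
  then have lo: "(1 - 3 * \<xi>) * F \<le> y" using \<xi> by simp
  have "3 * \<xi> = \<epsilon>" by (simp add: \<xi>_def)
  with up lo show ?thesis unfolding approximates_def y_def by simp
qed

section \<open>Counting distinct values by maxima of random numbers\<close>

lemma prob_all_le:
  fixes N m \<theta> d :: nat
  assumes "I \<subseteq> {1..N}" "0 < m" "\<theta> \<le> m"
  shows "measure_pmf.prob (Pi_pmf {1..N} d (\<lambda>_. pmf_of_set {1..m})) {u. \<forall>i\<in>I. u i \<le> \<theta>} =
    (real \<theta> / real m) ^ card I"
proof -
  have "{u. \<forall>i\<in>I. u i \<le> \<theta>} = Pi {1..N} (\<lambda>i. if i \<in> I then {..\<theta>} else UNIV)"
    using assms(1) by (fastforce simp: Pi_def)
  then have "measure_pmf.prob (Pi_pmf {1..N} d (\<lambda>_. pmf_of_set {1..m})) {u. \<forall>i\<in>I. u i \<le> \<theta>} =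
     (\<Prod>i\<in>{1..N}. measure_pmf.prob (pmf_of_set {1..m}) (if i \<in> I then {..\<theta>} else UNIV))"
    by (simp only: measure_Pi_pmf_Pi[OF finite_atLeastAtMost])
  also have "\<dots> = (\<Prod>i\<in>{1..N}. if i \<in> I then real \<theta> / real m else 1)"
  proof (intro prod.cong refl)
    fix i
    have "{1..m} \<inter> {..\<theta>} = {1..\<theta>}" using assms by auto
    then show "measure_pmf.prob (pmf_of_set {1..m}) (if i \<in> I then {..\<theta>} else UNIV) =
        (if i \<in> I then real \<theta> / real m else 1)"
      using assms by (simp add: measure_pmf_of_set)
  qed
  also have "\<dots> = (\<Prod>i\<in>I. real \<theta> / real m)"
    using assms(1) by (simp add: prod.If_cases Int_absorb1)
  finally show ?thesis by simp
qed

text \<open>A maximum of \<open>y\<close> independent uniform numbers from \<open>{1..m}\<close> has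
  distribution function \<open>(\<theta> / m) ^ y\<close>. The empirical distribution is compared at
  all thresholds, since the informative one depends on the unknown count.\<close>

definition fits_distinct :: "nat \<Rightarrow> nat \<Rightarrow> real \<Rightarrow> (nat \<Rightarrow> nat) \<Rightarrow> nat \<Rightarrow> bool" where
  "fits_distinct K m \<eta> h y \<longleftrightarrow>
     (\<forall>\<theta>\<le>m. \<bar>real (card {j. j < K \<and> h j \<le> \<theta>}) / real K - (real \<theta> / real m) ^ y\<bar> < \<eta>)"

lemma prob_not_fits_distinct:
  fixes N m d :: nat
  assumes "I \<subseteq> {1..N}" "0 < m" "0 < K" "0 \<le> \<eta>"
  shows "measure_pmf.prob (Pi_pmf {..<K} d' (\<lambda>_. Pi_pmf {1..N} d (\<lambda>_. pmf_of_set {1..m})))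
    {\<omega>. \<not> fits_distinct K m \<eta> (\<lambda>j. Max (insert 0 (\<omega> j ` I))) (card I)}
    \<le> (real m + 1) * (2 * exp (- 2 * real K * \<eta>\<^sup>2))"
proof -
  let ?Q = "Pi_pmf {1..N} d (\<lambda>_. pmf_of_set {1..m})"
  let ?P = "Pi_pmf {..<K} d' (\<lambda>_. ?Q)"
  define B where "B \<theta> = {u. \<forall>i\<in>I. u i \<le> \<theta>}" for \<theta> :: nat
  have fin: "finite I" using assms(1) finite_subset by blast
  have mx: "Max (insert 0 (u ` I)) \<le> \<theta> \<longleftrightarrow> u \<in> B \<theta>" for u :: "nat \<Rightarrow> nat" and \<theta>
    using fin by (auto simp: B_def)
  have "{\<omega>. \<not> fits_distinct K m \<eta> (\<lambda>j. Max (insert 0 (\<omega> j ` I))) (card I)} =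
    (\<Union>\<theta>\<in>{..m}. {\<omega>. \<bar>real (card {j. j < K \<and> \<omega> j \<in> B \<theta>}) / real K - measure_pmf.prob ?Q (B \<theta>)\<bar> \<ge> \<eta>})"
    unfolding fits_distinct_def mx using prob_all_le[OF assms(1,2), of _ d]
    by (auto simp: B_def not_less)
  then have "measure_pmf.prob ?P {\<omega>. \<not> fits_distinct K m \<eta> (\<lambda>j. Max (insert 0 (\<omega> j ` I))) (card I)} \<le>
    (\<Sum>\<theta>\<in>{..m}. measure_pmf.prob ?P
      {\<omega>. \<bar>real (card {j. j < K \<and> \<omega> j \<in> B \<theta>}) / real K - measure_pmf.prob ?Q (B \<theta>)\<bar> \<ge> \<eta>})"
    by (simp only:) (rule measure_pmf.finite_measure_subadditive_finite, auto)
  also have "\<dots> \<le> (\<Sum>\<theta>\<in>{..m}. 2 * exp (- 2 * real K * \<eta>\<^sup>2))"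
    by (intro sum_mono hoeffding_Pi_pmf(2) assms)
  finally show ?thesis by (simp add: add.commute)
qed

lemma exp_minus_le: "0 \<le> t \<Longrightarrow> t \<le> 1 \<Longrightarrow> exp (- t) \<le> 1 - t / 2" for t :: real
proof -
  assume t: "0 \<le> t" "t \<le> 1"
  have "exp (- t) = 1 / exp t" by (simp add: exp_minus inverse_eq_divide)
  also have "\<dots> \<le> 1 / (1 + t)" using t by (intro divide_left_mono exp_ge_add_one_self) (auto intro: add_pos_nonneg)
  also have "\<dots> \<le> 1 - t / 2"
  proof -
    have "t * t \<le> t" using t mult_left_le[of t t] by simp
    then have "1 \<le> (1 - t / 2) * (1 + t)" by (simp add: algebra_simps)
    then show ?thesis using t by (simp add: divide_le_eq)
  qed
  finally show ?thesis .
qed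

text \<open>The threshold \<open>\<theta> = 2n - \<lfloor>n / F\<rfloor>\<close> is the one at which the fraction of maxima below it
  depends most sensitively on \<open>F\<close>.\<close>

lemma fits_distinct_unique:
  assumes fF: "fits_distinct K (2 * n) (\<epsilon> / 40) h F" and fy: "fits_distinct K (2 * n) (\<epsilon> / 40) h y"
    and Fn: "F \<le> n" and n: "0 < n" and \<epsilon>: "0 < \<epsilon>" "\<epsilon> < 1"
  shows "\<bar>real y - real F\<bar> \<le> \<epsilon> * real F"
proof -
  have close: "\<bar>(real \<theta> / real (2 * n)) ^ F - (real \<theta> / real (2 * n)) ^ y\<bar> < \<epsilon> / 20" if "\<theta> \<le> 2 * n" for \<theta>
  proof -
    define Z where "Z = real (card {j. j < K \<and> h j \<le> \<theta>}) / real K"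
    have "\<bar>Z - (real \<theta> / real (2 * n)) ^ F\<bar> < \<epsilon> / 40" "\<bar>Z - (real \<theta> / real (2 * n)) ^ y\<bar> < \<epsilon> / 40"
      using fF fy that unfolding fits_distinct_def Z_def by blast+
    then show ?thesis by linarith
  qed
  show ?thesis
  proof (cases "F = 0")
    case True
    \<comment> \<open>At threshold \<open>0\<close> the power is \<open>1\<close> for exponent
      \<open>0\<close> and \<open>0\<close> for all others.\<close>
    then have "y = 0" using close[of 0] \<epsilon> by (cases y) auto
    then show ?thesis using True by simp
  next
    case False
    define t where "t = n div F"
    define q where "q = real (2 * n - t) / real (2 * n)"
    have t1: "1 \<le> t" using False Fn by (simp add: t_def div_greater_zero_iff Suc_leI)
    have tF: "t * F \<le> n" by (simp add: t_def)
    have "n < (t + 1) * F"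
      using False dividend_less_times_div[of F n] by (simp add: t_def mult.commute)
    also have "\<dots> \<le> (2 * t) * F" using t1 by (intro mult_right_mono) auto
    finally have nF: "n < 2 * t * F" .
    have tn: "t \<le> n" by (simp add: t_def)
    have q: "q = 1 - real t / (2 * real n)" using tn n by (simp add: q_def of_nat_diff field_simps)
    have tF': "real t * real F \<le> real n" using tF by (metis of_nat_le_iff of_nat_mult)
    have nF': "real n < 2 * (real t * real F)" using nF by (metis (mono_tags, lifting) mult.assoc of_nat_less_iff of_nat_mult of_nat_numeral)
    have up: "real t / (2 * real n) \<le> 1 / (2 * real F)" using tF' n False by (simp add: field_simps)
    have lo: "1 / (4 * real F) \<le> real t / (2 * real n)" using nF' n False by (simp add: field_simps)
    have qh: "1 / 2 \<le> q" using tn n by (simp add: q field_simps)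
    have q1: "q \<le> 1" using q by simp
    \<comment> \<open>Bernoulli's inequality keeps \<open>q ^ F\<close> at least
      \<open>1 / 2\<close>, because \<open>1 - q\<close> is at most
      \<open>1 / (2 * F)\<close>.\<close>
    have "1 + real F * (- (real t / (2 * real n))) \<le> (1 + (- (real t / (2 * real n)))) ^ F"
      using qh q by (intro Bernoulli_inequality) simp
    moreover have "real F * (real t / (2 * real n)) \<le> 1 / 2"
      using tF' n by (simp add: field_simps)
    ultimately have qF: "1 / 2 \<le> q ^ F" unfolding q by simp
    have expq: "q ^ k \<le> exp (- (real k / (4 * real F)))" for k
    proof -
      have "q \<le> exp (- (1 / (4 * real F)))"
        using exp_ge_add_one_self[of "- (1 / (4 * real F))"] lo q by linarith
      then have "q ^ k \<le> exp (- (1 / (4 * real F))) ^ k" using qh by (intro power_mono) auto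
      then show ?thesis by (simp add: exp_of_nat_mult[symmetric])
    qed
    \<comment> \<open>If the exponents differ by more than \<open>\<epsilon> * F\<close>, then
      \<open>q ^ (b - a)\<close> is at most
      \<open>exp (- (\<epsilon> / 4)) \<le> 1 - \<epsilon> / 8\<close>. As
      \<open>q ^ a \<ge> 1 / 2\<close>, the powers differ by at least
      \<open>\<epsilon> / 16\<close>, more than the tolerance
      \<open>\<epsilon> / 20\<close>.\<close>
    have gap: False if ab: "a \<le> b" "1 / 2 \<le> q ^ a" "\<epsilon> * real F < real b - real a" "q ^ a - q ^ b < \<epsilon> / 20" for a b
    proof -
      have "\<epsilon> / 4 \<le> real (b - a) / (4 * real F)" using ab False by (simp add: of_nat_diff field_simps)
      then have "q ^ (b - a) \<le> exp (- (\<epsilon> / 4))" using expq[of "b - a"] by (smt (verit) exp_le_cancel_iff)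
      also have "\<dots> \<le> 1 - \<epsilon> / 8" using exp_minus_le[of "\<epsilon> / 4"] \<epsilon> by simp
      finally have "q ^ a * q ^ (b - a) \<le> q ^ a * (1 - \<epsilon> / 8)" using ab(2) by (intro mult_left_mono) auto
      then have "q ^ b \<le> q ^ a * (1 - \<epsilon> / 8)" using ab(1) by (simp add: power_add[symmetric])
      then have "q ^ a * (\<epsilon> / 8) < \<epsilon> / 20" using ab(4) by (simp add: algebra_simps)
      moreover have "1 / 2 * (\<epsilon> / 8) \<le> q ^ a * (\<epsilon> / 8)" using ab(2) \<epsilon> by (intro mult_right_mono) auto
      ultimately show False using \<epsilon> by simp
    qed
    have c: "\<bar>q ^ F - q ^ y\<bar> < \<epsilon> / 20" using close[of "2 * n - t"] by (simp add: q_def)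
    show ?thesis
    proof (rule ccontr)
      assume neg: "\<not> ?thesis"
      have eF: "0 \<le> \<epsilon> * real F" using \<epsilon> by simp
      show False
      proof (cases "F \<le> y")
        case True
        have "\<epsilon> * real F < real y - real F" "q ^ F - q ^ y < \<epsilon> / 20"
          using True neg c by linarith+
        then show False using gap[of F y] qF True by blast
      next
        case False
        \<comment> \<open>For \<open>y < F\<close> the larger power is \<open>q ^ y\<close>, so
          \<open>gap\<close> applies with the roles exchanged.\<close>
        then have "q ^ F \<le> q ^ y" using qh q1 by (intro power_decreasing) auto
        then have "1 / 2 \<le> q ^ y" using qF by linarith
        moreover have "\<epsilon> * real F < real F - real y" "q ^ y - q ^ F < \<epsilon> / 20"
          using False neg c by linarith+
        ultimately show False using gap[of y F] False by force
      qed
    qed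
  qed
qed

section \<open>Moments of random signed sums\<close>

lemma rademacher_moments:
  fixes f :: "'a \<Rightarrow> real"
  assumes "finite I"
  defines "P \<equiv> \<lambda>I. Pi_pmf I False (\<lambda>_. bernoulli_pmf (1 / 2))"
    and "S \<equiv> \<lambda>I s. \<Sum>i\<in>I. if s i then f i else - f i"
  shows "measure_pmf.expectation (P I) (\<lambda>s. (S I s)\<^sup>2) = (\<Sum>i\<in>I. (f i)\<^sup>2) \<and>
    measure_pmf.expectation (P I) (\<lambda>s. (S I s) ^ 4) \<le> 3 * (\<Sum>i\<in>I. (f i)\<^sup>2)\<^sup>2"
  using assms(1)
proof (induction I rule: finite_induct)
  case empty
  then show ?case by (simp add: P_def S_def)
next
  case (insert i I)
  have finb: "finite (set_pmf (bernoulli_pmf (1 / 2)))" by (rule finite_subset[OF subset_UNIV]) simp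
  have [simp]: "integrable (measure_pmf (P I)) h" for h :: "_ \<Rightarrow> real"
    unfolding P_def by (intro integrable_measure_pmf_finite finite_set_Pi_pmf insert.hyps finb)
  have upd: "S (insert i I) (s(i := y)) = (if y then f i else - f i) + S I s" for s y
  proof -
    have "(\<Sum>j\<in>I. if (s(i := y)) j then f j else - f j) = S I s"
      unfolding S_def using insert.hyps by (intro sum.cong) auto
    then show ?thesis using insert.hyps by (simp add: S_def)
  qed
  \<comment> \<open>Conditioning on the new sign averages over \<open>f i\<close> and
    \<open>- f i\<close>, which cancels the odd powers below.\<close>
  have E: "measure_pmf.expectation (P (insert i I)) h =
     (measure_pmf.expectation (P I) (\<lambda>s. h (s(i := True))) +
      measure_pmf.expectation (P I) (\<lambda>s. h (s(i := False)))) / 2" for h :: "_ \<Rightarrow> real"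
    unfolding P_def by (subst expectation_Pi_pmf_insert[OF insert.hyps finb finb]) simp
  have "measure_pmf.expectation (P (insert i I)) (\<lambda>s. (S (insert i I) s)\<^sup>2) =
     (measure_pmf.expectation (P I) (\<lambda>s. (f i + S I s)\<^sup>2 + (- f i + S I s)\<^sup>2)) / 2"
    unfolding E upd by simp
  also have "(\<lambda>s. (f i + S I s)\<^sup>2 + (- f i + S I s)\<^sup>2) = (\<lambda>s. 2 * (f i)\<^sup>2 + 2 * (S I s)\<^sup>2)"
    by (auto simp: power2_eq_square algebra_simps)
  finally have 2: "measure_pmf.expectation (P (insert i I)) (\<lambda>s. (S (insert i I) s)\<^sup>2) =
      (\<Sum>i\<in>insert i I. (f i)\<^sup>2)"
    using insert by simp
  have "measure_pmf.expectation (P (insert i I)) (\<lambda>s. (S (insert i I) s) ^ 4) =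
     (measure_pmf.expectation (P I) (\<lambda>s. (f i + S I s) ^ 4 + (- f i + S I s) ^ 4)) / 2"
    unfolding E upd by simp
  also have "(\<lambda>s. (f i + S I s) ^ 4 + (- f i + S I s) ^ 4) =
      (\<lambda>s. 2 * (f i) ^ 4 + 12 * (f i)\<^sup>2 * (S I s)\<^sup>2 + 2 * (S I s) ^ 4)"
    by (auto simp: power4_eq_xxxx power2_eq_square algebra_simps)
  also have "measure_pmf.expectation (P I) \<dots> / 2 =
      (f i) ^ 4 + 6 * (f i)\<^sup>2 * (\<Sum>i\<in>I. (f i)\<^sup>2) + measure_pmf.expectation (P I) (\<lambda>s. (S I s) ^ 4)"
    using insert.IH by simp
  also have "\<dots> \<le> (f i) ^ 4 + 6 * (f i)\<^sup>2 * (\<Sum>i\<in>I. (f i)\<^sup>2) + 3 * (\<Sum>i\<in>I. (f i)\<^sup>2)\<^sup>2"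
    using insert.IH by simp
  \<comment> \<open>Expanding the square gives the same terms with \<open>3 * (f i) ^ 4\<close> in
    place of \<open>(f i) ^ 4\<close>.\<close>
  also have "\<dots> \<le> 3 * ((f i)\<^sup>2 + (\<Sum>i\<in>I. (f i)\<^sup>2))\<^sup>2"
    by (simp add: power2_sum algebra_simps flip: power_mult)
  finally show ?case using 2 insert.hyps by simp
qed

section \<open>Uniform sampling by random permutations\<close>

definition max_node :: "nat set \<Rightarrow> (nat \<Rightarrow> nat) \<Rightarrow> nat" where
  "max_node W \<pi> = (THE w. w \<in> W \<and> (\<forall>v\<in>W. \<pi> v \<le> \<pi> w))"

lemma max_node_eqI:
  assumes "inj_on \<pi> W" "w \<in> W" "\<And>v. v \<in> W \<Longrightarrow> \<pi> v \<le> \<pi> w"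
  shows "max_node W \<pi> = w"
  unfolding max_node_def
proof (rule the_equality)
  show "w \<in> W \<and> (\<forall>v\<in>W. \<pi> v \<le> \<pi> w)" using assms by blast
  fix w' assume w': "w' \<in> W \<and> (\<forall>v\<in>W. \<pi> v \<le> \<pi> w')"
  then have "\<pi> w' = \<pi> w" using assms by (intro antisym) auto
  then show "w' = w" using assms w' by (auto dest: inj_onD)
qed

lemma max_node:
  assumes "inj_on \<pi> W" "finite W" "W \<noteq> {}"
  shows "max_node W \<pi> \<in> W" "v \<in> W \<Longrightarrow> \<pi> v \<le> \<pi> (max_node W \<pi>)"
proof -
  have "Max (\<pi> ` W) \<in> \<pi> ` W" using assms by (intro Max_in) auto
  then obtain w where w: "w \<in> W" "\<pi> w = Max (\<pi> ` W)" by auto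
  have "max_node W \<pi> = w" using assms w by (intro max_node_eqI) auto
  with w assms show "max_node W \<pi> \<in> W" "v \<in> W \<Longrightarrow> \<pi> v \<le> \<pi> (max_node W \<pi>)" by auto
qed

text \<open>Composition with the transposition of two nodes of \<open>W\<close> permutes the
  permutations of \<open>U\<close> and moves the maximal node along. Hence all nodes of
  \<open>W\<close> are equally likely.\<close>

lemma max_node_uniform:
  assumes U: "finite U" "W \<subseteq> U" "W \<noteq> {}"
  shows "map_pmf (max_node W) (pmf_of_set {\<pi>. \<pi> permutes U}) = pmf_of_set W"
proof -
  let ?P = "{\<pi>. \<pi> permutes U}"
  let ?p = "pmf_of_set ?P" and ?q = "map_pmf (max_node W) (pmf_of_set {\<pi>. \<pi> permutes U})"
  have P: "finite ?P" "?P \<noteq> {}" using finite_permutations[OF U(1)] permutes_id by blast+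
  have fW: "finite W" using U finite_subset by blast
  have inj: "inj_on \<pi> W" if "\<pi> \<in> ?P" for \<pi> using that by (auto intro: permutes_inj_on)
  have sub: "set_pmf ?q \<subseteq> W" using P max_node(1)[OF inj fW U(3)] by auto
  have eq: "pmf ?q v = pmf ?q v'" if v: "v \<in> W" "v' \<in> W" for v v'
  proof -
    let ?t = "Transposition.transpose v v'"
    have t: "?t permutes U" using v U by (intro permutes_swap_id) auto
    have tW: "?t w \<in> W" if "w \<in> W" for w using v that by (auto simp: Transposition.transpose_def)
    have bij: "bij_betw (\<lambda>\<pi>. \<pi> \<circ> ?t) ?P ?P"
      by (rule bij_betwI[where g = "\<lambda>\<pi>. \<pi> \<circ> ?t"]) (auto simp: o_assoc[symmetric] intro: permutes_compose[OF t])
    have comm: "max_node W (\<pi> \<circ> ?t) = ?t (max_node W \<pi>)" if "\<pi> \<in> ?P" for \<pi>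
    proof (rule max_node_eqI)
      have "\<pi> \<circ> ?t \<in> ?P" using that permutes_compose[OF t] by auto
      then show "inj_on (\<pi> \<circ> ?t) W" by (rule inj)
      show "?t (max_node W \<pi>) \<in> W" using max_node(1)[OF inj[OF that] fW U(3)] tW by blast
      show "(\<pi> \<circ> ?t) w \<le> (\<pi> \<circ> ?t) (?t (max_node W \<pi>))" if "w \<in> W" for w
        using max_node(2)[OF inj[OF \<open>\<pi> \<in> ?P\<close>] fW U(3) tW[OF that]] by simp
    qed
    have "?q = map_pmf (max_node W) (map_pmf (\<lambda>\<pi>. \<pi> \<circ> ?t) ?p)"
      using map_pmf_of_set_bij_betw[OF bij P(2,1)] by simp
    also have "\<dots> = map_pmf (\<lambda>\<pi>. ?t (max_node W \<pi>)) ?p"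
      unfolding pmf.map_comp o_def by (rule map_pmf_cong) (use comm P in \<open>auto simp: o_def\<close>)
    also have "\<dots> = map_pmf ?t ?q" by (simp add: pmf.map_comp o_def)
    finally have "pmf ?q v = pmf (map_pmf ?t ?q) (?t v')" by simp
    also have "\<dots> = pmf ?q v'" by (rule pmf_map_inj') simp
    finally show ?thesis .
  qed
  obtain w where w: "w \<in> W" using U by blast
  have "1 = (\<Sum>v\<in>W. pmf ?q v)" by (rule sum_pmf_eq_1[OF fW sub, symmetric])
  also have "\<dots> = (\<Sum>v\<in>W. pmf ?q w)" by (rule sum.cong[OF refl eq[OF _ w]])
  finally have c: "pmf ?q w = 1 / real (card W)" using fW U by (simp add: field_simps)
  show ?thesis
  proof (rule pmf_eqI)
    fix v
    show "pmf ?q v = pmf (pmf_of_set W) v"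
    proof (cases "v \<in> W")
      case True
      then show ?thesis using eq[OF True w] c fW U by simp
    next
      case False
      then have "v \<notin> set_pmf ?q" using sub by blast
      then show ?thesis using False fW U by (simp only: set_pmf_iff) simp
    qed
  qed
qed

text \<open>Jensen's inequality bounds the first sum by
  \<open>s powr (1 - 1 / p) * \<Phi> powr (1 / p)\<close>. In the second sum the factor
  \<open>f i powr (p - 1)\<close> is at most \<open>\<Phi> powr (1 - 1 / p)\<close>, as one term is
  at most the whole of \<open>\<Phi>\<close>. The powers of \<open>\<Phi>\<close> multiply to its
  square.\<close>

lemma power_sum_inequality:
  fixes f :: "'a \<Rightarrow> real"
  assumes I: "finite I" "I \<noteq> {}" and f: "\<And>i. i \<in> I \<Longrightarrow> 0 < f i" and p: "1 < p"
  shows "(\<Sum>i\<in>I. f i) * (\<Sum>i\<in>I. f i powr (2 * p - 1)) \<le>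
    real (card I) powr (1 - 1 / p) * (\<Sum>i\<in>I. f i powr p)\<^sup>2"
proof -
  define s where "s = real (card I)"
  define \<Phi> where "\<Phi> = (\<Sum>i\<in>I. f i powr p)"
  have s: "0 < s" using I by (simp add: s_def card_gt_0_iff)
  have \<Phi>: "0 < \<Phi>" unfolding \<Phi>_def using I f by (intro sum_pos) (auto simp: less_imp_neq[symmetric] dest!: f)
  have sum: "0 < (\<Sum>i\<in>I. f i)" using I f by (intro sum_pos) auto
  have "(\<Sum>i\<in>I. (1 / s) *\<^sub>R f i) powr p \<le> (\<Sum>i\<in>I. (1 / s) * f i powr p)"
    by (rule convex_on_sum[OF I powr_convex]) (use p f s in \<open>auto simp: s_def\<close>)
  then have "((\<Sum>i\<in>I. f i) / s) powr p \<le> \<Phi> / s"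
    by (simp add: \<Phi>_def sum_divide_distrib)
  then have "(((\<Sum>i\<in>I. f i) / s) powr p) powr (1 / p) \<le> (\<Phi> / s) powr (1 / p)"
    using p by (intro powr_mono2) auto
  then have "(\<Sum>i\<in>I. f i) / s \<le> (\<Phi> / s) powr (1 / p)"
    using p s sum by (simp add: powr_powr)
  then have "(\<Sum>i\<in>I. f i) \<le> s * (\<Phi> / s) powr (1 / p)" using s by (simp add: field_simps)
  also have "\<dots> = s powr (1 - 1 / p) * \<Phi> powr (1 / p)"
    using s \<Phi> by (simp add: powr_divide powr_diff)
  finally have 1: "(\<Sum>i\<in>I. f i) \<le> s powr (1 - 1 / p) * \<Phi> powr (1 / p)" .
  have "(\<Sum>i\<in>I. f i powr (2 * p - 1)) \<le> (\<Sum>i\<in>I. f i powr p * \<Phi> powr (1 - 1 / p))"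
  proof (rule sum_mono)
    fix i assume i: "i \<in> I"
    have "f i powr p \<le> \<Phi>" unfolding \<Phi>_def using I i by (intro member_le_sum) auto
    then have "(f i powr p) powr (1 - 1 / p) \<le> \<Phi> powr (1 - 1 / p)" using p by (intro powr_mono2) auto
    moreover have "(f i powr p) powr (1 - 1 / p) = f i powr (p - 1)"
      using p by (simp add: powr_powr algebra_simps)
    ultimately have "f i powr p * f i powr (p - 1) \<le> f i powr p * \<Phi> powr (1 - 1 / p)"
      by (intro mult_left_mono) auto
    then show "f i powr (2 * p - 1) \<le> f i powr p * \<Phi> powr (1 - 1 / p)"
      by (simp add: powr_add[symmetric] algebra_simps)
  qed
  also have "\<dots> = \<Phi> * \<Phi> powr (1 - 1 / p)" by (simp add: \<Phi>_def sum_distrib_right)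
  finally have 2: "(\<Sum>i\<in>I. f i powr (2 * p - 1)) \<le> \<Phi> * \<Phi> powr (1 - 1 / p)" .
  have "(\<Sum>i\<in>I. f i) * (\<Sum>i\<in>I. f i powr (2 * p - 1)) \<le>
      (s powr (1 - 1 / p) * \<Phi> powr (1 / p)) * (\<Phi> * \<Phi> powr (1 - 1 / p))"
    using 1 2 by (intro mult_mono) (auto intro: sum_nonneg)
  also have "\<dots> = s powr (1 - 1 / p) * (\<Phi> * (\<Phi> powr (1 / p) * \<Phi> powr (1 - 1 / p)))" by simp
  also have "\<Phi> powr (1 / p) * \<Phi> powr (1 - 1 / p) = \<Phi>" using \<Phi> by (simp add: powr_add[symmetric])
  finally show ?thesis by (simp add: s_def \<Phi>_def power2_eq_square)
qed

section \<open>Simulation of shared randomness\<close>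

lemma network_if_congest_network:
  assumes "congest_network c n G"
  shows "network (pverts G) (parcs G)"
proof -
  from assms interpret pair_graph G by (simp add: congest_network_def)
  have sym: "symmetric (with_proj G)" by (rule pair_sym_arcs)
  have conn: "strongly_connected (mk_symmetric (with_proj G))"
    using assms by (simp add: congest_network_def Digraph_Component.connected_def)
  show ?thesis
  proof
    show "finite (pverts G)" by (rule pair_finite_verts)
    show "pverts G \<noteq> {}" using conn by (simp add: strongly_connected_def)
    show "parcs G \<subseteq> pverts G \<times> pverts G" using in_arcsD1 in_arcsD2 by auto
    show "sym (parcs G)" using sym by (simp add: symmetric_def)
    fix u v assume "u \<in> pverts G" "v \<in> pverts G"
    then have "u \<rightarrow>\<^sup>*\<^bsub>with_proj (mk_symmetric (with_proj G))\<^esub> v" using conn by (simp add: strongly_connected_def)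
    then have "u \<rightarrow>\<^sup>*\<^bsub>with_proj G\<^esub> v" using sym by (simp add: reachable_mk_symmetric_eq)
    then show "(u, v) \<in> (parcs G)\<^sup>*"
      by (auto simp: reachable_def dest: rtrancl_on_rtranclI)
  qed
qed

lemma graph_diameter_bounds:
  assumes "network (pverts G) (parcs G)"
  shows "u \<in> pverts G \<Longrightarrow> v \<in> pverts G \<Longrightarrow> \<exists>k\<le>graph_diameter G. (u, v) \<in> parcs G ^^ k"
    and "2 \<le> card (pverts G) \<Longrightarrow> 1 \<le> graph_diameter G"
proof -
  interpret network "pverts G" "parcs G" by fact
  have dist: "(u, v) \<in> parcs G ^^ graph_dist G u v" if "u \<in> pverts G" "v \<in> pverts G" for u v
    unfolding graph_dist_def
    by (rule LeastI_ex[where P = "\<lambda>k. (u, v) \<in> parcs G ^^ k"])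
      (use connected_E[OF that] in \<open>simp add: rtrancl_power\<close>)
  have le: "graph_dist G u v \<le> graph_diameter G" if "u \<in> pverts G" "v \<in> pverts G" for u v
    unfolding graph_diameter_def
  proof (rule Max_ge)
    have "{graph_dist G u v |u v. u \<in> pverts G \<and> v \<in> pverts G} =
        (\<lambda>(u, v). graph_dist G u v) ` (pverts G \<times> pverts G)" by auto
    then show "finite {graph_dist G u v |u v. u \<in> pverts G \<and> v \<in> pverts G}" using finite_V by simp
  qed (use that in blast)
  show "\<exists>k\<le>graph_diameter G. (u, v) \<in> parcs G ^^ k" if "u \<in> pverts G" "v \<in> pverts G"
    using dist[OF that] le[OF that] by blast
  assume "2 \<le> card (pverts G)"
  then have "\<not> pverts G \<subseteq> {leader}" using card_mono[of "{leader}" "pverts G"] by auto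
  then obtain v where v: "v \<in> pverts G" "v \<noteq> leader" by blast
  have "graph_dist G leader v \<noteq> 0" using dist[OF leader_in_V v(1)] v(2) by (cases "graph_dist G leader v") auto
  then show "1 \<le> graph_diameter G" using le[OF leader_in_V v(1)] by linarith
qed

section \<open>Counting inputs, and the fixed list of random strings\<close>

definition inputs :: "nat \<Rightarrow> nat \<Rightarrow> (nat set \<times> (nat \<Rightarrow> nat option)) set" where
  "inputs U N = {(V, x). V \<subseteq> {..<U} \<and> valid_vals N V x \<and> (\<forall>v. v \<notin> V \<longrightarrow> x v = None)}"

text \<open>An input is determined by the graph of \<open>x\<close> on \<open>V\<close>, a subset of
  a set with \<open>U * (N + 1)\<close> elements; fixing \<open>None\<close> outside
  \<open>V\<close> makes this injective.\<close>

lemma card_inputs: "finite (inputs U N)" "card (inputs U N) \<le> 2 ^ (U * (N + 1))"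
proof -
  let ?f = "\<lambda>(V, x). (\<lambda>v. (v, x v)) ` V"
  let ?B = "Pow ({..<U} \<times> insert None (Some ` {1..N})) :: (nat \<times> nat option) set set"
  have inj: "inj_on ?f (inputs U N)"
  proof (rule inj_onI, clarify)
    fix V x V' x' assume VV: "(V, x) \<in> inputs U N" "(V', x') \<in> inputs U N"
      and eq: "(\<lambda>v. (v, x v)) ` V = (\<lambda>v. (v, x' v)) ` V'"
    have "fst ` (\<lambda>v. (v, x v)) ` V = fst ` (\<lambda>v. (v, x' v)) ` V'" using eq by simp
    then have V: "V = V'" by (simp add: image_image)
    have "x v = x' v" for v
    proof (cases "v \<in> V")
      case True
      then have "(v, x v) \<in> (\<lambda>v. (v, x' v)) ` V'" using eq by blast
      then show ?thesis by auto
    next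
      case False
      then show ?thesis using VV V by (auto simp: inputs_def)
    qed
    then show "V = V' \<and> x = x'" using V by blast
  qed
  have sub: "?f ` inputs U N \<subseteq> ?B" by (auto simp: inputs_def valid_vals_def)
  have cB: "card ?B = 2 ^ (U * (N + 1))"
    by (simp add: card_Pow card_cartesian_product card_image)
  show "finite (inputs U N)" using inj_on_finite[OF inj sub] by simp
  show "card (inputs U N) \<le> 2 ^ (U * (N + 1))" using card_inj_on_le[OF inj sub] cB by simp
qed

lemma blackboard_cong:
  assumes "\<And>v. v \<in> V \<Longrightarrow> x v = y v"
  shows "blackboard K \<gamma> V x = blackboard K \<gamma> V y"
proof -
  have "agg st (\<lambda>v. \<gamma> st res j v (x v)) V = agg st (\<lambda>v. \<gamma> st res j v (y v)) V" for st res j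
    using assms by (intro agg_cong) auto
  then show ?thesis by (simp add: blackboard_def)
qed

lemma agg_le:
  assumes "finite W" "\<And>v. v \<in> W \<Longrightarrow> f v \<le> \<Gamma>" "card W \<le> n" "1 \<le> n"
  shows "agg st f W \<le> n * \<Gamma>"
proof (cases "st = 0")
  case True
  have "Max (insert 0 (f ` W)) \<le> \<Gamma>" using assms by simp
  also have "\<Gamma> \<le> n * \<Gamma>" using assms(4) by simp
  finally show ?thesis using True by (simp add: agg_def)
next
  case False
  have "sum f W \<le> card W * \<Gamma>" using sum_bounded_above[of W f \<Gamma>] assms by simp
  also have "\<dots> \<le> n * \<Gamma>" using assms by simp
  finally show ?thesis using False by (simp add: agg_def)
qed

lemma real_nat_ceiling_le: "0 \<le> a \<Longrightarrow> real (nat \<lceil>a\<rceil>) \<le> a + 1"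
  by linarith

lemma poly_le_power:
  assumes "2 \<le> n" "N \<le> c * n ^ c" "1 \<le> N"
  shows "c * n ^ c \<le> n ^ (2 * c)" "N + 2 \<le> n ^ (2 * c + 2)"
proof -
  have "c \<le> 2 ^ c" by (simp add: less_imp_le)
  also have "\<dots> \<le> n ^ c" using assms by (intro power_mono) auto
  finally have "c * n ^ c \<le> n ^ c * n ^ c" by simp
  then show 1: "c * n ^ c \<le> n ^ (2 * c)" by (simp add: mult_2 power_add)
  have "N + 2 \<le> 4 * N" using assms by simp
  also have "\<dots> \<le> n\<^sup>2 * n ^ (2 * c)"
    using assms 1 power_mono[of 2 n 2] by (intro mult_mono) auto
  finally show "N + 2 \<le> n ^ (2 * c + 2)" by (simp only: power_add mult.commute)
qed

text \<open>Public random strings are simulated by private randomness as in Newman's theorem: the leader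
  draws an index into a fixed list of polynomially many strings.\<close>

lemma blackboard_algorithm:
  fixes P :: "'w pmf" and \<gamma> :: "'w \<Rightarrow> nat \<Rightarrow> nat list list \<Rightarrow> nat \<Rightarrow> nat \<Rightarrow> nat option \<Rightarrow> nat"
    and dec :: "'w \<Rightarrow> nat list list \<Rightarrow> 'o" and Q :: "nat set \<Rightarrow> (nat \<Rightarrow> nat option) \<Rightarrow> 'o \<Rightarrow> bool"
  assumes n: "2 \<le> n" and N: "1 \<le> N" "N \<le> c * n ^ c" and K: "0 < K"
    and bound: "\<And>w st res j v y. w \<in> set_pmf P \<Longrightarrow> v < c * n ^ c \<Longrightarrow> y = None \<or> (\<exists>i\<in>{1..N}. y = Some i)
      \<Longrightarrow> \<gamma> w st res j v y \<le> n ^ e"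
    and Q_cong: "\<And>V x y. (\<And>v. v \<in> V \<Longrightarrow> x v = y v) \<Longrightarrow> Q V x = Q V y"
    and prob: "\<And>V x. V \<subseteq> {..<c * n ^ c} \<Longrightarrow> finite V \<Longrightarrow> card V = n \<Longrightarrow> valid_vals N V x \<Longrightarrow>
      measure_pmf.prob P {w. \<not> Q V x (dec w (blackboard K (\<gamma> w) V x))} \<le> 1 / (2 * real n ^ k)"
  defines "r \<equiv> 2 * k + 4 * c + e + 4"
  shows "\<exists>A :: (nat option, nat, 'o) congest_alg.
    bandwidth_at_most A ((3 * real r + 1) * log 2 (real n)) \<and>
    (\<forall>G x. congest_network c n G \<and> valid_vals N (pverts G) x \<longrightarrow>
      solves_within A G x (21 * real (graph_diameter G) + 4 * real K + 1) (1 / real n ^ k) (Q (pverts G) x))"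
proof -
  define U where "U = c * n ^ c"
  define \<delta> where "\<delta> = 1 / real n ^ k"
  \<comment> \<open>This makes \<open>S * \<delta>\<^sup>2 / 2\<close> equal to
    \<open>U * (N + 2)\<close>, so that the union bound beats the at most
    \<open>2 ^ (U * (N + 1))\<close> inputs.\<close>
  define S where "S = 2 * n ^ (2 * k) * (U * (N + 2))"
  \<comment> \<open>A common bound for identifiers, seeds and partial aggregates, each polynomial in
    \<open>n\<close>.\<close>
  define M where "M = n ^ r"
  have U1: "1 \<le> U" using order.trans[OF N] by (simp add: U_def)
  have \<delta>: "0 < \<delta>" using n by (simp add: \<delta>_def)
  have S0: "0 < S" using n U1 by (simp add: S_def)
  have Upow: "U \<le> n ^ (2 * c)" and Npow: "N + 2 \<le> n ^ (2 * c + 2)"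
    using poly_le_power[OF n N(2,1)] by (auto simp: U_def)
  have "S \<le> n ^ 1 * n ^ (2 * k) * (n ^ (2 * c) * n ^ (2 * c + 2))"
    unfolding S_def using n Upow Npow by (intro mult_mono) auto
  also have "\<dots> = n ^ (2 * k + 4 * c + 3)"
    unfolding power_add[symmetric] by (rule arg_cong[where f = "\<lambda>i. n ^ i"]) simp
  also have "\<dots> \<le> M" unfolding M_def using n by (intro power_increasing) (auto simp: r_def)
  finally have SM: "S \<le> M" .
  have UM: "U \<le> M" unfolding M_def
    by (rule order.trans[OF Upow power_increasing]) (use n in \<open>auto simp: r_def\<close>)
  have M2: "2 \<le> M"
  proof -
    have "n ^ 1 \<le> M" unfolding M_def using n by (intro power_increasing) (auto simp: r_def)
    then show ?thesis using n by simp
  qed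
  have eM: "n * n ^ e < M"
  proof -
    have "n ^ Suc e < M" unfolding M_def using n by (intro power_strict_increasing) (auto simp: r_def)
    then show ?thesis by simp
  qed
  define Bad where "Bad z = {w. \<not> Q (fst z) (snd z) (dec w (blackboard K (\<gamma> w) (fst z) (snd z)))}" for z
  define X where "X = {z \<in> inputs U N. card (fst z) = n}"
  have finX: "finite X" and cardX: "card X \<le> 2 ^ (U * (N + 1))"
    using card_inputs[of U N] card_mono[of "inputs U N" X] by (auto simp: X_def)
  have small: "real (card X) * exp (- (real S * \<delta>\<^sup>2 / 2)) < 1"
  proof -
    have eq: "real S * \<delta>\<^sup>2 / 2 = real (U * (N + 2))"
      using n by (simp add: S_def \<delta>_def power_mult power_divide power_mult_distrib power2_eq_square
          power_even_eq field_simps)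
    have "real (card X) < exp (real (U * (N + 2)))"
    proof -
      have "real (card X) \<le> 2 ^ (U * (N + 1))" using cardX by (metis of_nat_le_iff of_nat_numeral of_nat_power)
      also have "\<dots> \<le> exp 1 ^ (U * (N + 1))"
        using exp_ge_add_one_self[of 1] by (intro power_mono) auto
      also have "\<dots> = exp (real (U * (N + 1)))" by (simp add: exp_of_nat_mult[symmetric])
      also have "\<dots> < exp (real (U * (N + 2)))" using U1 by simp
      finally show ?thesis .
    qed
    then show ?thesis unfolding eq exp_minus by (simp add: divide_inverse[symmetric] del: of_nat_mult)
  qed
  have "\<exists>\<omega>. (\<forall>s<S. \<omega> s \<in> set_pmf P) \<and> (\<forall>z\<in>X. real (card {s. s < S \<and> \<omega> s \<in> Bad z}) \<le> \<delta> * real S)"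
  proof (rule random_string_list[OF finX _ \<delta> S0 small])
    fix z assume "z \<in> X"
    then have "fst z \<subseteq> {..<c * n ^ c}" "card (fst z) = n" "valid_vals N (fst z) (snd z)"
      by (auto simp: X_def inputs_def U_def)
    moreover from this have "finite (fst z)" using finite_subset by blast
    ultimately show "measure_pmf.prob P (Bad z) \<le> \<delta> / 2"
      using prob[of "fst z" "snd z"] by (simp add: Bad_def \<delta>_def)
  qed
  then obtain \<omega> where \<omega>: "\<And>s. s < S \<Longrightarrow> \<omega> s \<in> set_pmf P"
    and bad: "\<And>z. z \<in> X \<Longrightarrow> real (card {s. s < S \<and> \<omega> s \<in> Bad z}) \<le> \<delta> * real S" by blast
  \<comment> \<open>Three components below \<open>n ^ r\<close> take \<open>3 * r * log 2 n\<close>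
    bits; rounding up costs at most one more, which \<open>log 2 n \<ge> 1\<close> absorbs.\<close>
  define b where "b = nat \<lceil>3 * real r * log 2 (real n)\<rceil>"
  have lg: "1 \<le> log 2 (real n)" using n by (simp add: le_log_iff)
  have b_ge: "3 * real r * log 2 (real n) \<le> real b" unfolding b_def by (rule real_nat_ceiling_ge)
  have b_le: "real b \<le> (3 * real r + 1) * log 2 (real n)"
  proof -
    have "real b \<le> 3 * real r * log 2 (real n) + 1"
      unfolding b_def using lg by (intro real_nat_ceiling_le) auto
    then show ?thesis using lg by (simp add: algebra_simps)
  qed
  have "M ^ 3 \<le> 2 ^ b"
  proof -
    have "real (M ^ 3) = real n ^ (3 * r)" by (simp add: M_def power_mult[symmetric] mult.commute)
    also have "\<dots> = real n powr real (3 * r)" using n by (intro powr_realpow[symmetric]) auto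
    also have "\<dots> = (2 powr log 2 (real n)) powr real (3 * r)" using n by simp
    also have "\<dots> = 2 powr (log 2 (real n) * real (3 * r))" by (simp only: powr_powr)
    also have "\<dots> \<le> 2 powr (real b)" using b_ge by (intro powr_mono) (auto simp: mult_ac)
    also have "\<dots> = real (2 ^ b)" by (simp add: powr_realpow)
    finally show ?thesis by (simp only: of_nat_le_iff)
  qed
  interpret protocol K "\<lambda>st s. \<gamma> (\<omega> s) st" "\<lambda>s. dec (\<omega> s)" .
  obtain en de where code: "valid_code en de M b"
    using message_encoding[OF \<open>M ^ 3 \<le> 2 ^ b\<close>] unfolding valid_code_def by blast
  define A where "A = compiled en de M S"
  have "bandwidth_at_most A ((3 * real r + 1) * log 2 (real n))"
    using bandwidth_compiled[OF code, of S] b_le unfolding A_def bandwidth_at_most_def by fastforce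
  moreover have "solves_within A G x (21 * real (graph_diameter G) + 4 * real K + 1) (1 / real n ^ k) (Q (pverts G) x)"
    if G: "congest_network c n G" and x: "valid_vals N (pverts G) x" for G x
  proof -
    have net: "network (pverts G) (parcs G)" by (rule network_if_congest_network[OF G])
    then interpret network "pverts G" "parcs G" .
    have V: "pverts G \<subseteq> {..<U}" "card (pverts G) = n" using G by (auto simp: congest_network_def U_def)
    \<comment> \<open>The list is good for finitely many normalised inputs. Clearing the values
      outside the graph leads to one of them and changes neither the board nor
      \<open>Q\<close>.\<close>
    define x' where "x' v = (if v \<in> pverts G then x v else None)" for v
    have z: "(pverts G, x') \<in> X" using V x by (auto simp: X_def inputs_def valid_vals_def x'_def)
    have Bad: "\<omega> s \<in> Bad (pverts G, x') \<longleftrightarrow>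
        \<not> Q (pverts G) x (dec (\<omega> s) (blackboard K (\<gamma> (\<omega> s)) (pverts G) x))" for s
      using Q_cong[of "pverts G" x x'] blackboard_cong[of "pverts G" x x']
      by (simp add: Bad_def x'_def)
    show ?thesis
      unfolding A_def
    proof (rule compiled_solves[OF code net graph_diameter_bounds(1)[OF net] K _ M2 S0 SM])
      show "pverts G \<subseteq> {..<M}" using V UM by auto
      fix st s res j W assume s: "s < S" and W: "W \<subseteq> pverts G"
      have "agg st (\<lambda>v. \<gamma> (\<omega> s) st res j v (x v)) W \<le> n * n ^ e"
      proof (rule agg_le)
        show "finite W" using W finite_V finite_subset by blast
        show "card W \<le> n" using card_mono[OF finite_V W] V by simp
        fix v assume "v \<in> W"
        then have "v < c * n ^ c" "x v = None \<or> (\<exists>i\<in>{1..N}. x v = Some i)"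
          using W V x by (auto simp: U_def valid_vals_def)
        then show "\<gamma> (\<omega> s) st res j v (x v) \<le> n ^ e" by (rule bound[OF \<omega>[OF s]])
      qed (use n in simp)
      then show "agg st (\<lambda>v. \<gamma> (\<omega> s) st res j v (x v)) W < M" using eM by simp
    next
      show "real (card {s. s < S \<and> \<not> Q (pverts G) x (dec (\<omega> s) (blackboard K (\<lambda>st. \<gamma> (\<omega> s) st) (pverts G) x))})
          \<le> 1 / real n ^ k * real S"
        using bad[OF z] unfolding Bad \<delta>_def .
    qed auto
  qed
  ultimately show ?thesis by blast
qed

section \<open>Sketches of the moments\<close>

lemma sum_by_value:
  fixes h :: "nat \<Rightarrow> real"
  assumes V: "finite V" and x: "valid_vals N V x"
  shows "(\<Sum>v\<in>{v \<in> V. x v \<noteq> None}. h (the (x v))) = (\<Sum>i=1..N. real (freq V x i) * h i)"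
proof -
  let ?W = "{v \<in> V. x v \<noteq> None}"
  have "(\<Sum>v\<in>?W. h (the (x v))) = (\<Sum>i\<in>{1..N}. \<Sum>v\<in>{v \<in> ?W. the (x v) = i}. h (the (x v)))"
    by (rule sum.group[symmetric]) (use V x in \<open>auto simp: valid_vals_def\<close>)
  also have "\<dots> = (\<Sum>i=1..N. real (freq V x i) * h i)"
  proof (rule sum.cong[OF refl])
    fix i
    have "{v \<in> ?W. the (x v) = i} = {v \<in> V. x v = Some i}" by auto
    then show "(\<Sum>v\<in>{v \<in> ?W. the (x v) = i}. h (the (x v))) = real (freq V x i) * h i"
      by (simp add: freq_def)
  qed
  finally show ?thesis .
qed

lemma support_eq_image:
  assumes "valid_vals N V x" "finite V"
  shows "{i \<in> {1..N}. freq V x i > 0} = (\<lambda>v. the (x v)) ` {v \<in> V. x v \<noteq> None}"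
  using assms by (force simp: valid_vals_def freq_def card_gt_0_iff)

lemma distinct_count_le:
  assumes "finite V" "valid_vals N V x"
  shows "distinct_count N V x \<le> card V" "distinct_count N V x \<le> N"
proof -
  have "distinct_count N V x \<le> card {v \<in> V. x v \<noteq> None}"
    unfolding distinct_count_def support_eq_image[OF assms(2,1)] using assms(1) by (intro card_image_le) auto
  also have "\<dots> \<le> card V" using assms(1) by (intro card_mono) auto
  finally show "distinct_count N V x \<le> card V" .
  have "card {i \<in> {1..N}. freq V x i > 0} \<le> card {1..N}" by (intro card_mono) auto
  then show "distinct_count N V x \<le> N" by (simp add: distinct_count_def)
qed

lemma freq_cong: "(\<And>v. v \<in> V \<Longrightarrow> x v = y v) \<Longrightarrow> freq V x = freq V y"
  unfolding freq_def by (intro ext arg_cong[where f = card]) auto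

definition sample_value :: "nat set \<Rightarrow> (nat \<Rightarrow> nat option) \<Rightarrow> (nat \<Rightarrow> nat) \<Rightarrow> nat" where
  "sample_value V x \<pi> = the (x (max_node {v \<in> V. x v \<noteq> None} \<pi>))"

text \<open>If \<open>W\<close> is nonempty, a uniform node of \<open>W\<close> holds the value
  \<open>i\<close> with probability \<open>f_i / F_1\<close>, which gives both moments.
  \<open>power_sum_inequality\<close> is applied on the support, whose size is at most
  \<open>min (card V) N\<close>.\<close>

lemma sampling_moments:
  fixes p :: real
  assumes V: "V \<subseteq> {..<U}" "finite V" and x: "valid_vals N V x" and p: "2 < p"
  defines "X \<equiv> \<lambda>\<pi>. real (card {v \<in> V. x v \<noteq> None}) * real (freq V x (sample_value V x \<pi>)) powr (p - 1)"
    and "P \<equiv> pmf_of_set {\<pi>. \<pi> permutes {..<U}}"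
  shows "measure_pmf.expectation P X = freq_moment p N V x"
    and "measure_pmf.expectation P (\<lambda>\<pi>. (X \<pi>)\<^sup>2) \<le>
      real (min (card V) N) powr (1 - 1 / p) * (freq_moment p N V x)\<^sup>2"
proof -
  define W where "W = {v \<in> V. x v \<noteq> None}"
  have fW: "finite W" "W \<subseteq> {..<U}" using V by (auto simp: W_def)
  have mom: "measure_pmf.expectation P (\<lambda>\<pi>. h (sample_value V x \<pi>)) =
      (\<Sum>i=1..N. real (freq V x i) * h i) / real (card W)" if "W \<noteq> {}" for h :: "nat \<Rightarrow> real"
  proof -
    have "measure_pmf.expectation P (\<lambda>\<pi>. h (sample_value V x \<pi>)) =
        measure_pmf.expectation (map_pmf (max_node W) P) (\<lambda>v. h (the (x v)))"
      by (simp add: sample_value_def W_def)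
    also have "map_pmf (max_node W) P = pmf_of_set W"
      unfolding P_def by (rule max_node_uniform) (use fW that in auto)
    also have "measure_pmf.expectation (pmf_of_set W) (\<lambda>v. h (the (x v))) =
        (\<Sum>v\<in>W. h (the (x v))) / real (card W)"
      using fW that by (simp add: integral_pmf_of_set)
    finally show ?thesis using sum_by_value[OF V(2) x] by (simp add: W_def)
  qed
  have W0: "freq V x i = 0" if "W = {}" for i using that by (auto simp: W_def freq_def card_eq_0_iff)
  have cW: "real (card W) > 0" if "W \<noteq> {}" using that fW by (simp add: card_gt_0_iff)
  show "measure_pmf.expectation P X = freq_moment p N V x"
  proof (cases "W = {}")
    case True
    then show ?thesis using W0 by (simp add: X_def freq_moment_def)
  next
    case False
    have "measure_pmf.expectation P X =
       real (card W) * ((\<Sum>i=1..N. real (freq V x i) * real (freq V x i) powr (p - 1)) / real (card W))"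
      unfolding X_def W_def[symmetric] mom[OF False, of "\<lambda>i. real (freq V x i) powr (p - 1)", symmetric] by simp
    also have "\<dots> = (\<Sum>i=1..N. real (freq V x i) powr p)"
      using cW[OF False] by (auto intro!: sum.cong simp: powr_mult_base)
    finally show ?thesis by (simp add: freq_moment_def)
  qed
  show "measure_pmf.expectation P (\<lambda>\<pi>. (X \<pi>)\<^sup>2) \<le>
      real (min (card V) N) powr (1 - 1 / p) * (freq_moment p N V x)\<^sup>2"
  proof (cases "W = {}")
    case True
    then show ?thesis using W0 by (simp add: X_def)
  next
    case False
    define I where "I = {i \<in> {1..N}. freq V x i > 0}"
    define f where "f i = real (freq V x i)" for i
    have I: "finite I" "I \<noteq> {}"
      using support_eq_image[OF x V(2)] False fW(1) unfolding I_def W_def by auto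
    have restr: "(\<Sum>i=1..N. h i) = (\<Sum>i\<in>I. h i)" if "\<And>i. f i = 0 \<Longrightarrow> h i = 0" for h :: "nat \<Rightarrow> real"
      using that by (intro sum.mono_neutral_right) (auto simp: I_def f_def)
    have cI: "card I \<le> min (card V) N"
      using distinct_count_le[OF V(2) x] by (simp add: I_def distinct_count_def)
    have card: "real (card W) = (\<Sum>i\<in>I. f i)"
      using sum_by_value[OF V(2) x, of "\<lambda>_. 1"] restr[of f] by (simp add: W_def f_def)
    have "measure_pmf.expectation P (\<lambda>\<pi>. (X \<pi>)\<^sup>2) =
       (real (card W))\<^sup>2 * ((\<Sum>i=1..N. f i * (f i powr (p - 1))\<^sup>2) / real (card W))"
      unfolding X_def W_def[symmetric] mom[OF False, of "\<lambda>i. (f i powr (p - 1))\<^sup>2", folded f_def, symmetric]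
      by (simp add: power_mult_distrib f_def)
    also have "\<dots> = real (card W) * (\<Sum>i=1..N. f i * (f i powr (p - 1))\<^sup>2)"
      using cW[OF False] by (simp add: power2_eq_square)
    also have "(\<Sum>i=1..N. f i * (f i powr (p - 1))\<^sup>2) = (\<Sum>i\<in>I. f i powr (2 * p - 1))"
    proof -
      have "f i * (f i powr (p - 1))\<^sup>2 = f i powr (2 * p - 1)" for i
      proof -
        have "f i * (f i powr (p - 1))\<^sup>2 = f i * f i powr (2 * p - 2)"
          by (simp add: power2_eq_square powr_add[symmetric])
        also have "\<dots> = f i powr (2 * p - 1)"
          using powr_mult_base[of "f i" "2 * p - 2"] by (simp add: f_def algebra_simps)
        finally show ?thesis .
      qed
      then show ?thesis using restr[of "\<lambda>i. f i powr (2 * p - 1)"] by simp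
    qed
    also have "real (card W) * (\<Sum>i\<in>I. f i powr (2 * p - 1)) \<le>
        real (card I) powr (1 - 1 / p) * (\<Sum>i\<in>I. f i powr p)\<^sup>2"
      unfolding card by (rule power_sum_inequality) (use I p in \<open>auto simp: I_def f_def\<close>)
    also have "(\<Sum>i\<in>I. f i powr p) = freq_moment p N V x"
      using restr[of "\<lambda>i. f i powr p"] by (simp add: freq_moment_def f_def)
    also have "real (card I) powr (1 - 1 / p) * (freq_moment p N V x)\<^sup>2 \<le>
        real (min (card V) N) powr (1 - 1 / p) * (freq_moment p N V x)\<^sup>2"
      using cI p by (intro mult_right_mono powr_mono2) auto
    finally show ?thesis .
  qed
qed

lemma blackboard_nth:
  assumes "j < K"
  shows "blackboard K \<gamma> V x ! 0 ! j = agg 0 (\<lambda>v. \<gamma> 0 [] j v (x v)) V"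
    and "blackboard K \<gamma> V x ! 1 ! j = agg 1 (\<lambda>v. \<gamma> 1 [blackboard K \<gamma> V x ! 0] j v (x v)) V"
  using assms by (auto simp: blackboard_def Let_def)

lemma slot_index:
  fixes i j b L :: nat
  assumes "i < L" "j < b"
  shows "i * b + j < L * b" "(i * b + j) div b = i" "(i * b + j) mod b = j"
proof -
  have "i * b + j < i * b + b" using assms by simp
  also have "\<dots> = Suc i * b" by simp
  also have "\<dots> \<le> L * b" using assms by (intro mult_right_mono) auto
  finally show "i * b + j < L * b" .
qed (use assms in auto)

section \<open>The sketch for \<open>F_0\<close> and \<open>F_2\<close>\<close>

type_synonym sketch02 = "(nat \<Rightarrow> nat \<Rightarrow> nat) \<times> (nat \<Rightarrow> nat \<Rightarrow> nat \<Rightarrow> bool)"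

definition sketch02_pmf :: "nat \<Rightarrow> nat \<Rightarrow> nat \<Rightarrow> nat \<Rightarrow> sketch02 pmf" where
  "sketch02_pmf n N L b = pair_pmf
     (Pi_pmf {..<L * b} (\<lambda>_. 0) (\<lambda>_. Pi_pmf {1..N} 0 (\<lambda>_. pmf_of_set {1..2 * n})))
     (Pi_pmf {..<L} (\<lambda>_ _. False) (\<lambda>_. Pi_pmf {..<b} (\<lambda>_. False)
       (\<lambda>_. Pi_pmf {1..N} False (\<lambda>_. bernoulli_pmf (1 / 2)))))"

text \<open>Nodes with equal values contribute equally to a maximum, so multiplicities do not enter
  \<open>F_0\<close>. As contributions are natural numbers, the second pass counts positive signs;
  twice this count minus the number of nodes with a value, found in slot \<open>L * b\<close>, is
  the signed sum.\<close>

definition sketch02_contrib ::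
    "nat \<Rightarrow> nat \<Rightarrow> sketch02 \<Rightarrow> nat \<Rightarrow> nat list list \<Rightarrow> nat \<Rightarrow> nat \<Rightarrow> nat option \<Rightarrow> nat" where
  "sketch02_contrib L b w st res j v x = (case x of None \<Rightarrow> 0 | Some i \<Rightarrow>
     if st = 0 then fst w j i else of_bool (j = L * b \<or> snd w (j div b) (j mod b) i))"

definition sketch02_decode :: "nat \<Rightarrow> real \<Rightarrow> nat \<Rightarrow> nat \<Rightarrow> nat list list \<Rightarrow> real \<times> real" where
  "sketch02_decode n \<epsilon> L b res =
     (real (SOME y. fits_distinct (L * b) (2 * n) (\<epsilon> / 40) (\<lambda>j. res ! 0 ! j) y),
      majority_value L (\<epsilon> / 3) (\<lambda>i. (\<Sum>j<b. (2 * real (res ! 1 ! (i * b + j)) - real (res ! 1 ! (L * b)))\<^sup>2) / real b))"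

lemma fits_distinct_cong:
  "(\<And>j. j < K \<Longrightarrow> h j = h' j) \<Longrightarrow> fits_distinct K m \<eta> h y = fits_distinct K m \<eta> h' y"
  unfolding fits_distinct_def
  by (intro all_cong arg_cong2[where f = "(<)"] arg_cong[where f = abs] arg_cong2[where f = "(-)"]
      arg_cong2[where f = "(/)"] arg_cong[where f = real] arg_cong[where f = card]) auto

lemma majority_value_cong:
  assumes "\<And>i. i < L \<Longrightarrow> m i = m' i" shows "majority_value L \<xi> m = majority_value L \<xi> m'"
proof -
  have "{i. i < L \<and> \<bar>m i - y\<bar> \<le> \<xi> * y} = {i. i < L \<and> \<bar>m' i - y\<bar> \<le> \<xi> * y}" for y
    using assms by auto
  then show ?thesis by (simp add: majority_value_def)
qed

lemma sketch02_bound: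
  assumes "w \<in> set_pmf (sketch02_pmf n N L b)" "1 \<le> n"
  shows "sketch02_contrib L b w st res j v x \<le> 2 * n"
proof (cases x)
  case None
  then show ?thesis by (simp add: sketch02_contrib_def)
next
  case (Some i)
  have "fst w \<in> set_pmf (Pi_pmf {..<L * b} (\<lambda>_. 0) (\<lambda>_. Pi_pmf {1..N} 0 (\<lambda>_. pmf_of_set {1..2 * n})))"
    using assms by (auto simp: sketch02_pmf_def)
  then have "fst w j = (\<lambda>_. 0) \<or> fst w j \<in> set_pmf (Pi_pmf {1..N} 0 (\<lambda>_. pmf_of_set {1..2 * n}))"
    by (cases "j < L * b") (auto simp: set_Pi_pmf PiE_dflt_def)
  then have "fst w j i \<le> 2 * n"
    using assms(2) by (cases "i \<in> {1..N}") (auto simp: set_Pi_pmf PiE_dflt_def)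
  then show ?thesis using Some assms(2) by (auto simp: sketch02_contrib_def)
qed

text \<open>The decoder errs only if the maxima or the signed sums mislead it, so the two failure
  bounds add up. The constant is \<open>108 = 4 * 3 * 9\<close>, from \<open>median_of_means\<close>
  with the fourth-moment factor \<open>A = 3\<close> and accuracy
  \<open>\<epsilon> / 3\<close>.\<close>

lemma sketch02_fails:
  fixes \<epsilon> :: real
  assumes V: "finite V" "card V = n" and x: "valid_vals N V x" and n: "2 \<le> n"
    and \<epsilon>: "0 < \<epsilon>" "\<epsilon> < 1" and L: "0 < L" and b: "0 < b" "108 / \<epsilon>\<^sup>2 \<le> real b"
  shows "measure_pmf.prob (sketch02_pmf n N L b)
    {w. \<not> (case sketch02_decode n \<epsilon> L b (blackboard (L * b + 1) (sketch02_contrib L b w) V x) of (y0, y2) \<Rightarrow>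
        approximates \<epsilon> (real (distinct_count N V x)) y0 \<and> approximates \<epsilon> (freq_moment 2 N V x) y2)}
    \<le> (2 * real n + 1) * (2 * exp (- 2 * real (L * b) * (\<epsilon> / 40)\<^sup>2)) + exp (- real L / 8)"
proof -
  let ?P0 = "Pi_pmf {..<L * b} (\<lambda>_. 0) (\<lambda>_. Pi_pmf {1..N} 0 (\<lambda>_. pmf_of_set {1..2 * n})) :: (nat \<Rightarrow> nat \<Rightarrow> nat) pmf"
  let ?R = "Pi_pmf {1..N} False (\<lambda>_. bernoulli_pmf (1 / 2))"
  let ?P2 = "Pi_pmf {..<L} (\<lambda>_ _. False) (\<lambda>_. Pi_pmf {..<b} (\<lambda>_. False) (\<lambda>_. ?R))"
  let ?board = "\<lambda>w. blackboard (L * b + 1) (sketch02_contrib L b w) V x"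
  define I where "I = {i \<in> {1..N}. freq V x i > 0}"
  define F0 where "F0 = distinct_count N V x"
  define F2 where "F2 = freq_moment 2 N V x"
  have F0: "F0 = card I" by (simp add: F0_def I_def distinct_count_def)
  define S where "S s = (\<Sum>i=1..N. if s i then real (freq V x i) else - real (freq V x i))" for s :: "nat \<Rightarrow> bool"
  define B0 where "B0 = {\<omega>. \<not> fits_distinct (L * b) (2 * n) (\<epsilon> / 40) (\<lambda>j. Max (insert 0 (\<omega> j ` I))) F0}"
  define B2 where "B2 = {\<omega>. \<not> L < 2 * card {i. i < L \<and> \<bar>(\<Sum>j<b. (S (\<omega> i j))\<^sup>2) / real b - F2\<bar> \<le> \<epsilon> / 3 * F2}}"
  have F2: "F2 = (\<Sum>i=1..N. (real (freq V x i))\<^sup>2)"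
    by (simp add: F2_def freq_moment_def powr_numeral)
  have F2_nonneg: "0 \<le> F2" unfolding F2 by (intro sum_nonneg) auto
  have finR: "finite (set_pmf ?R)"
    by (rule finite_set_Pi_pmf) (auto intro: finite_subset[OF subset_UNIV])
  have mom: "measure_pmf.expectation ?R (\<lambda>s. (S s)\<^sup>2) = F2"
    "measure_pmf.expectation ?R (\<lambda>s. ((S s)\<^sup>2)\<^sup>2) \<le> 3 * F2\<^sup>2"
    using rademacher_moments[of "{1..N}" "\<lambda>i. real (freq V x i)"] unfolding S_def F2
    by (auto simp flip: power_mult)
  have pB0: "measure_pmf.prob ?P0 B0 \<le> (2 * real n + 1) * (2 * exp (- 2 * real (L * b) * (\<epsilon> / 40)\<^sup>2))"
    using prob_not_fits_distinct[of I N "2 * n" "L * b" "\<epsilon> / 40" "\<lambda>_. 0" 0] n L b(1) \<epsilon>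
    unfolding B0_def F0 by (simp add: I_def subset_iff)
  have pB2: "measure_pmf.prob ?P2 B2 \<le> exp (- real L / 8)"
    unfolding B2_def
    by (rule median_of_means[OF finR mom F2_nonneg]) (use \<epsilon> L b in \<open>auto simp: power_divide\<close>)
  have board1: "?board w ! 0 ! j = Max (insert 0 (fst w j ` I))" if "j < L * b" for w j
  proof -
    have "insert 0 ((\<lambda>v. sketch02_contrib L b w 0 [] j v (x v)) ` V) = insert 0 (fst w j ` I)"
      unfolding I_def support_eq_image[OF x V(1)]
      by (force simp: sketch02_contrib_def image_iff split: option.splits)
    then show ?thesis using that by (simp add: blackboard_nth agg_def)
  qed
  have total: "?board w ! 1 ! (L * b) = card {v \<in> V. x v \<noteq> None}" for w
  proof -
    have "?board w ! 1 ! (L * b) = (\<Sum>v\<in>V. of_bool (x v \<noteq> None))"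
      by (subst blackboard_nth) (auto simp: agg_def sketch02_contrib_def intro!: sum.cong split: option.splits)
    then show ?thesis using V(1) by (simp add: Int_def)
  qed
  have board2: "2 * real (?board w ! 1 ! (i * b + j)) - real (?board w ! 1 ! (L * b)) = S (snd w i j)"
    if "i < L" "j < b" for w i j
  proof -
    let ?W = "{v \<in> V. x v \<noteq> None}" and ?s = "snd w i j"
    note idx = slot_index[OF that]
    have "?board w ! 1 ! (i * b + j) = (\<Sum>v\<in>V. case x v of None \<Rightarrow> 0 | Some k \<Rightarrow> of_bool (?s k))"
      by (subst blackboard_nth) (use idx in \<open>auto simp: agg_def sketch02_contrib_def intro!: sum.cong split: option.splits\<close>)
    also have "\<dots> = (\<Sum>v\<in>?W. of_bool (?s (the (x v))))"
      using V(1) by (intro sum.mono_neutral_cong_right) auto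
    finally have "real (?board w ! 1 ! (i * b + j)) = (\<Sum>v\<in>?W. of_bool (?s (the (x v))))" by simp
    moreover have "real (card ?W) = (\<Sum>v\<in>?W. 1)" by simp
    ultimately have "2 * real (?board w ! 1 ! (i * b + j)) - real (?board w ! 1 ! (L * b)) =
       (\<Sum>v\<in>?W. 2 * of_bool (?s (the (x v))) - 1)"
      unfolding total by (simp only: sum_distrib_left sum_subtractf)
    also have "\<dots> = (\<Sum>i=1..N. real (freq V x i) * (2 * of_bool (?s i) - 1))"
      by (rule sum_by_value[OF V(1) x])
    also have "\<dots> = S ?s" unfolding S_def by (intro sum.cong) auto
    finally show ?thesis .
  qed
  have good: "case sketch02_decode n \<epsilon> L b (?board w) of (y0, y2) \<Rightarrow>
      approximates \<epsilon> (real F0) y0 \<and> approximates \<epsilon> F2 y2" if w: "fst w \<notin> B0" "snd w \<notin> B2" for w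
  proof -
    define y where "y = (SOME y. fits_distinct (L * b) (2 * n) (\<epsilon> / 40) (\<lambda>j. ?board w ! 0 ! j) y)"
    have fit: "fits_distinct (L * b) (2 * n) (\<epsilon> / 40) (\<lambda>j. ?board w ! 0 ! j) F0"
      using w(1) unfolding B0_def by (subst fits_distinct_cong[OF board1]) auto
    then have "fits_distinct (L * b) (2 * n) (\<epsilon> / 40) (\<lambda>j. ?board w ! 0 ! j) y"
      unfolding y_def by (rule someI)
    then have "\<bar>real y - real F0\<bar> \<le> \<epsilon> * real F0"
      using fit distinct_count_le(1)[OF V(1) x] V(2) n \<epsilon> by (intro fits_distinct_unique) (auto simp: F0_def)
    then have 0: "approximates \<epsilon> (real F0) (real y)" by (simp add: approximates_def abs_le_iff algebra_simps)
    have "majority_value L (\<epsilon> / 3) (\<lambda>i. (\<Sum>j<b. (2 * real (?board w ! 1 ! (i * b + j)) - real (?board w ! 1 ! (L * b)))\<^sup>2) / real b)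
      = majority_value L (\<epsilon> / 3) (\<lambda>i. (\<Sum>j<b. (S (snd w i j))\<^sup>2) / real b)"
      by (intro majority_value_cong arg_cong2[where f = "(/)"] sum.cong arg_cong[where f = "\<lambda>a. a\<^sup>2"] refl board2) auto
    moreover have "approximates \<epsilon> F2 (majority_value L (\<epsilon> / 3) (\<lambda>i. (\<Sum>j<b. (S (snd w i j))\<^sup>2) / real b))"
      using w(2) F2_nonneg \<epsilon> by (intro majority_value_approximates) (auto simp: B2_def)
    ultimately show ?thesis using 0 by (simp add: sketch02_decode_def y_def)
  qed
  have "measure_pmf.prob (sketch02_pmf n N L b)
      {w. \<not> (case sketch02_decode n \<epsilon> L b (?board w) of (y0, y2) \<Rightarrow>
        approximates \<epsilon> (real F0) y0 \<and> approximates \<epsilon> F2 y2)} \<le>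
    measure_pmf.prob (sketch02_pmf n N L b) (fst -` B0 \<union> snd -` B2)"
  proof (rule measure_pmf.finite_measure_mono, rule subsetI, rule ccontr)
    fix w assume bad: "w \<in> {w. \<not> (case sketch02_decode n \<epsilon> L b (?board w) of (y0, y2) \<Rightarrow>
        approximates \<epsilon> (real F0) y0 \<and> approximates \<epsilon> F2 y2)}" and "w \<notin> fst -` B0 \<union> snd -` B2"
    then have "fst w \<notin> B0" "snd w \<notin> B2" by auto
    from good[OF this] bad show False unfolding mem_Collect_eq by contradiction
  qed simp
  also have "\<dots> \<le> measure_pmf.prob (sketch02_pmf n N L b) (fst -` B0) +
      measure_pmf.prob (sketch02_pmf n N L b) (snd -` B2)"
    by (rule measure_subadditive) auto
  also have "measure_pmf.prob (sketch02_pmf n N L b) (fst -` B0) = measure_pmf.prob ?P0 B0"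
    by (simp add: sketch02_pmf_def map_fst_pair_pmf flip: measure_map_pmf)
  also have "measure_pmf.prob (sketch02_pmf n N L b) (snd -` B2) = measure_pmf.prob ?P2 B2"
    by (simp add: sketch02_pmf_def map_snd_pair_pmf flip: measure_map_pmf)
  finally show ?thesis using pB0 pB2 unfolding F0_def F2_def by linarith
qed

section \<open>The sketch for \<open>F_p\<close>\<close>

definition sketchp_pmf :: "nat \<Rightarrow> nat \<Rightarrow> nat \<Rightarrow> (nat \<Rightarrow> nat \<Rightarrow> nat \<Rightarrow> nat) pmf" where
  "sketchp_pmf U L b = Pi_pmf {..<L} (\<lambda>_. id)
     (\<lambda>_. Pi_pmf {..<b} id (\<lambda>_. pmf_of_set {\<pi>. \<pi> permutes {..<U}}))"

text \<open>In stage \<open>0\<close> the winner's value is encoded in the low-order digit to the base \<open>N + 1\<close>; slot \<open>L * b\<close>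
  counts the nodes that hold a value.\<close>

definition sketchp_contrib :: "nat \<Rightarrow> nat \<Rightarrow> nat \<Rightarrow> (nat \<Rightarrow> nat \<Rightarrow> nat \<Rightarrow> nat) \<Rightarrow>
    nat \<Rightarrow> nat list list \<Rightarrow> nat \<Rightarrow> nat \<Rightarrow> nat option \<Rightarrow> nat" where
  "sketchp_contrib N L b w st res j v x = (case x of None \<Rightarrow> 0 | Some i \<Rightarrow>
     if st = 0 then w (j div b) (j mod b) v * (N + 1) + i
     else of_bool (j = L * b \<or> res ! 0 ! j mod (N + 1) = i))"

definition sketchp_decode :: "real \<Rightarrow> real \<Rightarrow> nat \<Rightarrow> nat \<Rightarrow> nat list list \<Rightarrow> real" where
  "sketchp_decode p \<epsilon> L b res = majority_value L (\<epsilon> / 3)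
     (\<lambda>i. (\<Sum>j<b. real (res ! 1 ! (L * b)) * real (res ! 1 ! (i * b + j)) powr (p - 1)) / real b)"

text \<open>The defaults are identities and hence permutations, so indices outside the range are
  covered as well.\<close>

lemma sketchp_component:
  assumes "w \<in> set_pmf (sketchp_pmf U L b)"
  shows "w i j permutes {..<U}"
proof -
  have P: "finite {\<pi>. \<pi> permutes {..<U}}" "{\<pi>. \<pi> permutes {..<U}} \<noteq> {}"
    using finite_permutations[of "{..<U}"] permutes_id by blast+
  have "w i = (\<lambda>_. id) \<or> w i \<in> set_pmf (Pi_pmf {..<b} id (\<lambda>_. pmf_of_set {\<pi>. \<pi> permutes {..<U}}))"
    using assms unfolding sketchp_pmf_def by (cases "i < L") (auto simp: set_Pi_pmf PiE_dflt_def)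
  then have "w i j = id \<or> w i j \<in> {\<pi>. \<pi> permutes {..<U}}"
    using P by (cases "j < b") (auto simp: set_Pi_pmf PiE_dflt_def)
  then show ?thesis using permutes_id by auto
qed

lemma sketchp_bound:
  assumes "w \<in> set_pmf (sketchp_pmf U L b)" "v < U" "x = None \<or> (\<exists>i\<in>{1..N}. x = Some i)"
  shows "sketchp_contrib N L b w st res j v x \<le> U * (N + 1) + N"
proof -
  have "w (j div b) (j mod b) v < U"
    using sketchp_component[OF assms(1)] assms(2) permutes_in_image by fastforce
  then have "w (j div b) (j mod b) v * (N + 1) \<le> U * (N + 1)" by (intro mult_right_mono) auto
  then show ?thesis using assms(3) by (auto simp: sketchp_contrib_def)
qed

text \<open>The constant is \<open>36 = 4 * 9\<close>, from \<open>median_of_means\<close> with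
  accuracy \<open>\<epsilon> / 3\<close>. The slots reproduce \<open>X\<close> for \<open>w\<close>
  in the support, where all components are permutations; hence the events are compared almost
  surely.\<close>

lemma sketchp_fails:
  fixes \<epsilon> p :: real
  assumes V: "finite V" "V \<subseteq> {..<U}" and x: "valid_vals N V x" and p: "2 < p"
    and \<epsilon>: "0 < \<epsilon>" "\<epsilon> < 1" and L: "0 < L" and b: "0 < b" "36 * real (min (card V) N) powr (1 - 1 / p) / \<epsilon>\<^sup>2 \<le> real b"
  shows "measure_pmf.prob (sketchp_pmf U L b)
    {w. \<not> approximates \<epsilon> (freq_moment p N V x)
      (sketchp_decode p \<epsilon> L b (blackboard (L * b + 1) (sketchp_contrib N L b w) V x))} \<le> exp (- real L / 8)"
proof -
  let ?P = "pmf_of_set {\<pi>. \<pi> permutes {..<U}}"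
  let ?board = "\<lambda>w. blackboard (L * b + 1) (sketchp_contrib N L b w) V x"
  let ?W = "{v \<in> V. x v \<noteq> None}"
  have perms: "finite {\<pi>. \<pi> permutes {..<U}}" "{\<pi>. \<pi> permutes {..<U}} \<noteq> {}"
    using finite_permutations[of "{..<U}"] permutes_id by blast+
  define F where "F = freq_moment p N V x"
  define X where "X \<pi> = real (card ?W) * real (freq V x (sample_value V x \<pi>)) powr (p - 1)" for \<pi>
  define B where "B = {\<omega>. \<not> L < 2 * card {i. i < L \<and> \<bar>(\<Sum>j<b. X (\<omega> i j)) / real b - F\<bar> \<le> \<epsilon> / 3 * F}}"
  have F: "0 \<le> F" unfolding F_def freq_moment_def by (intro sum_nonneg) auto
  have mom: "measure_pmf.expectation ?P X = F"
    "measure_pmf.expectation ?P (\<lambda>\<pi>. (X \<pi>)\<^sup>2) \<le> real (min (card V) N) powr (1 - 1 / p) * F\<^sup>2"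
    unfolding F_def X_def using sampling_moments[OF V(2,1) x p] by blast+
  have pB: "measure_pmf.prob (sketchp_pmf U L b) B \<le> exp (- real L / 8)"
    unfolding B_def sketchp_pmf_def
    by (rule median_of_means[OF _ mom F]) (use \<epsilon> L b perms in \<open>auto simp: power_divide\<close>)
  have total: "?board w ! 1 ! (L * b) = card ?W" for w
  proof -
    have "?board w ! 1 ! (L * b) = (\<Sum>v\<in>V. of_bool (x v \<noteq> None))"
      by (subst blackboard_nth) (auto simp: agg_def sketchp_contrib_def intro!: sum.cong split: option.splits)
    then show ?thesis using V(1) by (simp add: Int_def)
  qed
  have X_eq: "real (?board w ! 1 ! (L * b)) * real (?board w ! 1 ! (i * b + j)) powr (p - 1) = X (w i j)"
    if ij: "i < L" "j < b" and w: "w \<in> set_pmf (sketchp_pmf U L b)" for w i j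
  proof (cases "?W = {}")
    case True
    then have "card ?W = 0" by (simp only: card.empty)
    then show ?thesis unfolding total X_def by simp
  next
    case False
    note idx = slot_index[OF ij]
    define \<pi> where "\<pi> = w i j"
    have inj: "inj_on \<pi> ?W" using sketchp_component[OF w, of i j] by (auto simp: \<pi>_def intro: permutes_inj_on)
    have fW: "finite ?W" using V(1) by simp
    define u where "u = max_node ?W \<pi>"
    have u: "u \<in> ?W" "\<And>v. v \<in> ?W \<Longrightarrow> \<pi> v \<le> \<pi> u"
      using max_node[OF inj fW False] by (auto simp: u_def)
    obtain k where k: "x u = Some k" "k \<in> {1..N}" using u(1) x by (auto simp: valid_vals_def)
    have "?board w ! 0 ! (i * b + j) =
        Max (insert 0 ((\<lambda>v. sketchp_contrib N L b w 0 [] (i * b + j) v (x v)) ` V))"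
      using idx by (subst blackboard_nth) (auto simp: agg_def)
    also have "\<dots> = \<pi> u * (N + 1) + k"
    proof (rule Max_eqI)
      show "\<pi> u * (N + 1) + k \<in> insert 0 ((\<lambda>v. sketchp_contrib N L b w 0 [] (i * b + j) v (x v)) ` V)"
        using u(1) k idx by (auto simp: sketchp_contrib_def \<pi>_def image_iff intro!: bexI[of _ u])
      fix a assume "a \<in> insert 0 ((\<lambda>v. sketchp_contrib N L b w 0 [] (i * b + j) v (x v)) ` V)"
      then consider "a = 0" | v k' where "v \<in> V" "x v = Some k'" "a = \<pi> v * (N + 1) + k'"
        using idx by (auto simp: sketchp_contrib_def \<pi>_def split: option.splits)
      then show "a \<le> \<pi> u * (N + 1) + k"
      proof cases
        case 2
        show ?thesis
        proof (cases "v = u")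
          case False
          \<comment> \<open>Different nodes have different ranks, and one step in rank outweighs any
            value, as values are at most \<open>N\<close>.\<close>
          have "\<pi> v \<noteq> \<pi> u" using inj 2 u(1) False by (auto dest: inj_onD)
          then have "\<pi> v + 1 \<le> \<pi> u" using u(2)[of v] 2 by auto
          then have "(\<pi> v + 1) * (N + 1) \<le> \<pi> u * (N + 1)" by (intro mult_right_mono) auto
          moreover have "k' \<le> N" using x 2 by (auto simp: valid_vals_def)
          ultimately show ?thesis using 2 by simp
        qed (use 2 k in simp)
      qed simp
    qed (use V(1) in simp)
    finally have "?board w ! 0 ! (i * b + j) mod (N + 1) = k mod (N + 1)" by (simp only: mod_mult_self3)
    also have "\<dots> = k" using k(2) by simp
    finally have "?board w ! 0 ! (i * b + j) mod (N + 1) = k" .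
    then have "?board w ! 1 ! (i * b + j) = (\<Sum>v\<in>V. of_bool (x v = Some k))"
      using idx by (subst blackboard_nth)
        (auto simp: agg_def sketchp_contrib_def intro!: sum.cong split: option.splits)
    also have "\<dots> = freq V x k" using V(1) by (simp add: freq_def Int_def)
    also have "k = sample_value V x \<pi>" using k(1) by (simp add: sample_value_def u_def)
    finally show ?thesis unfolding total X_def \<pi>_def by simp
  qed
  have "measure_pmf.prob (sketchp_pmf U L b)
      {w. \<not> approximates \<epsilon> F (sketchp_decode p \<epsilon> L b (?board w))} \<le> measure_pmf.prob (sketchp_pmf U L b) B"
  proof (rule measure_pmf.finite_measure_mono_AE)
    show "AE w in sketchp_pmf U L b. w \<in> {w. \<not> approximates \<epsilon> F (sketchp_decode p \<epsilon> L b (?board w))} \<longrightarrow> w \<in> B"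
      unfolding AE_measure_pmf_iff
    proof (intro ballI impI, rule ccontr)
      fix w assume w: "w \<in> set_pmf (sketchp_pmf U L b)" and B: "w \<notin> B"
        and bad: "w \<in> {w. \<not> approximates \<epsilon> F (sketchp_decode p \<epsilon> L b (?board w))}"
      have "sketchp_decode p \<epsilon> L b (?board w) = majority_value L (\<epsilon> / 3) (\<lambda>i. (\<Sum>j<b. X (w i j)) / real b)"
        unfolding sketchp_decode_def by (intro majority_value_cong arg_cong2[where f = "(/)"] sum.cong refl)
          (rule X_eq[OF _ _ w], auto)
      moreover have "approximates \<epsilon> F (majority_value L (\<epsilon> / 3) (\<lambda>i. (\<Sum>j<b. X (w i j)) / real b))"
        using B F \<epsilon> by (intro majority_value_approximates) (auto simp: B_def)
      ultimately show False using bad by simp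
    qed
  qed simp
  with pB show ?thesis unfolding F_def by linarith
qed

section \<open>The algorithms\<close>

text \<open>A constant output without communication settles the degenerate cases:
  \<open>n = 1\<close>, where the permitted failure probability is \<open>1\<close> and the
  bandwidth \<open>0\<close>, and \<open>\<epsilon> \<ge> 1\<close>, where \<open>0\<close> is an
  acceptable estimate.\<close>

lemma trivial_algorithm:
  fixes z :: 'o
  shows "\<exists>A :: (nat option, nat, 'o) congest_alg. (\<forall>\<beta>. bandwidth_at_most A \<beta>) \<and>
    (\<forall>G x R \<delta> P. 0 \<le> R \<and> 0 \<le> \<delta> \<and> (1 \<le> \<delta> \<or> P z) \<longrightarrow> solves_within A G x R \<delta> P)"
proof -
  define A :: "(nat option, nat, 'o) congest_alg" where
    "A = \<lparr>alg_init = \<lambda>_ _ _. return_pmf 0, alg_send = \<lambda>_ _. None,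
      alg_step = \<lambda>s _. return_pmf s, alg_output = \<lambda>_. Some z\<rparr>"
  have "solves_within A G x R \<delta> P" if "0 \<le> R" "0 \<le> \<delta>" "1 \<le> \<delta> \<or> P z" for G x R \<delta> P
    unfolding solves_within_def
  proof (intro exI[of _ 0] conjI)
    show "1 - \<delta> \<le> measure_pmf.prob (congest_run A G x 0)
        {\<sigma>. \<forall>v\<in>pverts G. \<exists>y. alg_output A (\<sigma> v) = Some y \<and> P y}"
    proof (cases "P z")
      case True
      then have "{\<sigma> :: nat \<Rightarrow> nat. \<forall>v\<in>pverts G. \<exists>y. alg_output A (\<sigma> v) = Some y \<and> P y} = UNIV"
        by (simp add: A_def)
      then show ?thesis using that by simp
    next
      case False
      then have "1 - \<delta> \<le> 0" using that by simp
      then show ?thesis by (rule order.trans) simp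
    qed
  qed (use that in \<open>auto simp: A_def\<close>)
  moreover have "bandwidth_at_most A \<beta>" for \<beta> by (simp add: A_def bandwidth_at_most_def)
  ultimately show ?thesis by blast
qed

lemma solves_within_mono: "solves_within A G x R \<delta> P \<Longrightarrow> R \<le> R' \<Longrightarrow> solves_within A G x R' \<delta> P"
  unfolding solves_within_def using order.trans by blast

lemma approximates_0: "1 \<le> \<epsilon> \<Longrightarrow> 0 \<le> F \<Longrightarrow> approximates \<epsilon> F 0"
  by (auto simp: approximates_def mult_nonpos_nonneg)

text \<open>The factor \<open>8\<close> in \<open>L\<close> matches the exponent
  \<open>L / 8\<close>, and \<open>800\<close> makes the exponent
  \<open>2 * L * b * (\<epsilon> / 40)\<^sup>2\<close> at least \<open>L\<close>. In the round
  bound, \<open>25632 = 4 * 8 * 801\<close> comes from \<open>4 * L * b\<close> with its roundings,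
  and \<open>26 = 21 + 4 + 1\<close> absorbs the additive constants by
  \<open>D \<ge> 1\<close>.\<close>

lemma sketch_parameters:
  fixes \<epsilon> a :: real and n k :: nat
  assumes n: "2 \<le> n" and \<epsilon>: "0 < \<epsilon>" "\<epsilon> < 1" and a: "1 \<le> a"
  defines "L \<equiv> nat \<lceil>8 * (real k + 6) * log 2 (real n)\<rceil>" and "b \<equiv> nat \<lceil>800 * a / \<epsilon>\<^sup>2\<rceil>"
  shows "0 < L" "0 < b" "800 * a / \<epsilon>\<^sup>2 \<le> real b"
    and "exp (- real L / 8) \<le> 1 / real n ^ (k + 6)"
    and "exp (- 2 * real (L * b) * (\<epsilon> / 40)\<^sup>2) \<le> 1 / real n ^ (k + 6)"
    and "1 \<le> D \<Longrightarrow> 21 * real D + 4 * real (L * b + 1) + 1 \<le>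
      (26 + 25632 * (real k + 7)) * (real D + 1 / \<epsilon>\<^sup>2 * a * log 2 (real n))"
proof -
  have lg: "1 \<le> log 2 (real n)" using n by (simp add: le_log_iff)
  have e2: "0 < \<epsilon>\<^sup>2" "\<epsilon>\<^sup>2 \<le> 1" using \<epsilon> by (auto simp: power_le_one)
  define q where "q = a / \<epsilon>\<^sup>2"
  have q: "1 \<le> q" using a e2 by (simp add: q_def le_divide_eq)
  have L_ge: "8 * (real k + 6) * log 2 (real n) \<le> real L" unfolding L_def by (rule real_nat_ceiling_ge)
  have L_le: "real L \<le> 8 * (real k + 6) * log 2 (real n) + 1"
    unfolding L_def using lg by (intro real_nat_ceiling_le) auto
  have b_le: "real b \<le> 800 * q + 1"
    unfolding b_def q_def using real_nat_ceiling_le[of "800 * a / \<epsilon>\<^sup>2"] a by simp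
  show b_ge: "800 * a / \<epsilon>\<^sup>2 \<le> real b" unfolding b_def by (rule real_nat_ceiling_ge)
  have "0 < 8 * (real k + 6) * log 2 (real n)" using lg by (intro mult_pos_pos) auto
  then have "0 < real L" using L_ge by linarith
  then show "0 < L" by simp
  have "0 < 800 * a / \<epsilon>\<^sup>2" using a e2 by simp
  then have "0 < real b" using b_ge by linarith
  then show "0 < b" by simp
  have ln2: "ln (2 :: real) \<le> 1" using ln_le_minus_one[of 2] by simp
  have lnn: "0 \<le> ln (real n)" using n by simp
  have "ln (real n) * ln 2 \<le> ln (real n) * 1" using ln2 lnn by (intro mult_left_mono) auto
  then have "ln (real n) \<le> log 2 (real n)" by (simp add: log_def field_simps)
  then have "real (k + 6) * ln (real n) \<le> real (k + 6) * log 2 (real n)" by (intro mult_left_mono) auto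
  also have "\<dots> \<le> real L / 8" using L_ge by (simp add: algebra_simps)
  finally have key: "real (k + 6) * ln (real n) \<le> real L / 8" .
  have bound: "exp (- t) \<le> 1 / real n ^ (k + 6)" if "real L / 8 \<le> t" for t
  proof -
    have "exp (- t) \<le> exp (- (real (k + 6) * ln (real n)))" using key that by simp
    also have "\<dots> = 1 / exp (ln (real n)) ^ (k + 6)"
      by (simp only: exp_minus exp_of_nat_mult inverse_eq_divide)
    also have "\<dots> = 1 / real n ^ (k + 6)" using n by simp
    finally show ?thesis .
  qed
  show "exp (- real L / 8) \<le> 1 / real n ^ (k + 6)" using bound[of "real L / 8"] by simp
  have "800 * 1 \<le> real b * \<epsilon>\<^sup>2"
    using b_ge a e2 by (simp add: field_simps)
  then have "real L * 800 \<le> real L * (real b * \<epsilon>\<^sup>2)" by (intro mult_left_mono) auto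
  then have "real L / 8 \<le> 2 * real (L * b) * (\<epsilon> / 40)\<^sup>2" by (simp add: power_divide)
  from bound[OF this] show "exp (- 2 * real (L * b) * (\<epsilon> / 40)\<^sup>2) \<le> 1 / real n ^ (k + 6)" by simp
  assume D: "1 \<le> D"
  have "real L \<le> 8 * (real k + 7) * log 2 (real n)" using L_le lg by (simp add: algebra_simps)
  moreover have "real b \<le> 801 * q" using b_le q by simp
  ultimately have "real L * real b \<le> (8 * (real k + 7) * log 2 (real n)) * (801 * q)"
    using lg by (intro mult_mono) auto
  define \<kappa> where "\<kappa> = 25632 * (real k + 7)"
  define u where "u = q * log 2 (real n)"
  have arith: "21 * d + 4 * (l + 1) + 1 \<le> 26 * d + 26 * v + y + z"
    if "4 * l \<le> z" "0 \<le> v" "0 \<le> y" "1 \<le> d" for d l v y z :: real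
    using that by simp
  have 1: "4 * (real L * real b) \<le> \<kappa> * u"
    using \<open>real L * real b \<le> _\<close> by (simp add: \<kappa>_def u_def algebra_simps)
  have 2: "0 \<le> u" using q lg by (simp add: u_def)
  have 3: "0 \<le> \<kappa> * real D" by (simp add: \<kappa>_def)
  have 4: "(26 + \<kappa>) * (real D + u) = 26 * real D + 26 * u + \<kappa> * real D + \<kappa> * u"
    by (simp add: algebra_simps)
  have 5: "1 / \<epsilon>\<^sup>2 * a * log 2 (real n) = u" by (simp add: u_def q_def)
  have 6: "real (L * b + 1) = real L * real b + 1" "1 \<le> real D" using D by auto
  show "21 * real D + 4 * real (L * b + 1) + 1 \<le>
      (26 + 25632 * (real k + 7)) * (real D + 1 / \<epsilon>\<^sup>2 * a * log 2 (real n))"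
    unfolding \<kappa>_def[symmetric] 5 4 6(1) by (rule arith[OF 1 2 3 6(2)])
qed

lemma moments_02_algorithm:
  fixes \<epsilon> :: real
  assumes n: "1 \<le> n" and N: "1 \<le> N" "N \<le> c * n ^ c" and \<epsilon>: "0 < \<epsilon>"
  shows "\<exists>A :: (nat option, nat, real \<times> real) congest_alg.
    bandwidth_at_most A ((3 * real (2 * k + 4 * c + 2 + 4) + 1) * log 2 (real n)) \<and>
    (\<forall>G x. congest_network c n G \<and> valid_vals N (pverts G) x \<longrightarrow>
      solves_within A G x
        ((26 + 25632 * (real k + 7)) * (real (graph_diameter G) + 1 / \<epsilon>\<^sup>2 * log 2 (real n)))
        (1 / real n ^ k)
        (\<lambda>(y0, y2). approximates \<epsilon> (real (distinct_count N (pverts G) x)) y0 \<and>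
           approximates \<epsilon> (freq_moment 2 N (pverts G) x) y2))"
proof (cases "n = 1 \<or> 1 \<le> \<epsilon>")
  case True
  from trivial_algorithm[where z = "(0, 0) :: real \<times> real"]
  obtain A :: "(nat option, nat, real \<times> real) congest_alg" where
    A: "\<forall>\<beta>. bandwidth_at_most A \<beta>"
      "\<forall>G x R \<delta> P. 0 \<le> R \<and> 0 \<le> \<delta> \<and> (1 \<le> \<delta> \<or> P (0, 0)) \<longrightarrow> solves_within A G x R \<delta> P"
    by (elim exE conjE)
  have "0 \<le> log 2 (real n)" using n by simp
  moreover have "0 \<le> freq_moment 2 N V x" for V :: "nat set" and x
    unfolding freq_moment_def by (intro sum_nonneg) auto
  ultimately show ?thesis using A(1) True
    by (intro exI[of _ A] conjI allI impI A(2)[rule_format]) (auto intro: approximates_0)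
next
  case False
  then have n2: "2 \<le> n" and e1: "\<epsilon> < 1" using n by auto
  define L where "L = nat \<lceil>8 * (real k + 6) * log 2 (real n)\<rceil>"
  define b where "b = nat \<lceil>800 * 1 / \<epsilon>\<^sup>2\<rceil>"
  have par: "0 < L" "0 < b" "800 * 1 / \<epsilon>\<^sup>2 \<le> real b" "exp (- real L / 8) \<le> 1 / real n ^ (k + 6)"
    "exp (- 2 * real (L * b) * (\<epsilon> / 40)\<^sup>2) \<le> 1 / real n ^ (k + 6)"
    "\<And>D. 1 \<le> D \<Longrightarrow> 21 * real D + 4 * real (L * b + 1) + 1 \<le>
      (26 + 25632 * (real k + 7)) * (real D + 1 / \<epsilon>\<^sup>2 * 1 * log 2 (real n))"
    unfolding L_def b_def by (rule sketch_parameters[OF n2 \<epsilon> e1 order_refl]; assumption?)+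
  define Q where "Q V x = (\<lambda>(y0, y2). approximates \<epsilon> (real (distinct_count N V x)) y0 \<and>
      approximates \<epsilon> (freq_moment 2 N V x) y2)" for V :: "nat set" and x
  have "\<exists>A :: (nat option, nat, real \<times> real) congest_alg.
    bandwidth_at_most A ((3 * real (2 * k + 4 * c + 2 + 4) + 1) * log 2 (real n)) \<and>
    (\<forall>G x. congest_network c n G \<and> valid_vals N (pverts G) x \<longrightarrow>
      solves_within A G x (21 * real (graph_diameter G) + 4 * real (L * b + 1) + 1) (1 / real n ^ k) (Q (pverts G) x))"
  proof (rule blackboard_algorithm[OF n2 N, where P = "sketch02_pmf n N L b"
        and \<gamma> = "sketch02_contrib L b" and dec = "\<lambda>_. sketch02_decode n \<epsilon> L b"])
    show "sketch02_contrib L b w st res j v y \<le> n\<^sup>2" if "w \<in> set_pmf (sketch02_pmf n N L b)" for w st res j v y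
    proof -
      have "sketch02_contrib L b w st res j v y \<le> 2 * n" using sketch02_bound[OF that n] .
      also have "\<dots> \<le> n\<^sup>2" using n2 by (simp add: power2_eq_square)
      finally show ?thesis .
    qed
    show "Q V x = Q V y" if "\<And>v. v \<in> V \<Longrightarrow> x v = y v" for V x y
      using freq_cong[of V x y] that by (simp add: Q_def distinct_count_def freq_moment_def)
    fix V :: "nat set" and x assume V: "finite V" "card V = n" "valid_vals N V x"
    define \<xi> where "\<xi> = 1 / real n ^ (k + 6)"
    have "measure_pmf.prob (sketch02_pmf n N L b)
       {w. \<not> Q V x (sketch02_decode n \<epsilon> L b (blackboard (L * b + 1) (sketch02_contrib L b w) V x))}
      \<le> (2 * real n + 1) * (2 * exp (- 2 * real (L * b) * (\<epsilon> / 40)\<^sup>2)) + exp (- real L / 8)"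
      unfolding Q_def
    proof (rule sketch02_fails[OF V n2 \<epsilon> e1 par(1,2)])
      have "108 / \<epsilon>\<^sup>2 \<le> 800 * 1 / \<epsilon>\<^sup>2" by (intro divide_right_mono) auto
      then show "108 / \<epsilon>\<^sup>2 \<le> real b" using par(3) by linarith
    qed
    also have "\<dots> \<le> (2 * real n + 1) * (2 * \<xi>) + \<xi>"
      using par(4,5) unfolding \<xi>_def by (intro add_mono mult_left_mono) auto
    \<comment> \<open>The six spare powers of \<open>n\<close> pay for the \<open>2 * n + 1\<close>
      thresholds, by \<open>2 * (4 * n + 3) \<le> n ^ 6\<close>.\<close>
    also have "\<dots> \<le> 1 / (2 * real n ^ k)"
    proof -
      have "2 * (4 * real n + 3) \<le> 32 * real n" using n2 by simp
      also have "\<dots> \<le> real n ^ 5 * real n" using power_mono[of 2 "real n" 5] n2 by (intro mult_right_mono) auto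
      finally have "2 * (4 * real n + 3) \<le> real n ^ 6" by (simp add: power_Suc2[symmetric] del: power_Suc)
      then have "(4 * real n + 3) / real n ^ 6 \<le> 1 / 2" using n2 by (simp add: divide_le_eq)
      then have "(4 * real n + 3) / real n ^ 6 * (1 / real n ^ k) \<le> 1 / 2 * (1 / real n ^ k)"
        by (intro mult_right_mono) auto
      moreover have "(2 * real n + 1) * (2 * \<xi>) + \<xi> = (4 * real n + 3) * \<xi>" by (simp add: algebra_simps)
      moreover have "(4 * real n + 3) * \<xi> = (4 * real n + 3) / real n ^ 6 * (1 / real n ^ k)"
        by (simp add: \<xi>_def power_add)
      ultimately show ?thesis by simp
    qed
    finally show "measure_pmf.prob (sketch02_pmf n N L b)
       {w. \<not> Q V x (sketch02_decode n \<epsilon> L b (blackboard (L * b + 1) (sketch02_contrib L b w) V x))}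
      \<le> 1 / (2 * real n ^ k)" .
  qed simp
  then obtain A :: "(nat option, nat, real \<times> real) congest_alg" where
    A: "bandwidth_at_most A ((3 * real (2 * k + 4 * c + 2 + 4) + 1) * log 2 (real n))"
      "\<And>G x. congest_network c n G \<Longrightarrow> valid_vals N (pverts G) x \<Longrightarrow>
        solves_within A G x (21 * real (graph_diameter G) + 4 * real (L * b + 1) + 1) (1 / real n ^ k) (Q (pverts G) x)"
    by blast
  show ?thesis
  proof (intro exI[of _ A] conjI allI impI A(1))
    fix G x assume "congest_network c n G \<and> valid_vals N (pverts G) x"
    then have G: "congest_network c n G" and x: "valid_vals N (pverts G) x" by auto
    have "1 \<le> graph_diameter G"
      using graph_diameter_bounds(2)[OF network_if_congest_network[OF G]] G n2 by (simp add: congest_network_def)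
    from solves_within_mono[OF A(2)[OF G x] par(6)[OF this]]
    show "solves_within A G x
        ((26 + 25632 * (real k + 7)) * (real (graph_diameter G) + 1 / \<epsilon>\<^sup>2 * log 2 (real n)))
        (1 / real n ^ k)
        (\<lambda>(y0, y2). approximates \<epsilon> (real (distinct_count N (pverts G) x)) y0 \<and>
           approximates \<epsilon> (freq_moment 2 N (pverts G) x) y2)"
      unfolding Q_def by simp
  qed
qed

lemma moment_p_algorithm:
  fixes \<epsilon> p :: real
  assumes p: "2 < p" and n: "1 \<le> n" and N: "1 \<le> N" "N \<le> c * n ^ c" and \<epsilon>: "0 < \<epsilon>"
  shows "\<exists>A :: (nat option, nat, real) congest_alg.
    bandwidth_at_most A ((3 * real (2 * k + 4 * c + (4 * c + 3) + 4) + 1) * log 2 (real n)) \<and>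
    (\<forall>G x. congest_network c n G \<and> valid_vals N (pverts G) x \<longrightarrow>
      solves_within A G x
        ((26 + 25632 * (real k + 7)) * (real (graph_diameter G) +
           1 / \<epsilon>\<^sup>2 * real (min n N) powr (1 - 1 / p) * log 2 (real n)))
        (1 / real n ^ k)
        (\<lambda>y. approximates \<epsilon> (freq_moment p N (pverts G) x) y))"
proof (cases "n = 1 \<or> 1 \<le> \<epsilon>")
  case True
  from trivial_algorithm[where z = "0 :: real"]
  obtain A :: "(nat option, nat, real) congest_alg" where
    A: "\<forall>\<beta>. bandwidth_at_most A \<beta>"
      "\<forall>G x R \<delta> P. 0 \<le> R \<and> 0 \<le> \<delta> \<and> (1 \<le> \<delta> \<or> P 0) \<longrightarrow> solves_within A G x R \<delta> P"
    by (elim exE conjE)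
  have "0 \<le> log 2 (real n)" using n by simp
  moreover have "0 \<le> freq_moment p N V x" for V :: "nat set" and x
    unfolding freq_moment_def by (intro sum_nonneg) auto
  ultimately show ?thesis using A(1) True
    by (intro exI[of _ A] conjI allI impI A(2)[rule_format]) (auto intro: approximates_0)
next
  case False
  then have n2: "2 \<le> n" and e1: "\<epsilon> < 1" using n by auto
  define a where "a = real (min n N) powr (1 - 1 / p)"
  have a: "1 \<le> a" unfolding a_def using n N(1) p by (intro ge_one_powr_ge_zero) auto
  define L where "L = nat \<lceil>8 * (real k + 6) * log 2 (real n)\<rceil>"
  define b where "b = nat \<lceil>800 * a / \<epsilon>\<^sup>2\<rceil>"
  have par: "0 < L" "0 < b" "800 * a / \<epsilon>\<^sup>2 \<le> real b" "exp (- real L / 8) \<le> 1 / real n ^ (k + 6)"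
    "exp (- 2 * real (L * b) * (\<epsilon> / 40)\<^sup>2) \<le> 1 / real n ^ (k + 6)"
    "\<And>D. 1 \<le> D \<Longrightarrow> 21 * real D + 4 * real (L * b + 1) + 1 \<le>
      (26 + 25632 * (real k + 7)) * (real D + 1 / \<epsilon>\<^sup>2 * a * log 2 (real n))"
    unfolding L_def b_def by (rule sketch_parameters[OF n2 \<epsilon> e1 a]; assumption?)+
  have "\<exists>A :: (nat option, nat, real) congest_alg.
    bandwidth_at_most A ((3 * real (2 * k + 4 * c + (4 * c + 3) + 4) + 1) * log 2 (real n)) \<and>
    (\<forall>G x. congest_network c n G \<and> valid_vals N (pverts G) x \<longrightarrow>
      solves_within A G x (21 * real (graph_diameter G) + 4 * real (L * b + 1) + 1) (1 / real n ^ k)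
        (approximates \<epsilon> (freq_moment p N (pverts G) x)))"
  proof (rule blackboard_algorithm[OF n2 N, where P = "sketchp_pmf (c * n ^ c) L b"
        and \<gamma> = "sketchp_contrib N L b" and dec = "\<lambda>_. sketchp_decode p \<epsilon> L b"
        and Q = "\<lambda>V x. approximates \<epsilon> (freq_moment p N V x)"])
    fix w st res j v y
    assume w: "w \<in> set_pmf (sketchp_pmf (c * n ^ c) L b)" "v < c * n ^ c" "y = None \<or> (\<exists>i\<in>{1..N}. y = Some i)"
    note pw = poly_le_power[OF n2 N(2,1)]
    have "sketchp_contrib N L b w st res j v y \<le> c * n ^ c * (N + 1) + N" by (rule sketchp_bound[OF w])
    also have "\<dots> \<le> n ^ (2 * c) * n ^ (2 * c + 2) + n ^ (2 * c) * n ^ (2 * c + 2)"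
      using pw n2 by (intro add_mono mult_mono order.trans[OF N(2)] order.trans[OF pw(1)]) auto
    also have "\<dots> = 2 * n ^ (4 * c + 2)" unfolding power_add[symmetric] by (simp add: mult.commute)
    also have "\<dots> \<le> n * n ^ (4 * c + 2)" using n2 by simp
    also have "\<dots> = n ^ (4 * c + 3)" by (simp add: numeral_3_eq_3)
    finally show "sketchp_contrib N L b w st res j v y \<le> n ^ (4 * c + 3)" .
  next
    show "approximates \<epsilon> (freq_moment p N V x) = approximates \<epsilon> (freq_moment p N V y)"
      if "\<And>v. v \<in> V \<Longrightarrow> x v = y v" for V x y
      using freq_cong[of V x y] that by (simp add: freq_moment_def)
  next
    fix V x assume V: "V \<subseteq> {..<c * n ^ c}" "finite V" "card V = n" "valid_vals N V x"
    have "measure_pmf.prob (sketchp_pmf (c * n ^ c) L b)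
       {w. \<not> approximates \<epsilon> (freq_moment p N V x)
          (sketchp_decode p \<epsilon> L b (blackboard (L * b + 1) (sketchp_contrib N L b w) V x))} \<le> exp (- real L / 8)"
    proof (rule sketchp_fails[OF V(2,1,4) p \<epsilon> e1 par(1,2)])
      have "36 * a / \<epsilon>\<^sup>2 \<le> 800 * a / \<epsilon>\<^sup>2" using a by (intro divide_right_mono) auto
      then show "36 * real (min (card V) N) powr (1 - 1 / p) / \<epsilon>\<^sup>2 \<le> real b"
        using par(3) V(3) unfolding a_def by simp
    qed
    also have "\<dots> \<le> 1 / real n ^ (k + 6)" by (rule par(4))
    also have "\<dots> \<le> 1 / (2 * real n ^ k)"
    proof -
      have "(2 :: real) ^ 1 \<le> 2 ^ 6" by simp
      also have "\<dots> \<le> real n ^ 6" using n2 by (intro power_mono) auto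
      finally have "2 * real n ^ k \<le> real n ^ (k + 6)" using n2 by (simp add: power_add)
      then show ?thesis using n2 by (intro divide_left_mono) auto
    qed
    finally show "measure_pmf.prob (sketchp_pmf (c * n ^ c) L b)
       {w. \<not> approximates \<epsilon> (freq_moment p N V x)
          (sketchp_decode p \<epsilon> L b (blackboard (L * b + 1) (sketchp_contrib N L b w) V x))} \<le> 1 / (2 * real n ^ k)" .
  qed simp
  then obtain A :: "(nat option, nat, real) congest_alg" where
    A: "bandwidth_at_most A ((3 * real (2 * k + 4 * c + (4 * c + 3) + 4) + 1) * log 2 (real n))"
      "\<And>G x. congest_network c n G \<Longrightarrow> valid_vals N (pverts G) x \<Longrightarrow>
        solves_within A G x (21 * real (graph_diameter G) + 4 * real (L * b + 1) + 1) (1 / real n ^ k)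
          (approximates \<epsilon> (freq_moment p N (pverts G) x))"
    by blast
  show ?thesis
  proof (intro exI[of _ A] conjI allI impI A(1))
    fix G x assume "congest_network c n G \<and> valid_vals N (pverts G) x"
    then have G: "congest_network c n G" and x: "valid_vals N (pverts G) x" by auto
    have "1 \<le> graph_diameter G"
      using graph_diameter_bounds(2)[OF network_if_congest_network[OF G]] G n2 by (simp add: congest_network_def)
    from solves_within_mono[OF A(2)[OF G x] par(6)[OF this]]
    show "solves_within A G x
        ((26 + 25632 * (real k + 7)) * (real (graph_diameter G) +
           1 / \<epsilon>\<^sup>2 * real (min n N) powr (1 - 1 / p) * log 2 (real n)))
        (1 / real n ^ k) (\<lambda>y. approximates \<epsilon> (freq_moment p N (pverts G) x) y)"
      unfolding a_def .
  qed
qed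

theorem theorem5:
  shows
    "(\<forall>c k :: nat. \<exists>B C :: real. \<forall>(n :: nat) (N :: nat) (\<epsilon> :: real).
        1 \<le> n \<and> 1 \<le> N \<and> N \<le> c * n ^ c \<and> 0 < \<epsilon> \<longrightarrow>
        (\<exists>A :: (nat option, nat, real \<times> real) congest_alg.
           bandwidth_at_most A (B * log 2 (real n)) \<and>
           (\<forall>G val. congest_network c n G \<and> valid_vals N (pverts G) val \<longrightarrow>
              solves_within A G val
                (C * (real (graph_diameter G) + 1 / \<epsilon>\<^sup>2 * log 2 (real n)))
                (1 / real n ^ k)
                (\<lambda>(y0, y2).
                   approximates \<epsilon> (real (distinct_count N (pverts G) val)) y0 \<and>
                   approximates \<epsilon> (freq_moment 2 N (pverts G) val) y2))))
   \<and> (\<forall>p :: real. p > 2 \<longrightarrow>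
       (\<forall>c k :: nat. \<exists>B C :: real. \<forall>(n :: nat) (N :: nat) (\<epsilon> :: real).
        1 \<le> n \<and> 1 \<le> N \<and> N \<le> c * n ^ c \<and> 0 < \<epsilon> \<longrightarrow>
        (\<exists>A :: (nat option, nat, real) congest_alg.
           bandwidth_at_most A (B * log 2 (real n)) \<and>
           (\<forall>G val. congest_network c n G \<and> valid_vals N (pverts G) val \<longrightarrow>
              solves_within A G val
                (C * (real (graph_diameter G) +
                   1 / \<epsilon>\<^sup>2 * real (min n N) powr (1 - 1 / p) * log 2 (real n)))
                (1 / real n ^ k)
                (\<lambda>y. approximates \<epsilon> (freq_moment p N (pverts G) val) y)))))"
proof (intro conjI allI impI)
  fix c k :: nat
  show "\<exists>B C :: real. \<forall>(n :: nat) (N :: nat) (\<epsilon> :: real).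
        1 \<le> n \<and> 1 \<le> N \<and> N \<le> c * n ^ c \<and> 0 < \<epsilon> \<longrightarrow>
        (\<exists>A :: (nat option, nat, real \<times> real) congest_alg.
           bandwidth_at_most A (B * log 2 (real n)) \<and>
           (\<forall>G val. congest_network c n G \<and> valid_vals N (pverts G) val \<longrightarrow>
              solves_within A G val
                (C * (real (graph_diameter G) + 1 / \<epsilon>\<^sup>2 * log 2 (real n)))
                (1 / real n ^ k)
                (\<lambda>(y0, y2).
                   approximates \<epsilon> (real (distinct_count N (pverts G) val)) y0 \<and>
                   approximates \<epsilon> (freq_moment 2 N (pverts G) val) y2)))"
    \<comment> \<open>\<open>B\<close> and \<open>C\<close> are left open and read off from the
      lemma; they involve only \<open>c\<close> and \<open>k\<close>, as the order of the
      quantifiers demands.\<close>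
    by (rule exI, rule exI, intro allI impI, elim conjE, rule moments_02_algorithm)
next
  fix p :: real and c k :: nat
  assume p: "2 < p"
  show "\<exists>B C :: real. \<forall>(n :: nat) (N :: nat) (\<epsilon> :: real).
        1 \<le> n \<and> 1 \<le> N \<and> N \<le> c * n ^ c \<and> 0 < \<epsilon> \<longrightarrow>
        (\<exists>A :: (nat option, nat, real) congest_alg.
           bandwidth_at_most A (B * log 2 (real n)) \<and>
           (\<forall>G val. congest_network c n G \<and> valid_vals N (pverts G) val \<longrightarrow>
              solves_within A G val
                (C * (real (graph_diameter G) +
                   1 / \<epsilon>\<^sup>2 * real (min n N) powr (1 - 1 / p) * log 2 (real n)))
                (1 / real n ^ k)
                (\<lambda>y. approximates \<epsilon> (freq_moment p N (pverts G) val) y)))"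
    by (rule exI, rule exI, intro allI impI, elim conjE, rule moment_p_algorithm[OF p])
qed

end
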